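(* Let $K$ be a non-CM number field and let $S$ be a finite set of primes of $K$ including all the infinite ones, with $\mathrm{card}(S)\ge 2$. Then there exists $\alpha\in\mathcal{O}_S^*$ such that, for every positive integer $n$, the ring $\mathbb{Z}[\alpha^n]$ is a subgroup of finite (additive) index in the ring $\mathcal{O}_S$ of $S$-integers.
   Context: The infinite primes of $K$ are the embeddings of $K$ into $\mathbb{C}$ taken up to complex conjugation; the finite primes are the nonzero prime ideals $\mathfrak{p}$ of the ring of integers $\mathcal{O}_K$, with associated valuation $v_{\mathfrak{p}}$. The ring of $S$-integers is $\mathcal{O}_S=\{x\in K: v_{\mathfrak{p}}(x)\ge 0 \text{ for every prime } \mathfrak{p}\notin S\}$ (with $\mathfrak p$ ranging over finite primes), and $\mathcal{O}_S^*$ is its unit group. A number field is totally real if all its embeddings into $\mathbb C$ are real; it is a CM field if it is an imaginary quadratic extension (i.e. a quadratic extension with no real embedding) of a totally real field (so imaginary quadratic fields are CM); it is non-CM if it is not a CM field. *)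

theory Defs
  imports "HOL-Algebra.Algebra" "HOL-Algebra.Algebraic_Closure_Type"
begin

text \<open>
  Number fields, and the rings attached to them, are subsets of an arbitrary ambient type of class
  \<^class>\<open>field_char_0\<close> (a whole type \<open>UNIV\<close> being allowed). In this way the subfields
  of a number field are number fields in the same sense. The constant
  \<^const>\<open>ring_of_type_algebra\<close> turns the ambient type into a \<open>HOL-Algebra\<close> ring.
\<close>

abbreviation subring_of :: "'a::field_char_0 set \<Rightarrow> 'a ring"
  where "subring_of A \<equiv> (ring_of_type_algebra :: 'a ring)\<lparr>carrier := A\<rparr>"

definition number_field :: "'a::field_char_0 set \<Rightarrow> bool"
  where "number_field K \<longleftrightarrow>
    subfield K ring_of_type_algebra \<and> ring.finite_dimension ring_of_type_algebra \<rat> K"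


subsection \<open>Embeddings, totally real fields and CM fields\<close>

text \<open>Embeddings are extensional functions, so that distinct functions differ on \<open>K\<close>.\<close>

definition embeddings :: "'a::field_char_0 set \<Rightarrow> ('a \<Rightarrow> complex) set"
  where "embeddings K = ring_hom (subring_of K) ring_of_type_algebra \<inter> extensional K"

definition real_embedding :: "'a::field_char_0 set \<Rightarrow> ('a \<Rightarrow> complex) \<Rightarrow> bool"
  where "real_embedding K \<sigma> \<longleftrightarrow> \<sigma> \<in> embeddings K \<and> \<sigma> ` K \<subseteq> \<real>"

definition totally_real_field :: "'a::field_char_0 set \<Rightarrow> bool"
  where "totally_real_field K \<longleftrightarrow> number_field K \<and> (\<forall>\<sigma>\<in>embeddings K. real_embedding K \<sigma>)"

definition CM_field :: "'a::field_char_0 set \<Rightarrow> bool"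
  where "CM_field K \<longleftrightarrow> number_field K \<and> (\<nexists>\<sigma>. real_embedding K \<sigma>) \<and>
    (\<exists>F. totally_real_field F \<and> F \<subseteq> K \<and> ring.dimension ring_of_type_algebra 2 F K)"


subsection \<open>Primes\<close>

definition ring_of_integers :: "'a::field_char_0 set \<Rightarrow> 'a set"
  where "ring_of_integers K = {x \<in> K. algebraic_int x}"

definition infinite_primes :: "'a::field_char_0 set \<Rightarrow> ('a \<Rightarrow> complex) set set"
  where "infinite_primes K = (\<lambda>\<sigma>. {\<sigma>, restrict (cnj \<circ> \<sigma>) K}) ` embeddings K"

definition finite_primes :: "'a::field_char_0 set \<Rightarrow> 'a set set"
  where "finite_primes K = {P. primeideal P (subring_of (ring_of_integers K)) \<and> P \<noteq> {0}}"

definition primes_of :: "'a::field_char_0 set \<Rightarrow> (('a \<Rightarrow> complex) set + 'a set) set"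
  where "primes_of K = infinite_primes K <+> finite_primes K"


subsection \<open>Valuations and S-integers\<close>

text \<open>The exponent of \<open>P\<close> in the factorization of the principal ideal generated by a nonzero
  algebraic integer \<open>a\<close>, that is, the largest \<open>n\<close> such that the \<open>n\<close>-th ideal power
  of \<open>P\<close> contains \<open>a\<close>.\<close>

definition ideal_order :: "'a::field_char_0 set \<Rightarrow> 'a set \<Rightarrow> 'a \<Rightarrow> nat"
  where "ideal_order K P a =
    (GREATEST n. a \<in> P [^]\<^bsub>ideals_set (subring_of (ring_of_integers K))\<^esub> n)"

text \<open>Only meaningful for nonzero \<open>x\<close> in \<open>K\<close>; the value at \<open>0\<close>, which is infinite,
  is dealt with separately below.\<close>

definition prime_valuation :: "'a::field_char_0 set \<Rightarrow> 'a set \<Rightarrow> 'a \<Rightarrow> int"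
  where "prime_valuation K P x = (THE v. \<exists>a\<in>ring_of_integers K - {0}. \<exists>b\<in>ring_of_integers K - {0}.
    x = a / b \<and> v = int (ideal_order K P a) - int (ideal_order K P b))"

definition S_integers ::
    "'a::field_char_0 set \<Rightarrow> (('a \<Rightarrow> complex) set + 'a set) set \<Rightarrow> 'a set"
  where "S_integers K S =
    {x \<in> K. \<forall>P\<in>finite_primes K. Inr P \<notin> S \<longrightarrow> x = 0 \<or> prime_valuation K P x \<ge> 0}"

definition int_adjoin :: "'a::field_char_0 \<Rightarrow> 'a set"
  where "int_adjoin \<beta> = range (\<lambda>p :: int poly. poly (map_poly of_int p) \<beta>)"

end

theory Submission
  imports Defs "Jordan_Normal_Form.Char_Poly"
begin

text \<open>
  Some power of every nonzero prime ideal is principal, so there is an algebraic integer \<open>\<delta>\<close> lying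
  in exactly those primes which belong to \<open>S\<close>, and \<open>\<O>\<^sub>S = \<O>\<^sub>K[1/\<delta>]\<close>. Multiplying a power of
  \<open>\<delta>\<close> by units, one finds \<open>\<gamma>\<close> lying in the same primes and having distinct absolute values at
  distinct infinite primes. Let \<open>\<beta> = \<gamma> ^ n\<close>. If two embeddings agree at \<open>\<beta>\<close>, they are complex
  conjugate to each other; as all fibres of \<open>\<sigma> \<mapsto> \<sigma> \<beta>\<close> have the same size, every fibre is then a pair
  of distinct conjugate embeddings, so that \<open>\<rat>(\<beta>)\<close> is totally real and \<open>K\<close> is a CM field.
  Otherwise \<open>K = \<rat>(\<beta>)\<close>, and \<open>\<int>[\<beta>]\<close> has finite index in \<open>\<O>\<^sub>K\<close>. Since \<open>\<beta>\<close> is integral, it belongs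
  to \<open>\<int>[1/\<beta>]\<close>, hence a positive integer multiplies \<open>\<O>\<^sub>S\<close> into \<open>\<int>[1/\<beta>]\<close>, and \<open>\<alpha> = 1/\<gamma>\<close> works.
\<close>

subsection \<open>Rational polynomials and primitive elements\<close>

text \<open>One \<open>\<alpha>\<close> has to serve for every exponent. Hence conjugates are
  separated by absolute value: an inequality of absolute values passes to all powers, while distinct
  numbers may have equal powers. Complex conjugate embeddings always agree in absolute value, and
  this is the only coincidence left to the hypothesis on CM fields. Inverting
  \<open>\<gamma>\<close> is forced when \<open>S\<close> contains finite primes, since
  \<open>\<int>[\<gamma> ^ n]\<close> stays inside the integers of \<open>K\<close>. All finiteness
  comes from two facts, the box principle and the bound 1 for the absolute norm of a nonzero
  algebraic integer. They give finite residue rings, principal powers of ideals, and units: elements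
  of bounded norm that are small at all infinite primes but one generate finitely many ideals, and
  two generators of the same ideal differ by a unit. Neither the full unit theorem nor unique
  factorization of ideals enters; a prime ideal is inverted by means of a principal power, and this
  already makes its valuation additive.\<close>

definition rpoly :: "rat poly \<Rightarrow> 'a::field_char_0 \<Rightarrow> 'a"
  where "rpoly p x = poly (map_poly of_rat p) x"

lemma rpoly_0 [simp]: "rpoly 0 x = 0"
  by (simp add: rpoly_def)

lemma rpoly_1 [simp]: "rpoly 1 x = 1"
  by (simp add: rpoly_def)

lemma rpoly_pCons [simp]: "rpoly (pCons a p) x = of_rat a + x * rpoly p x"
  by (cases "a = 0 \<and> p = 0") (auto simp: rpoly_def map_poly_pCons)

lemma rpoly_add [simp]: "rpoly (p + q) x = rpoly p x + rpoly q x"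
  by (simp add: rpoly_def of_rat_hom.map_poly_hom_add)

lemma rpoly_smult [simp]: "rpoly (smult c p) x = of_rat c * rpoly p x"
  by (simp add: rpoly_def of_rat_hom.map_poly_hom_smult)

lemma rpoly_mult [simp]: "rpoly (p * q) x = rpoly p x * rpoly q x"
  by (induction p) (auto simp: algebra_simps)

lemma rpoly_minus [simp]: "rpoly (- p) x = - rpoly p x"
  by (induction p) (auto simp: of_rat_minus)

lemma rpoly_diff [simp]: "rpoly (p - q) x = rpoly p x - rpoly q x"
  using rpoly_add[of p "- q" x] by simp

lemma rpoly_monom [simp]: "rpoly (monom c n) x = of_rat c * x ^ n"
  by (simp add: rpoly_def map_poly_monom poly_monom)

lemma rpoly_sum: "rpoly (\<Sum>i\<in>A. p i) x = (\<Sum>i\<in>A. rpoly (p i) x)"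
  by (induction A rule: infinite_finite_induct) auto

lemma rpoly_pcompose: "rpoly (pcompose p q) x = rpoly p (rpoly q x)"
  by (induction p) (auto simp: pcompose_pCons)

lemma rpoly_altdef: "rpoly p x = (\<Sum>i\<le>degree p. of_rat (coeff p i) * x ^ i)"
  by (simp add: rpoly_def poly_altdef)

lemma finite_rpoly_roots: "p \<noteq> 0 \<Longrightarrow> finite {x. rpoly p x = 0}"
  unfolding rpoly_def by (intro poly_roots_finite) (auto simp: map_poly_eq_0_iff)

text \<open>If \<open>f\<close> does not divide \<open>g\<close>, the two are coprime, and a Bezout
  identity evaluated at a common root reads \<open>0 = 1\<close>. As \<open>x\<close> may lie in any
  field of characteristic zero, divisibility by \<open>f\<close> carries relations from
  \<open>\<theta>\<close> to its complex conjugates.\<close>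

lemma irreducible_rpoly_zero_iff:
  fixes x :: "'a::field_char_0"
  assumes "Factorial_Ring.irreducible f" and "rpoly f x = 0"
  shows "rpoly g x = 0 \<longleftrightarrow> f dvd g"
proof
  assume "f dvd g"
  then show "rpoly g x = 0" using assms(2) by (auto elim!: dvdE)
next
  assume g: "rpoly g x = 0"
  show "f dvd g"
  proof (rule ccontr)
    assume "\<not> f dvd g"
    then have "coprime f g"
      using assms(1) by (meson irreducible_imp_prime_elem prime_elem_imp_coprime)
    then obtain u v where "u * f + v * g = 1"
      using bezout_coefficients_fst_snd[of f g] by (metis coprime_imp_gcd_eq_1)
    then have "rpoly (u * f + v * g) x = (1 :: 'a)" by simp
    then show False using assms(2) g by simp
  qed
qed

text \<open>In characteristic zero the derivative of \<open>f\<close> is nonzero and of smaller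
  degree, so it cannot be a multiple of \<open>f\<close>. This makes the roots of \<open>f\<close>
  simple.\<close>

lemma irreducible_rpoly_pderiv_nonzero:
  fixes x :: "'a::field_char_0"
  assumes "Factorial_Ring.irreducible f" and "rpoly f x = 0"
  shows "rpoly (pderiv f) x \<noteq> 0"
proof
  assume "rpoly (pderiv f) x = 0"
  then have "f dvd pderiv f" using irreducible_rpoly_zero_iff[OF assms] by simp
  moreover have d: "degree f \<noteq> 0"
  proof
    assume "degree f = 0"
    then obtain c where "f = [:c:]" by (auto elim: degree_eq_zeroE)
    with assms show False by (auto simp: irreducible_def)
  qed
  moreover have "degree (pderiv f) < degree f" using d by (simp add: degree_pderiv)
  moreover have "pderiv f \<noteq> 0" using d by (simp add: pderiv_eq_0_iff)
  ultimately show False using dvd_imp_degree_le by fastforce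
qed

lemma irreducible_rpoly_bezout:
  fixes x :: "'a::field_char_0"
  assumes "Factorial_Ring.irreducible f" and "rpoly f x = 0" and "rpoly p x \<noteq> 0"
  shows "\<exists>u. rpoly u x * rpoly p x = 1"
proof -
  have "\<not> f dvd p" using irreducible_rpoly_zero_iff[OF assms(1,2)] assms(3) by simp
  then have "coprime f p"
    using assms(1) by (meson irreducible_imp_prime_elem prime_elem_imp_coprime)
  then obtain u v where "u * f + v * p = 1"
    using bezout_coefficients_fst_snd[of f p] by (metis coprime_imp_gcd_eq_1)
  then have "rpoly (u * f + v * p) x = (1 :: 'a)" by simp
  then show ?thesis using assms(2) by auto
qed

lemma exists_minimal_polynomial:
  fixes x :: "'a::field_char_0"
  assumes "p \<noteq> 0" and "rpoly p x = 0"
  shows "\<exists>f. Factorial_Ring.irreducible f \<and> lead_coeff f = 1 \<and> rpoly f x = 0"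
proof -
  define n where "n = (LEAST n. \<exists>p. p \<noteq> 0 \<and> rpoly p x = 0 \<and> degree p = n)"
  have "\<exists>p. p \<noteq> 0 \<and> rpoly p x = 0 \<and> degree p = n"
    unfolding n_def by (rule LeastI_ex) (use assms in blast)
  then obtain q where q: "q \<noteq> 0" "rpoly q x = 0" "degree q = n" by blast
  have min: "n \<le> degree p" if "p \<noteq> 0" "rpoly p x = 0" for p
    unfolding n_def by (rule Least_le) (use that in blast)
  have irr: "Factorial_Ring.irreducible q"
  proof (rule Factorial_Ring.irreducibleI)
    show "q \<noteq> 0" by fact
    show "\<not> q dvd 1"
    proof
      assume "q dvd 1"
      then have "degree q = 0" using q(1) by (simp add: is_unit_iff_degree)
      then obtain c where "q = [:c:]" by (auto elim: degree_eq_zeroE)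
      with q(1,2) show False by auto
    qed
    fix a b assume ab: "q = a * b"
    with q have nz: "a \<noteq> 0" "b \<noteq> 0" and deg: "degree a + degree b = n"
      by (auto simp: degree_mult_eq)
    have "rpoly a x = 0 \<or> rpoly b x = 0" using q(2) ab by simp
    then show "a dvd 1 \<or> b dvd 1"
      using min[of a] min[of b] nz deg by (auto simp: is_unit_iff_degree)
  qed
  have "Factorial_Ring.irreducible (smult (inverse (lead_coeff q)) q)"
    using irr q(1) by (simp add: irreducible_smult_field)
  moreover have "lead_coeff (smult (inverse (lead_coeff q)) q) = 1"
    using q(1) by simp
  moreover have "rpoly (smult (inverse (lead_coeff q)) q) x = 0" using q(2) by simp
  ultimately show ?thesis by blast
qed

section \<open>Subfields of finite dimension over the rationals\<close>

global_interpretation rat_vs: vector_space "\<lambda>(q::rat) (x::'a::field_char_0). of_rat q * x"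
  defines rat_span = rat_vs.span and rat_subspace = rat_vs.subspace
  by unfold_locales (auto simp: algebra_simps of_rat_add of_rat_mult)

lemma ring_of_type_algebra_simps [simp]:
  "carrier ring_of_type_algebra = UNIV"
  "x \<otimes>\<^bsub>ring_of_type_algebra\<^esub> y = x * y"
  "x \<oplus>\<^bsub>ring_of_type_algebra\<^esub> y = x + y"
  "\<zero>\<^bsub>ring_of_type_algebra\<^esub> = 0"
  "\<one>\<^bsub>ring_of_type_algebra\<^esub> = 1"
  by (simp_all add: ring_of_type_algebra_def)

lemma line_extension_ring_of_type_algebra:
  "ring.line_extension ring_of_type_algebra F v E =
     {k * v + e | k e. k \<in> F \<and> e \<in> (E :: 'a::field_char_0 set)}"
proof -
  interpret A: ring "ring_of_type_algebra :: 'a ring" by (rule ring_from_type_algebra)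
  show ?thesis
    unfolding A.line_extension_def by (auto simp: set_add_def set_mult_def r_coset_def)
qed

lemma line_extension_rat_span:
  "ring.line_extension ring_of_type_algebra \<rat> v (rat_span B) = rat_span (insert v (B :: 'a::field_char_0 set))"
proof -
  have "(\<exists>k e. x = k * v + e \<and> k \<in> \<rat> \<and> e \<in> rat_span B) \<longleftrightarrow> (\<exists>q. x - of_rat q * v \<in> rat_span B)"
    (is "?l \<longleftrightarrow> ?r") for x
  proof
    assume ?l
    then obtain q e where "x = of_rat q * v + e" "e \<in> rat_span B" by (auto elim: Rats_cases)
    then have "x - of_rat q * v \<in> rat_span B" by simp
    then show ?r by blast
  next
    assume ?r
    then obtain q where "x - of_rat q * v \<in> rat_span B" by blast
    moreover have "x = of_rat q * v + (x - of_rat q * v)" by simp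
    ultimately show ?l using Rats_of_rat by blast
  qed
  then show ?thesis
    unfolding line_extension_ring_of_type_algebra rat_vs.span_insert by auto
qed

lemma dimension_rat_imp_span:
  assumes "ring.dimension ring_of_type_algebra n \<rat> (E :: 'a::field_char_0 set)"
  shows "\<exists>B. finite B \<and> E = rat_span B"
proof -
  interpret A: ring "ring_of_type_algebra :: 'a ring" by (rule ring_from_type_algebra)
  from assms show ?thesis
  proof (induction n "\<rat> :: 'a set" E rule: A.dimension.induct)
    case zero_dim
    then show ?case by (intro exI[of _ "{}"]) (simp add: rat_vs.span_empty)
  next
    case (Suc_dim v E n)
    then obtain B where B: "finite B" "E = rat_span B" by blast
    have "A.line_extension \<rat> v E = rat_span (insert v B)"
      unfolding B(2) by (rule line_extension_rat_span)
    then show ?case using B(1) by blast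
  qed
qed

lemma span_imp_dimension_rat:
  assumes "finite (B :: 'a::field_char_0 set)"
  shows "\<exists>n. ring.dimension ring_of_type_algebra n \<rat> (rat_span B)"
proof -
  interpret A: ring "ring_of_type_algebra :: 'a ring" by (rule ring_from_type_algebra)
  from assms show ?thesis
  proof (induction B)
    case empty
    have "rat_span ({} :: 'a set) = {\<zero>\<^bsub>ring_of_type_algebra\<^esub>}" by (simp add: rat_vs.span_empty)
    then show ?case using A.zero_dim by metis
  next
    case (insert v B)
    then obtain n where n: "A.dimension n \<rat> (rat_span B)" by blast
    show ?case
    \<comment> \<open>\<open>dimension\<close> may only be extended by a vector outside the space
      already built, so a redundant generator is dropped.\<close>
    proof (cases "v \<in> rat_span B")
      case True
      then show ?thesis using n by (auto simp: rat_vs.span_redundant)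
    next
      case False
      have "A.line_extension \<rat> v (rat_span B) = rat_span (insert v B)"
        by (rule line_extension_rat_span)
      moreover have "A.dimension (Suc n) \<rat> (A.line_extension \<rat> v (rat_span B))"
        using False n by (intro A.Suc_dim) auto
      ultimately show ?thesis by auto
    qed
  qed
qed

text \<open>Closure under the total operations of the ambient type. Since
  \<open>inverse 0 = 0\<close>, the zero element needs no exception.\<close>

definition closed_subfield :: "'a::field_char_0 set \<Rightarrow> bool"
  where "closed_subfield K \<longleftrightarrow> 0 \<in> K \<and> 1 \<in> K \<and> (\<forall>x\<in>K. \<forall>y\<in>K. x + y \<in> K \<and> x * y \<in> K) \<and>
    (\<forall>x\<in>K. - x \<in> K \<and> inverse x \<in> K)"

lemma subfield_imp_closed_subfield:
  assumes "subfield K (ring_of_type_algebra :: 'a::field_char_0 ring)"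
  shows "closed_subfield K"
proof -
  interpret A: field "ring_of_type_algebra :: 'a ring" by (rule field_from_type_algebra)
  note S = subringE[OF subfieldE(1)[OF assms]]
  have m: "- x \<in> K" if "x \<in> K" for x
  proof -
    have "\<ominus>\<^bsub>ring_of_type_algebra\<^esub> x = - x"
      by (rule A.minus_equality) simp_all
    then show ?thesis using S(5)[OF that] by simp
  qed
  have i: "inverse x \<in> K" if "x \<in> K" for x
  proof (cases "x = 0")
    case False
    then have "x \<in> K - {\<zero>\<^bsub>ring_of_type_algebra\<^esub>}" using that by simp
    from A.subfield_m_inv[OF assms this] obtain y where "y \<in> K" "x * y = 1" by auto
    then show ?thesis by (metis inverse_unique)
  qed (use S(2) in auto)
  show ?thesis unfolding closed_subfield_def
    using S(2,3,6,7) m i by auto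
qed

lemma closed_subfield_imp_subfield:
  assumes "closed_subfield K"
  shows "subfield K (ring_of_type_algebra :: 'a::field_char_0 ring)"
proof -
  interpret A: field "ring_of_type_algebra :: 'a ring" by (rule field_from_type_algebra)
  have m: "\<ominus>\<^bsub>ring_of_type_algebra\<^esub> x = - x" for x :: 'a
    by (rule A.minus_equality) simp_all
  have i: "inv\<^bsub>ring_of_type_algebra\<^esub> x = inverse x" if "x \<noteq> 0" for x :: 'a
    by (rule A.comm_inv_char) (use that in simp_all)
  have "subring K (ring_of_type_algebra :: 'a ring)"
    using assms m by (intro A.subringI) (auto simp: closed_subfield_def)
  then show ?thesis
    by (rule A.subfieldI') (use assms i in \<open>auto simp: closed_subfield_def\<close>)
qed

lemma of_rat_in_closed_subfield:
  assumes "closed_subfield K"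
  shows "of_rat q \<in> K"
proof -
  have n: "of_nat n \<in> K" for n
    using assms by (induction n) (auto simp: closed_subfield_def)
  have i: "of_int n \<in> K" for n
    using n assms by (cases n) (auto simp: closed_subfield_def simp del: of_nat_Suc)
  obtain a b where "q = Rat.Fract a b" "b > 0" by (cases q)
  then show ?thesis using i assms by (auto simp: of_rat_rat divide_inverse closed_subfield_def)
qed

lemma rpoly_in_closed_subfield:
  assumes "closed_subfield K" and "x \<in> K"
  shows "rpoly p x \<in> K"
  using assms by (induction p) (auto simp: of_rat_in_closed_subfield closed_subfield_def)

lemma closed_subfield_subspace: "closed_subfield K \<Longrightarrow> rat_subspace K"
  by (auto simp: rat_vs.subspace_def closed_subfield_def of_rat_in_closed_subfield)

lemma number_field_iff:
  "number_field K \<longleftrightarrow> closed_subfield K \<and> (\<exists>B. finite B \<and> K = rat_span B)"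
proof -
  interpret A: ring "ring_of_type_algebra :: 'a ring" by (rule ring_from_type_algebra)
  show ?thesis
    unfolding number_field_def A.finite_dimension_def
    using subfield_imp_closed_subfield closed_subfield_imp_subfield
      dimension_rat_imp_span span_imp_dimension_rat by metis
qed

text \<open>Dependence concerns sets, so a repetition among the powers is treated apart; it yields
  the relation \<open>X ^ i - X ^ j\<close>. Without repetition, \<open>card B + 1\<close> powers
  cannot be independent in a space spanned by \<open>B\<close>.\<close>

lemma exists_rational_relation:
  assumes "finite B" and "\<And>n. x ^ n \<in> rat_span B"
  shows "\<exists>p. p \<noteq> 0 \<and> rpoly p (x :: 'a::field_char_0) = 0"
proof (cases "inj (\<lambda>n::nat. x ^ n)")
  case False
  then obtain i j where ij: "i \<noteq> j" "x ^ i = x ^ j" by (auto simp: inj_def)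
  have "coeff (monom (1::rat) i - monom 1 j) i \<noteq> 0" using ij by simp
  then have "monom (1::rat) i - monom 1 j \<noteq> 0" by (metis coeff_0)
  moreover have "rpoly (monom 1 i - monom 1 j) x = 0" using ij by simp
  ultimately show ?thesis by blast
next
  case True
  define V where "V = (\<lambda>n. x ^ n) ` {..card B}"
  have inj: "inj_on (\<lambda>n. x ^ n) {..card B}" using True inj_on_subset by blast
  have "card V = Suc (card B)" unfolding V_def by (subst card_image[OF inj]) simp
  moreover have "V \<subseteq> rat_span B" unfolding V_def using assms(2) by auto
  ultimately have "rat_vs.dependent V"
    using rat_vs.independent_span_bound[OF assms(1), of V] by fastforce
  then obtain u where u: "(\<Sum>v\<in>V. of_rat (u v) * v) = 0" "\<exists>v\<in>V. u v \<noteq> 0"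
    by (subst (asm) rat_vs.dependent_finite) (auto simp: V_def)
  define p where "p = (\<Sum>n\<le>card B. monom (u (x ^ n)) n)"
  have "rpoly p x = (\<Sum>n\<le>card B. of_rat (u (x ^ n)) * x ^ n)"
    by (simp add: p_def rpoly_sum)
  also have "\<dots> = (\<Sum>v\<in>V. of_rat (u v) * v)"
    unfolding V_def by (subst sum.reindex[OF inj]) simp
  finally have "rpoly p x = 0" using u by simp
  moreover have "p \<noteq> 0"
  proof
    assume "p = 0"
    obtain n where n: "n \<le> card B" "u (x ^ n) \<noteq> 0" using u(2) by (auto simp: V_def)
    have "coeff p n = u (x ^ n)" using n(1) by (simp add: p_def coeff_sum sum.delta if_distrib cong: if_cong)
    then show False using n \<open>p = 0\<close> by simp
  qed
  ultimately show ?thesis by blast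
qed

lemma closed_subfield_power: "closed_subfield K \<Longrightarrow> x \<in> K \<Longrightarrow> x ^ n \<in> K"
  by (induction n) (auto simp: closed_subfield_def)

lemma number_field_minimal_polynomial:
  assumes "number_field K" and "x \<in> K"
  shows "\<exists>f. Factorial_Ring.irreducible f \<and> lead_coeff f = 1 \<and> rpoly f x = 0"
proof -
  from assms(1) obtain B where B: "finite B" "K = rat_span B" "closed_subfield K"
    by (auto simp: number_field_iff)
  have "x ^ n \<in> rat_span B" for n using B assms(2) closed_subfield_power by metis
  from exists_rational_relation[OF B(1) this] show ?thesis
    using exists_minimal_polynomial by blast
qed

definition rat_adjoin :: "'a::field_char_0 \<Rightarrow> 'a set"
  where "rat_adjoin x = range (\<lambda>p. rpoly p x)"

lemma rat_adjoin_base: "x \<in> rat_adjoin x"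
  unfolding rat_adjoin_def by (rule image_eqI[of _ _ "[:0, 1:]"]) simp_all

text \<open>Polynomial expressions suffice for a field: the inverse of a nonzero
  \<open>rpoly p x\<close> is again one, by Bezout for \<open>f\<close> and
  \<open>p\<close>.\<close>

lemma rat_adjoin_closed_subfield:
  assumes "Factorial_Ring.irreducible f" and "rpoly f (x::'a::field_char_0) = 0"
  shows "closed_subfield (rat_adjoin x)"
  unfolding closed_subfield_def
proof (intro conjI ballI)
  show "0 \<in> rat_adjoin x" unfolding rat_adjoin_def by (rule image_eqI[of _ _ 0]) simp_all
  show "1 \<in> rat_adjoin x" unfolding rat_adjoin_def by (rule image_eqI[of _ _ 1]) simp_all
  fix a assume "a \<in> rat_adjoin x"
  then obtain p where p: "a = rpoly p x" by (auto simp: rat_adjoin_def)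
  show "- a \<in> rat_adjoin x" unfolding rat_adjoin_def p by (rule image_eqI[of _ _ "- p"]) simp_all
  show "inverse a \<in> rat_adjoin x"
  proof (cases "a = 0")
    case False
    then obtain u where "rpoly u x * a = 1" using irreducible_rpoly_bezout[OF assms] p by blast
    then have "inverse a = rpoly u x" by (metis inverse_unique mult.commute)
    then show ?thesis by (auto simp: rat_adjoin_def)
  qed (use \<open>0 \<in> rat_adjoin x\<close> in simp)
  fix b assume "b \<in> rat_adjoin x"
  then obtain q where q: "b = rpoly q x" by (auto simp: rat_adjoin_def)
  show "a + b \<in> rat_adjoin x" unfolding rat_adjoin_def p q by (rule image_eqI[of _ _ "p + q"]) simp_all
  show "a * b \<in> rat_adjoin x" unfolding rat_adjoin_def p q by (rule image_eqI[of _ _ "p * q"]) simp_all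
qed

lemma rat_adjoin_subset: "closed_subfield K \<Longrightarrow> x \<in> K \<Longrightarrow> rat_adjoin x \<subseteq> K"
  by (auto simp: rat_adjoin_def rpoly_in_closed_subfield)

text \<open>\<open>F\<close> is a set and not a type, so polynomials over \<open>F\<close> are
  polynomials over the ambient field with a condition on their coefficients.\<close>

definition coeffs_in :: "'a::field_char_0 set \<Rightarrow> 'a poly \<Rightarrow> bool"
  where "coeffs_in F p \<longleftrightarrow> (\<forall>i. coeff p i \<in> F)"

lemma coeffs_in_closed:
  assumes "closed_subfield F" "coeffs_in F p" "coeffs_in F q"
  shows "coeffs_in F (p + q)" "coeffs_in F (p - q)" "coeffs_in F (p * q)"
proof -
  have s: "sum g A \<in> F" if "\<And>i. g i \<in> F" for g :: "nat \<Rightarrow> 'a" and A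
    by (induction A rule: infinite_finite_induct) (use that assms(1) in \<open>auto simp: closed_subfield_def\<close>)
  have "a - b \<in> F" if "a \<in> F" "b \<in> F" for a b
    using that assms(1) unfolding closed_subfield_def by (metis diff_conv_add_uminus)
  then show "coeffs_in F (p + q)" "coeffs_in F (p - q)" "coeffs_in F (p * q)"
    using assms s by (auto simp: coeffs_in_def closed_subfield_def coeff_mult)
qed

lemma coeffs_in_pCons:
  assumes "closed_subfield F" "a \<in> F" "coeffs_in F p"
  shows "coeffs_in F (pCons a p)"
  using assms by (auto simp: coeffs_in_def coeff_pCons split: nat.split)

lemma coeffs_in_0: "closed_subfield F \<Longrightarrow> coeffs_in F 0"
  by (simp add: coeffs_in_def closed_subfield_def)

lemma coeffs_in_of_rat: "closed_subfield F \<Longrightarrow> coeffs_in F (map_poly of_rat p)"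
  by (simp add: coeffs_in_def coeff_map_poly of_rat_in_closed_subfield)

lemma coeffs_in_pcompose:
  assumes "closed_subfield F" "coeffs_in F p" "coeffs_in F q"
  shows "coeffs_in F (pcompose p q)"
  using assms(2)
proof (induction p)
  case 0
  then show ?case using assms coeffs_in_0 by simp
next
  case (pCons a p)
  have "coeffs_in F p" "a \<in> F" using pCons.prems
    by (auto simp: coeffs_in_def dest: spec[of _ "Suc _"] spec[of _ 0])
  then show ?case unfolding pcompose_pCons using assms pCons.IH
    by (intro coeffs_in_closed coeffs_in_pCons coeffs_in_0) auto
qed

text \<open>Division with remainder is carried out one leading term at a time, so that every
  intermediate \<open>h'\<close> keeps its coefficients in \<open>F\<close>; the minimality of the
  degree of \<open>m\<close> is available only for such polynomials.\<close>

lemma exists_minimal_polynomial_over: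
  assumes F: "closed_subfield F" and "coeffs_in F p" "p \<noteq> 0" "poly p x = 0"
  shows "\<exists>m. coeffs_in F m \<and> m \<noteq> 0 \<and> poly m x = 0 \<and> (\<forall>h. coeffs_in F h \<longrightarrow> poly h x = 0 \<longrightarrow> m dvd h)"
proof -
  define P where "P = (\<lambda>m. coeffs_in F m \<and> m \<noteq> 0 \<and> poly m x = 0)"
  obtain m where m: "P m" and min: "\<And>h. P h \<Longrightarrow> degree m \<le> degree h"
    using ex_has_least_nat[of P p degree] assms unfolding P_def by blast
  have "m dvd h" if "coeffs_in F h" "poly h x = 0" for h
    using that
  proof (induction "degree h" arbitrary: h rule: less_induct)
    case less
    show ?case
    proof (cases "h = 0")
      case False
      then have "P h" using less.prems by (auto simp: P_def)
      then have le: "degree m \<le> degree h" by (rule min)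
      define c where "c = monom (lead_coeff h / lead_coeff m) (degree h - degree m)"
      have "lead_coeff h / lead_coeff m \<in> F"
        using less.prems m F unfolding divide_inverse
        by (auto simp: P_def coeffs_in_def closed_subfield_def)
      then have c: "coeffs_in F c" using F by (auto simp: c_def coeffs_in_def closed_subfield_def)
      define h' where "h' = h - c * m"
      have h': "coeffs_in F h'" "poly h' x = 0"
        unfolding h'_def using coeffs_in_closed[OF F] c m less.prems by (auto simp: P_def)
      have m0: "m \<noteq> 0" using m by (auto simp: P_def)
      have lc: "lead_coeff h / lead_coeff m \<noteq> 0" using m0 False by simp
      then have "degree c = degree h - degree m" unfolding c_def by (rule degree_monom_eq)
      moreover have "c \<noteq> 0" using lc by (simp add: c_def monom_eq_0_iff)
      ultimately have cm2: "degree (c * m) = degree h"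
        using m0 le by (simp add: degree_mult_eq)
      moreover have "lead_coeff (c * m) = lead_coeff h"
        using m0 lc unfolding lead_coeff_mult c_def by (simp add: degree_monom_eq)
      ultimately have cm: "lead_coeff (c * m) = lead_coeff h" "degree (c * m) = degree h" by auto
      have "m dvd h'"
      \<comment> \<open>Constants are separate: cancelling the leading term of a constant does not
        lower the degree, it gives \<open>h' = 0\<close> outright.\<close>
      proof (cases "degree h = 0")
        case True
        then have "h' = 0" using cm by (metis h'_def degree_0_id eq_iff_diff_eq_0)
        then show ?thesis by simp
      next
        case False
        have "coeff h' (degree h) = 0" using cm by (simp add: h'_def)
        moreover have "degree h' \<le> degree h" unfolding h'_def using cm(2) by (intro degree_diff_le) auto
        ultimately have "degree h' < degree h"
          using False by (metis degree_0 le_neq_implies_less leading_coeff_0_iff neq0_conv)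
        then show ?thesis using less.hyps h' by blast
      qed
      then have "m dvd h' + c * m" by (intro dvd_add) auto
      then show ?thesis unfolding h'_def by simp
    qed simp
  qed
  then show ?thesis using m unfolding P_def by blast
qed

section \<open>The algebraic closure and the theorem of the primitive element\<close>

lemma to_ac_of_rat: "to_ac (of_rat q :: 'a::field_char_0) = of_rat q"
  by (cases q) (simp add: of_rat_rat)

lemma rpoly_to_ac: "rpoly p (to_ac x) = to_ac (rpoly p (x :: 'a::field_char_0))"
  by (induction p) (simp_all add: to_ac_of_rat)

lemma map_poly_to_ac_mult: "map_poly to_ac (p * q) = map_poly to_ac p * map_poly to_ac q"
  by (rule poly_eqI) (simp add: coeff_map_poly coeff_mult to_ac_sum)

lemma map_poly_to_ac_pCons: "map_poly to_ac (pCons a p) = pCons (to_ac a) (map_poly to_ac p)"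
  by (rule poly_eqI) (auto simp: coeff_map_poly coeff_pCons split: nat.split)

lemma map_poly_to_ac_pcompose:
  "map_poly to_ac (pcompose p q) = pcompose (map_poly to_ac p) (map_poly to_ac q)"
proof (induction p)
  case (pCons a p)
  have "map_poly to_ac (u + v) = map_poly to_ac u + map_poly to_ac (v :: 'a poly)" for u v
    by (rule poly_eqI) (simp add: coeff_map_poly)
  then show ?case
    by (simp only: pcompose_pCons map_poly_to_ac_pCons map_poly_to_ac_mult pCons.IH map_poly_0)
qed simp

lemma degree_map_poly_to_ac: "degree (map_poly to_ac p) = degree p"
  by (rule degree_map_poly) auto

lemma map_poly_to_ac_of_rat: "map_poly to_ac (map_poly of_rat p) = map_poly of_rat p"
  by (rule poly_eqI) (simp add: coeff_map_poly to_ac_of_rat)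

text \<open>A nonconstant cofactor of \<open>X - b\<close> would have a root, which is again
  \<open>b\<close>, and \<open>b\<close> would be a double root.\<close>

lemma alg_closed_root_unique_imp_linear:
  fixes p :: "'a::alg_closed_field poly"
  assumes "degree p > 0" and "\<And>w. poly p w = 0 \<Longrightarrow> w = b" and "\<not> [:-b, 1:] ^ 2 dvd p"
  shows "degree p = 1"
proof -
  have "poly p b = 0" using assms(2) alg_closed_imp_poly_has_root[OF assms(1)] by blast
  then obtain q where q: "p = [:-b, 1:] * q" by (auto simp: poly_eq_0_iff_dvd elim: dvdE)
  have "q \<noteq> 0" using assms(1) q by auto
  have "degree q = 0"
  proof (rule ccontr)
    assume "degree q \<noteq> 0"
    then obtain w where w: "poly q w = 0" using alg_closed_imp_poly_has_root by blast
    then have "w = b" using assms(2) q by simp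
    then have "[:-b, 1:] dvd q" using w by (simp add: poly_eq_0_iff_dvd)
    then have "[:-b, 1:] ^ 2 dvd p" unfolding q power2_eq_square by (intro mult_dvd_mono dvd_refl)
    then show False using assms(3) by blast
  qed
  then show ?thesis unfolding q using \<open>q \<noteq> 0\<close> by (subst degree_mult_eq) auto
qed

text \<open>The rational number \<open>c\<close> is chosen such that \<open>b\<close> is the only common root of \<open>g\<close> and
  \<open>f(y - c X)\<close> in the algebraic closure; since \<open>g\<close> is separable, the minimal polynomial of
  \<open>b\<close> over \<open>\<rat>(y)\<close> is then linear.\<close>

lemma primitive_element_two:
  fixes a b :: "'a::field_char_0"
  assumes K: "number_field K" and ab: "a \<in> K" "b \<in> K"
  shows "\<exists>y\<in>K. a \<in> rat_adjoin y \<and> b \<in> rat_adjoin y"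
proof -
  have cK: "closed_subfield K" using K number_field_iff by blast
  obtain f where f: "Factorial_Ring.irreducible f" "rpoly f a = 0"
    using number_field_minimal_polynomial[OF K ab(1)] by blast
  obtain g where g: "Factorial_Ring.irreducible g" "rpoly g b = 0"
    using number_field_minimal_polynomial[OF K ab(2)] by blast
  have nz: "f \<noteq> 0" "g \<noteq> 0" using f g by auto
  define Rf where "Rf = {z :: 'a alg_closure. rpoly f z = 0}"
  define Rg where "Rg = {z :: 'a alg_closure. rpoly g z = 0}"
  have fin: "finite Rf" "finite Rg" using finite_rpoly_roots nz by (auto simp: Rf_def Rg_def)
  \<comment> \<open>\<open>a + c b = z + c w\<close> with \<open>w \<noteq> b\<close> means
    \<open>c = (z - a) / (b - w)\<close>; these finitely many values are avoided. Pairs with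
    \<open>w = b\<close> contribute only 0, by the convention for division by zero.\<close>
  define bad where "bad = (\<lambda>(z, w). (z - to_ac a) / (to_ac b - w)) ` (Rf \<times> Rg)"
  have "finite bad" using fin by (simp add: bad_def)
  moreover have "infinite (range (of_rat :: rat \<Rightarrow> 'a alg_closure))"
    by (simp add: finite_image_iff inj_on_def infinite_UNIV_char_0)
  ultimately obtain c :: rat where c: "of_rat c \<notin> bad"
    by (metis finite_subset image_subsetI)
  define y where "y = a + of_rat c * b"
  have yK: "y \<in> K" using cK ab of_rat_in_closed_subfield[OF cK] by (auto simp: y_def closed_subfield_def)
  define F where "F = rat_adjoin y"
  have F: "closed_subfield F" unfolding F_def
    using number_field_minimal_polynomial[OF K yK] rat_adjoin_closed_subfield by blast
  have yF: "y \<in> F" unfolding F_def by (rule rat_adjoin_base)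
  define G where "G = (map_poly of_rat g :: 'a poly)"
  define H where "H = pcompose (map_poly of_rat f) [:y, - of_rat c:]"
  have G: "coeffs_in F G" "poly G b = 0" "G \<noteq> 0"
    using coeffs_in_of_rat[OF F] g nz by (auto simp: G_def rpoly_def)
  have "- of_rat c \<in> F" using F of_rat_in_closed_subfield[OF F, of c] by (auto simp: closed_subfield_def)
  then have H: "coeffs_in F H" "poly H b = 0"
    using coeffs_in_of_rat[OF F] yF f
    by (auto simp: H_def rpoly_def poly_pcompose y_def algebra_simps
        intro!: coeffs_in_pcompose coeffs_in_pCons coeffs_in_0 F)
  obtain m where m: "coeffs_in F m" "m \<noteq> 0" "poly m b = 0" "m dvd G" "m dvd H"
    using exists_minimal_polynomial_over[OF F G(1,3,2)] G H by metis
  define m' where "m' = map_poly to_ac m"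
  have dm: "degree m > 0"
  proof (rule ccontr)
    assume "\<not> degree m > 0"
    then obtain c where "m = [:c:]" using degree_eq_zeroE by auto
    then show False using m(2,3) by simp
  qed
  have "degree m' = 1"
  proof (rule alg_closed_root_unique_imp_linear)
    show "degree m' > 0" using dm by (simp add: m'_def degree_map_poly_to_ac)
    have m'G: "m' dvd map_poly of_rat g" using m(4) unfolding m'_def G_def
      by (metis dvd_def map_poly_to_ac_mult map_poly_to_ac_of_rat)
    fix w assume w: "poly m' w = 0"
    have "w \<in> Rg" using m'G w by (auto simp: Rg_def rpoly_def elim!: dvdE)
    obtain q where "H = m * q" using m(5) by (auto elim: dvdE)
    then have "map_poly to_ac H = m' * map_poly to_ac q" by (simp add: m'_def map_poly_to_ac_mult)
    then have "poly (map_poly to_ac H) w = 0" using w by simp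
    moreover have "map_poly to_ac H = pcompose (map_poly of_rat f) [:to_ac y, - of_rat c:]"
      unfolding H_def map_poly_to_ac_pcompose map_poly_to_ac_of_rat
      by (simp add: map_poly_to_ac_pCons to_ac_of_rat)
    ultimately have "to_ac y - of_rat c * w \<in> Rf"
      by (simp add: poly_pcompose Rf_def rpoly_def algebra_simps)
    then have z: "(to_ac y - of_rat c * w, w) \<in> Rf \<times> Rg" using \<open>w \<in> Rg\<close> by simp
    show "w = to_ac b"
    proof (rule ccontr)
      assume "w \<noteq> to_ac b"
      then have "of_rat c = ((to_ac y - of_rat c * w) - to_ac a) / (to_ac b - w)"
        by (simp add: y_def to_ac_of_rat field_simps)
      then show False using c z unfolding bad_def by (metis (no_types, lifting) case_prod_conv imageI)
    qed
  next
    show "\<not> [:- to_ac b, 1:] ^ 2 dvd m'"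
    proof
      assume "[:- to_ac b, 1:] ^ 2 dvd m'"
      also have "m' dvd map_poly of_rat g" using m(4) unfolding m'_def G_def
        by (metis dvd_def map_poly_to_ac_mult map_poly_to_ac_of_rat)
      finally obtain h where h: "map_poly of_rat g = [:- to_ac b, 1:] ^ 2 * h" by (auto elim: dvdE)
      have "poly (pderiv (map_poly of_rat g)) (to_ac b) = 0"
        unfolding h pderiv_mult power2_eq_square by (simp del: mult_pCons_left mult_pCons_right)
      then have "rpoly (pderiv g) (to_ac b) = 0" by (simp add: rpoly_def of_rat_hom.map_poly_pderiv)
      then show False using irreducible_rpoly_pderiv_nonzero[OF g] by (simp add: rpoly_to_ac)
    qed
  qed
  then have "degree m = 1" by (simp add: m'_def degree_map_poly_to_ac)
  obtain u q where q: "m = pCons u q" by (cases m)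
  with \<open>degree m = 1\<close> have "degree q = 0" "q \<noteq> 0" by (auto split: if_splits)
  then obtain v where "q = [:v:]" "v \<noteq> 0" by (auto elim: degree_eq_zeroE)
  then have uv: "m = [:u, v:]" "v \<noteq> 0" using q by auto
  have "coeff m 0 \<in> F" "coeff m 1 \<in> F" using m(1) by (auto simp: coeffs_in_def)
  then have "u \<in> F" "v \<in> F" using uv by auto
  moreover have "b = - u * inverse v"
    using m(3) uv(2) unfolding uv(1) by (simp add: field_simps eq_neg_iff_add_eq_0)
  ultimately have bF: "b \<in> F" using F by (auto simp: closed_subfield_def)
  have "a = y + of_rat (- c) * b" by (simp add: y_def of_rat_minus)
  moreover have "y + of_rat (- c) * b \<in> F"
    using bF yF F of_rat_in_closed_subfield[OF F, of "- c"] unfolding closed_subfield_def by blast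
  ultimately have "a \<in> F" by simp
  then show ?thesis using bF yK unfolding F_def by blast
qed

theorem primitive_element:
  assumes "number_field (K :: 'a::field_char_0 set)"
  shows "\<exists>\<theta>\<in>K. K = rat_adjoin \<theta>"
proof -
  have cK: "closed_subfield K" using assms number_field_iff by blast
  obtain B where B: "finite B" "K = rat_span B" using assms number_field_iff by blast
  have "\<exists>\<theta>\<in>K. B' \<subseteq> rat_adjoin \<theta>" if "finite B'" "B' \<subseteq> K" for B'
    using that
  proof (induction B')
    case empty
    then show ?case using cK by (auto simp: closed_subfield_def)
  next
    case (insert b B')
    then obtain t where t: "t \<in> K" "B' \<subseteq> rat_adjoin t" by auto
    obtain y where y: "y \<in> K" "t \<in> rat_adjoin y" "b \<in> rat_adjoin y"
      using primitive_element_two[OF assms t(1)] insert.prems by blast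
    have "closed_subfield (rat_adjoin y)"
      using number_field_minimal_polynomial[OF assms y(1)] rat_adjoin_closed_subfield by blast
    then have "rat_adjoin t \<subseteq> rat_adjoin y" using y(2) by (rule rat_adjoin_subset)
    then show ?case using y t by blast
  qed
  moreover have "B \<subseteq> K" using B rat_vs.span_superset by blast
  ultimately obtain t where t: "t \<in> K" "B \<subseteq> rat_adjoin t" using B(1) by blast
  have F: "closed_subfield (rat_adjoin t)"
    using number_field_minimal_polynomial[OF assms t(1)] rat_adjoin_closed_subfield by blast
  have "K \<subseteq> rat_adjoin t"
    unfolding B(2) by (rule rat_vs.span_minimal[OF t(2) closed_subfield_subspace[OF F]])
  moreover have "rat_adjoin t \<subseteq> K" by (rule rat_adjoin_subset[OF cK t(1)])
  ultimately show ?thesis using t(1) by blast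
qed

subsection \<open>Algebraic integers\<close>

definition zspan :: "'a::field_char_0 set \<Rightarrow> 'a set"
  where "zspan B = range (\<lambda>c. \<Sum>b\<in>B. of_int (c b) * b)"

lemma zspan_base: "finite B \<Longrightarrow> b \<in> B \<Longrightarrow> b \<in> zspan B"
  unfolding zspan_def
  by (rule image_eqI[of _ _ "\<lambda>x. if x = b then 1 else 0"]) (auto simp: if_distrib[of of_int] if_distrib[of "\<lambda>x. x * _"] cong: if_cong)

lemma zspan_0: "0 \<in> zspan B"
  unfolding zspan_def by (rule image_eqI[of _ _ "\<lambda>_. 0"]) auto

lemma zspan_add: "x \<in> zspan B \<Longrightarrow> y \<in> zspan B \<Longrightarrow> x + y \<in> zspan B"
proof -
  assume "x \<in> zspan B" "y \<in> zspan B"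
  then obtain c d where "x = (\<Sum>b\<in>B. of_int (c b) * b)" "y = (\<Sum>b\<in>B. of_int (d b) * b)"
    by (auto simp: zspan_def)
  then have "x + y = (\<Sum>b\<in>B. of_int (c b + d b) * b)" by (simp add: sum.distrib algebra_simps)
  then show ?thesis unfolding zspan_def by (intro image_eqI[of _ _ "\<lambda>b. c b + d b"]) auto
qed

lemma zspan_mult_int: "x \<in> zspan B \<Longrightarrow> of_int k * x \<in> zspan B"
proof -
  assume "x \<in> zspan B"
  then obtain c where "x = (\<Sum>b\<in>B. of_int (c b) * b)" by (auto simp: zspan_def)
  then have "of_int k * x = (\<Sum>b\<in>B. of_int (k * c b) * b)" by (simp add: sum_distrib_left algebra_simps)
  then show ?thesis unfolding zspan_def by (intro image_eqI[of _ _ "\<lambda>b. k * c b"]) auto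
qed

lemma zspan_sum_mem: "(\<And>i. i \<in> I \<Longrightarrow> g i \<in> zspan B) \<Longrightarrow> sum g I \<in> zspan B"
  by (induction I rule: infinite_finite_induct) (auto intro: zspan_0 zspan_add)

lemma zspan_mult_closed:
  assumes "\<And>b. b \<in> B \<Longrightarrow> x * b \<in> zspan B'" and "y \<in> zspan B"
  shows "x * y \<in> zspan B'"
proof -
  obtain c where "y = (\<Sum>b\<in>B. of_int (c b) * b)" using assms(2) by (auto simp: zspan_def)
  then have "x * y = (\<Sum>b\<in>B. of_int (c b) * (x * b))" by (simp add: sum_distrib_left algebra_simps)
  also have "\<dots> \<in> zspan B'" by (intro zspan_sum_mem zspan_mult_int assms(1))
  finally show ?thesis .
qed

text \<open>The \<open>v i\<close> form an eigenvector of the integer matrix \<open>A\<close> for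
  the eigenvalue \<open>x\<close>, which is thus a root of a monic integer polynomial, the
  characteristic polynomial.\<close>

lemma algebraic_int_eigenvalue:
  fixes x :: "'a::field_char_0" and A :: "nat \<Rightarrow> nat \<Rightarrow> int"
  assumes ev: "\<And>i. i < n \<Longrightarrow> x * v i = (\<Sum>j<n. of_int (A i j) * v j)"
    and nz: "i < n" "v i \<noteq> 0"
  shows "algebraic_int x"
proof -
  define M where "M = mat n n (\<lambda>(i, j). A i j)"
  define M' where "M' = (map_mat of_int M :: 'a mat)"
  have carr: "M \<in> carrier_mat n n" "M' \<in> carrier_mat n n" by (auto simp: M_def M'_def)
  have "eigenvector M' (vec n v) x"
    unfolding eigenvector_def
  proof (intro conjI)
    show "vec n v \<in> carrier_vec (dim_row M')" using carr by auto
    show "vec n v \<noteq> 0\<^sub>v (dim_row M')"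
    proof
      assume "vec n v = 0\<^sub>v (dim_row M')"
      then have "vec n v $ i = 0\<^sub>v n $ i" using carr by simp
      then show False using nz by simp
    qed
    show "M' *\<^sub>v vec n v = x \<cdot>\<^sub>v vec n v"
      by (rule eq_vecI) (auto simp: M'_def M_def scalar_prod_def ev atLeast0LessThan)
  qed
  then have "eigenvalue M' x" by (auto simp: eigenvalue_def)
  then have "poly (char_poly M') x = 0" using eigenvalue_root_char_poly[OF carr(2)] by simp
  also have "char_poly M' = map_poly of_int (char_poly M)"
    unfolding M'_def by (rule of_int_hom.char_poly_hom[OF carr(1)])
  finally show ?thesis using degree_monic_char_poly[OF carr(1)]
    unfolding algebraic_int_altdef_ipoly by auto
qed

text \<open>Multiplication by \<open>x\<close> preserves the group generated by \<open>B\<close>,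
  and listing \<open>B\<close> turns it into an integer matrix. The element \<open>b0\<close> makes
  the eigenvector nonzero.\<close>

lemma algebraic_int_zspan:
  assumes "finite B" and "\<And>b. b \<in> B \<Longrightarrow> x * b \<in> zspan B" and "b0 \<in> B" "b0 \<noteq> 0"
  shows "algebraic_int x"
proof -
  obtain v n where v: "B = v ` {i. i < (n::nat)}" "inj_on v {i. i < n}"
    using finite_imp_nat_seg_image_inj_on[OF assms(1)] by blast
  have B: "B = v ` {..<n}" "inj_on v {..<n}" using v by (auto simp: lessThan_def)
  have "\<forall>b\<in>B. \<exists>c. x * b = (\<Sum>b'\<in>B. of_int (c b') * b')" using assms(2) by (auto simp: zspan_def)
  then obtain c where c: "\<And>b. b \<in> B \<Longrightarrow> x * b = (\<Sum>b'\<in>B. of_int (c b b') * b')" by metis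
  obtain i where i: "i < n" "v i = b0" using B assms(3) by auto
  show ?thesis
  proof (rule algebraic_int_eigenvalue[of n x v "\<lambda>i j. c (v i) (v j)", OF _ i(1)])
    fix i assume "i < n"
    then have "x * v i = (\<Sum>b'\<in>B. of_int (c (v i) b') * b')" using B by (intro c) auto
    also have "\<dots> = (\<Sum>j<n. of_int (c (v i) (v j)) * v j)"
      unfolding B(1) by (subst sum.reindex[OF B(2)]) simp
    finally show "x * v i = (\<Sum>j<n. of_int (c (v i) (v j)) * v j)" .
  qed (use i assms(4) in simp)
qed

lemma algebraic_int_power_relation:
  assumes "algebraic_int (x :: 'a::field_char_0)"
  shows "\<exists>m a. m > 0 \<and> x ^ m = (\<Sum>i<m. of_int (a i) * x ^ i)"
proof -
  obtain p where p: "poly (map_poly of_int p) x = 0" "lead_coeff p = (1::int)"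
    using assms unfolding algebraic_int_altdef_ipoly by blast
  define m where "m = degree p"
  have "poly (map_poly of_int p) x = (\<Sum>i\<le>m. of_int (coeff p i) * x ^ i)"
    by (simp add: poly_altdef m_def)
  then have s: "(\<Sum>i<m. of_int (coeff p i) * x ^ i) + x ^ m = 0"
    using p by (simp add: m_def lessThan_Suc_atMost[symmetric])
  have "m > 0"
  proof (rule ccontr)
    assume "\<not> m > 0"
    then show False using s by simp
  qed
  moreover have "x ^ m = (\<Sum>i<m. of_int (- coeff p i) * x ^ i)"
    using s by (simp add: sum_negf eq_neg_iff_add_eq_0 add.commute)
  ultimately show ?thesis by (intro exI[of _ m] exI[of _ "\<lambda>i. - coeff p i"]) auto
qed

text \<open>The monomials \<open>x ^ i * y ^ j\<close> with \<open>i < m\<close> and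
  \<open>j < n\<close> generate a group stable under \<open>x\<close> and under \<open>y\<close>: a
  monomial that leaves the range is rewritten by the monic relation of degree \<open>m\<close> or
  \<open>n\<close>.\<close>

lemma algebraic_int_ring:
  fixes x y :: "'a::field_char_0"
  assumes "algebraic_int x" "algebraic_int y"
  shows "algebraic_int (x + y)" "algebraic_int (x * y)"
proof -
  obtain m a where m: "m > 0" "x ^ m = (\<Sum>i<m. of_int (a i) * x ^ i)"
    using algebraic_int_power_relation[OF assms(1)] by blast
  obtain n c where n: "n > 0" "y ^ n = (\<Sum>i<n. of_int (c i) * y ^ i)"
    using algebraic_int_power_relation[OF assms(2)] by blast
  define B where "B = (\<lambda>(i, j). x ^ i * y ^ j) ` ({..<m} \<times> {..<n})"
  have fin: "finite B" by (simp add: B_def)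
  have inB: "x ^ i * y ^ j \<in> zspan B" if "i < m" "j < n" for i j
    using that by (intro zspan_base[OF fin]) (auto simp: B_def)
  have xB: "x * b \<in> zspan B" if "b \<in> B" for b
  proof -
    from that obtain i j where ij: "i < m" "j < n" "b = x ^ i * y ^ j" by (auto simp: B_def)
    show ?thesis
    proof (cases "Suc i < m")
      case True
      then show ?thesis using inB[of "Suc i" j] ij by (simp add: algebra_simps)
    next
      case False
      then have "x * b = x ^ m * y ^ j" using ij by (metis Suc_lessI mult.assoc power_Suc)
      also have "\<dots> = (\<Sum>i<m. of_int (a i) * (x ^ i * y ^ j))"
        unfolding m(2) by (simp add: sum_distrib_right mult.assoc)
      also have "\<dots> \<in> zspan B" using ij by (intro zspan_sum_mem zspan_mult_int inB) auto
      finally show ?thesis .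
    qed
  qed
  have yB: "y * b \<in> zspan B" if "b \<in> B" for b
  proof -
    from that obtain i j where ij: "i < m" "j < n" "b = x ^ i * y ^ j" by (auto simp: B_def)
    show ?thesis
    proof (cases "Suc j < n")
      case True
      then show ?thesis using inB[of i "Suc j"] ij by (simp add: algebra_simps)
    next
      case False
      then have "y * b = x ^ i * y ^ n" using ij by (metis Suc_lessI mult.left_commute power_Suc)
      also have "\<dots> = (\<Sum>j<n. of_int (c j) * (x ^ i * y ^ j))"
        unfolding n(2) by (simp add: sum_distrib_left algebra_simps)
      also have "\<dots> \<in> zspan B" using ij by (intro zspan_sum_mem zspan_mult_int inB) auto
      finally show ?thesis .
    qed
  qed
  have one: "1 \<in> B" using m(1) n(1) unfolding B_def by (intro image_eqI[of _ _ "(0, 0)"]) auto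
  show "algebraic_int (x + y)"
    by (rule algebraic_int_zspan[OF fin _ one]) (auto simp: distrib_right intro: zspan_add xB yB)
  show "algebraic_int (x * y)"
    by (rule algebraic_int_zspan[OF fin _ one])
       (auto simp: mult.assoc intro: zspan_mult_closed[where B = B] xB yB)
qed

lemma algebraic_int_diff: "algebraic_int x \<Longrightarrow> algebraic_int y \<Longrightarrow> algebraic_int (x - y :: 'a::field_char_0)"
  using algebraic_int_ring(1)[of x "- y"] by auto

lemma algebraic_int_of_int: "algebraic_int (of_int n :: 'a::field_char_0)"
  by (rule int_imp_algebraic_int) auto

lemma algebraic_int_1: "algebraic_int (1 :: 'a::field_char_0)"
  by (rule int_imp_algebraic_int) auto

lemma algebraic_int_prod:
  "(\<And>i. i \<in> I \<Longrightarrow> algebraic_int (g i)) \<Longrightarrow> algebraic_int (prod g I :: 'a::field_char_0)"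
  by (induction I rule: infinite_finite_induct) (auto intro: algebraic_int_ring algebraic_int_1)

lemma algebraic_int_power: "algebraic_int x \<Longrightarrow> algebraic_int (x ^ n :: 'a::field_char_0)"
  by (induction n) (auto intro: algebraic_int_ring algebraic_int_1)

section \<open>Integral multiples of algebraic numbers\<close>

lemma clear_denominators:
  "\<exists>D>0. \<exists>q. smult (of_int D) p = map_poly rat_of_int q"
proof (induction p)
  case 0
  show ?case by (intro exI[of _ 1] exI[of _ 0] conjI) auto
next
  case (pCons a p)
  then obtain D q where D: "D > 0" "smult (of_int D) p = map_poly rat_of_int q" by blast
  obtain u v where uv: "a = Rat.Fract u v" "v > 0" by (cases a)
  then have a: "of_int v * a = of_int u" by (simp add: Fract_of_int_quotient)
  have "smult (of_int (v * D)) (pCons a p) = map_poly rat_of_int (pCons (u * D) (smult v q))"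
  proof -
    have "of_int (v * D) * a = of_int (u * D)" using a by (simp add: algebra_simps)
    moreover have "smult (of_int (v * D)) p = smult (of_int v) (map_poly rat_of_int q)"
      using D(2) by (simp flip: smult_smult)
    ultimately show ?thesis
      by (simp add: of_int_hom.map_poly_pCons_hom of_int_hom.map_poly_hom_smult)
  qed
  then show ?case using D(1) uv(2) by (intro exI[of _ "v * D"]) auto
qed

lemma rational_root_multiple_algebraic_int:
  fixes x :: "'a::field_char_0"
  assumes "p \<noteq> 0" "rpoly p x = 0"
  shows "\<exists>D>0. algebraic_int (of_int D * x)"
proof -
  obtain D q where D: "D > 0" "smult (of_int D) p = map_poly rat_of_int q"
    using clear_denominators by blast
  have "rpoly (smult (of_int D) p) x = 0" using assms by simp
  then have q0: "poly (map_poly of_int q) x = 0"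
    unfolding D(2) rpoly_def by (simp add: map_poly_map_poly o_def)
  have "q \<noteq> 0" using D assms(1) by auto
  define n where "n = degree q"
  define c where "c = lead_coeff q"
  have c0: "c \<noteq> 0" using \<open>q \<noteq> 0\<close> by (simp add: c_def)
  have s: "(\<Sum>i\<le>n. of_int (coeff q i) * x ^ i) = 0" using q0 by (simp add: poly_altdef n_def)
  have n0: "n > 0"
  proof (rule ccontr)
    assume "\<not> n > 0"
    then show False using s c0 by (simp add: c_def n_def)
  qed
  define y where "y = of_int c * x"
  \<comment> \<open>\<open>r\<close> is \<open>c ^ (n - 1) * q(X / c)\<close>, a monic integer
    polynomial with root \<open>c * x\<close>.\<close>
  define r where "r = monom 1 n + (\<Sum>i<n. monom (coeff q i * c ^ (n - 1 - i)) i)"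
  have low: "degree (\<Sum>i<n. monom (coeff q i * c ^ (n - 1 - i)) i) < n"
    using n0 by (intro degree_sum_less) (auto simp: degree_monom_le intro: le_less_trans[OF degree_monom_le])
  have r1: "lead_coeff r = 1"
  proof -
    have "degree (monom (1::int) n) = n" by (simp add: degree_monom_eq)
    then show ?thesis using low unfolding r_def
      by (simp add: degree_add_eq_left coeff_eq_0)
  qed
  have "poly (map_poly of_int r) y = y ^ n + (\<Sum>i<n. of_int (coeff q i * c ^ (n - 1 - i)) * y ^ i)"
    unfolding r_def by (simp add: of_int_hom.map_poly_hom_add of_int_poly_hom.hom_sum of_int_hom.map_poly_hom_monom poly_sum poly_monom)
  also have "(\<Sum>i<n. of_int (coeff q i * c ^ (n - 1 - i)) * y ^ i)
     = (\<Sum>i<n. of_int c ^ (n - 1) * (of_int (coeff q i) * x ^ i))"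
  proof (rule sum.cong)
    fix i assume "i \<in> {..<n}"
    then have "(of_int c :: 'a) ^ (n - 1 - i) * of_int c ^ i = of_int c ^ (n - 1)"
      by (simp flip: power_add)
    then show "of_int (coeff q i * c ^ (n - 1 - i)) * y ^ i = of_int c ^ (n - 1) * (of_int (coeff q i) * x ^ i)"
      by (simp add: y_def power_mult_distrib mult_ac)
  qed simp
  also have "y ^ n = of_int c ^ (n - 1) * (of_int (coeff q n) * x ^ n)"
    using n0 by (cases n) (simp_all add: y_def c_def n_def power_mult_distrib mult_ac)
  also have "of_int c ^ (n - 1) * (of_int (coeff q n) * x ^ n) + (\<Sum>i<n. of_int c ^ (n - 1) * (of_int (coeff q i) * x ^ i))
     = of_int c ^ (n - 1) * (\<Sum>i\<le>n. of_int (coeff q i) * x ^ i)"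
    by (simp add: lessThan_Suc_atMost[symmetric] sum_distrib_left algebra_simps)
  also have "\<dots> = 0" unfolding s by simp
  finally have "algebraic_int y" unfolding algebraic_int_altdef_ipoly using r1 by blast
  then have "algebraic_int (of_int \<bar>c\<bar> * x)" unfolding y_def by (cases "c \<ge> 0") auto
  then show ?thesis using c0 by (intro exI[of _ "\<bar>c\<bar>"]) auto
qed

subsection \<open>Embeddings and norms\<close>

text \<open>The resultant of two monic polynomials is symmetric up to sign. Roots are kept in
  multisets, because the remainders in Euclid's algorithm may have repeated roots.\<close>

lemma prod_mset_linear_eq:
  "(\<Prod>a\<in>#A. \<Prod>b\<in>#B. a - b :: complex) = (-1) ^ (size A * size B) * (\<Prod>b\<in>#B. \<Prod>a\<in>#A. b - a)"
proof -
  have "(\<Prod>b\<in>#B. a - b) = (-1) ^ size B * (\<Prod>b\<in>#B. b - a)" for a :: complex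
    by (induction B) (auto simp: algebra_simps)
  then have "(\<Prod>a\<in>#A. \<Prod>b\<in>#B. a - b) = (\<Prod>a\<in>#A. (-1) ^ size B * (\<Prod>b\<in>#B. b - a))" by simp
  also have "\<dots> = ((-1) ^ size B) ^ size A * (\<Prod>a\<in>#A. \<Prod>b\<in>#B. b - a)"
    by (simp add: prod_mset.distrib)
  also have "(\<Prod>a\<in>#A. \<Prod>b\<in>#B. b - a) = (\<Prod>b\<in>#B. \<Prod>a\<in>#A. b - a)" by (rule prod_mset.swap)
  finally show ?thesis by (simp add: power_mult[symmetric] mult.commute)
qed

lemma poly_prod_mset_linear: "poly (\<Prod>a\<in>#A. [:- a, 1:]) x = (\<Prod>a\<in>#A. x - (a :: 'a::comm_ring_1))"
  by (induction A) (auto simp: algebra_simps)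

lemma degree_prod_mset_linear: "degree (\<Prod>a\<in>#A. [:- a, 1 :: 'a::idom:]) = size A"
proof (induction A)
  case (add a A)
  have "(\<Prod>a\<in>#A. [:- a, 1:]) \<noteq> 0" by (auto simp: prod_mset_zero_iff)
  then show ?case using add degree_mult_eq[of "[:-a, 1:]" "(\<Prod>a\<in>#A. [:- a, 1:])"]
    by (simp del: mult_pCons_left)
qed simp

text \<open>Euclid's algorithm for the resultant of \<open>f\<close> and \<open>p\<close>.\<close>

lemma prod_mset_roots_rational:
  fixes f p :: "rat poly" and A :: "complex multiset"
  assumes "map_poly of_rat f = (\<Prod>a\<in>#A. [:- a, 1:])"
  shows "(\<Prod>a\<in>#A. rpoly p a) \<in> \<rat>"
  using assms
proof (induction "size A" arbitrary: A f p rule: less_induct)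
  case less
  have deg: "degree f = size A"
    using arg_cong[OF less.prems, of degree] by (simp add: degree_prod_mset_linear)
  have root: "rpoly f x = (\<Prod>a\<in>#A. x - a)" for x
    by (simp add: rpoly_def less.prems poly_prod_mset_linear)
  show ?case
  proof (cases "A = {#}")
    case False
    then have dpos: "degree f > 0" using deg by (simp add: nonempty_has_size)
    define q where "q = p mod f"
    have "rpoly p a = rpoly q a" if "a \<in># A" for a
    proof -
      have "rpoly p a = rpoly (p div f * f + q) a" by (simp add: q_def)
      also have "rpoly f a = 0" using that by (auto simp: root prod_mset_zero_iff)
      then have "rpoly (p div f * f + q) a = rpoly q a" by simp
      finally show ?thesis .
    qed
    then have eq: "(\<Prod>a\<in>#A. rpoly p a) = (\<Prod>a\<in>#A. rpoly q a)"
      by (intro arg_cong[of _ _ prod_mset] image_mset_cong) auto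
    show ?thesis
    proof (cases "q = 0")
      case True
      have "(\<Prod>a\<in>#A. rpoly q a) = (\<Prod>a\<in>#A. 0 :: complex)" unfolding True rpoly_0 ..
      then show ?thesis unfolding eq using False by (simp add: nonempty_has_size)
    next
      case q0: False
      have "degree q < degree f" unfolding q_def
        by (rule degree_mod_less') (use dpos q0 in \<open>auto simp: q_def\<close>)
      define c where "c = lead_coeff q"
      have c0: "c \<noteq> 0" using q0 by (simp add: c_def)
      \<comment> \<open>The remainder is made monic so that it has the form required of
        \<open>f\<close>. The induction hypothesis is then used with exchanged roles: the roots
        \<open>B\<close> of \<open>q1\<close>, and \<open>f\<close> as the polynomial to be
        evaluated.\<close>
      define q1 where "q1 = smult (inverse c) q"
      have q: "q = smult c q1" using c0 by (simp add: q1_def)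
      have q1: "lead_coeff q1 = 1" "q1 \<noteq> 0" using c0 q0 by (auto simp: q1_def c_def)
      have nz: "map_poly (of_rat :: rat \<Rightarrow> complex) q1 \<noteq> 0" using q1 by (simp add: map_poly_eq_0_iff)
      obtain B where B: "size B = degree (map_poly (of_rat :: rat \<Rightarrow> complex) q1)"
        "map_poly of_rat q1 = smult (lead_coeff (map_poly (of_rat :: rat \<Rightarrow> complex) q1)) (\<Prod>b\<in>#B. [:- b, 1:])"
        using alg_closed_imp_factorization[OF nz] by blast
      have Beq: "map_poly of_rat q1 = (\<Prod>b\<in>#B. [:- b, 1:])" using B(2) q1 by simp
      have "degree q1 = degree q" using c0 by (simp add: q1_def)
      then have sB: "size B < size A" using B(1) \<open>degree q < degree f\<close> deg by simp
      have rq: "rpoly q a = of_rat c * (\<Prod>b\<in>#B. a - b)" for a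
      proof -
        have "rpoly q1 a = (\<Prod>b\<in>#B. a - b)" unfolding rpoly_def Beq by (rule poly_prod_mset_linear)
        moreover have "rpoly q a = of_rat c * rpoly q1 a" by (subst q) (rule rpoly_smult)
        ultimately show ?thesis by simp
      qed
      have "(\<Prod>a\<in>#A. rpoly q a) = of_rat c ^ size A * (\<Prod>a\<in>#A. \<Prod>b\<in>#B. a - b)"
        unfolding rq by (simp add: prod_mset.distrib)
      also have "\<dots> = of_rat c ^ size A * ((-1) ^ (size A * size B) * (\<Prod>b\<in>#B. rpoly f b))"
      proof -
        have "(\<Prod>b\<in>#B. \<Prod>a\<in>#A. b - a) = (\<Prod>b\<in>#B. rpoly f b)" by (simp only: root)
        then show ?thesis by (simp only: prod_mset_linear_eq[where A = A and B = B])
      qed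
      also have "\<dots> \<in> \<rat>" using less.hyps[OF sB Beq, of f] by (intro Rats_mult Rats_power) auto
      finally show ?thesis using eq by simp
    qed
  qed simp
qed

lemma map_poly_of_rat_mult: "map_poly of_rat (p * q) = map_poly of_rat p * (map_poly of_rat q :: complex poly)"
  by (rule poly_eqI) (simp add: coeff_map_poly coeff_mult of_rat_sum of_rat_mult)

text \<open>Newton interpolation: subtracting the value at \<open>q0\<close> and dividing by
  \<open>X - q0\<close> lowers the degree, and the quotient is again rational at all points of
  \<open>S\<close> other than \<open>q0\<close>.\<close>

lemma poly_rational_values_imp_rational:
  fixes P :: "complex poly" and S :: "rat set"
  assumes "infinite S" and "\<And>q. q \<in> S \<Longrightarrow> poly P (of_rat q) \<in> \<rat>"
  shows "\<exists>r. P = map_poly of_rat r"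
  using assms
proof (induction "degree P" arbitrary: P S rule: less_induct)
  case less
  obtain q0 where q0: "q0 \<in> S" using less.prems(1) by fastforce
  obtain c where c: "poly P (of_rat q0) = of_rat c" using less.prems(2)[OF q0] by (auto elim: Rats_cases)
  have "poly (P - [:of_rat c:]) (of_rat q0) = 0" using c by simp
  then have "[:- of_rat q0, 1:] dvd P - [:of_rat c:]" by (simp only: poly_eq_0_iff_dvd)
  then obtain P1 where P1: "P - [:of_rat c:] = [:- of_rat q0, 1:] * P1" by (rule dvdE)
  have P: "P = [:of_rat c:] + [:- of_rat q0, 1:] * P1" using P1 by (simp add: algebra_simps)
  show ?case
  proof (cases "P1 = 0")
    case True
    then have "P = map_poly of_rat [:c:]" using P by (simp add: of_rat_hom.map_poly_pCons_hom)
    then show ?thesis by blast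
  next
    case False
    have "degree ([:- of_rat q0, 1:] * P1) = Suc (degree P1)"
      using False by (subst degree_mult_eq) auto
    then have "degree P = Suc (degree P1)" unfolding P by (subst degree_add_eq_right) auto
    moreover have "poly P1 (of_rat q) \<in> \<rat>" if "q \<in> S - {q0}" for q
    proof -
      have ne: "of_rat q - (of_rat q0 :: complex) \<noteq> 0" using that by simp
      have "poly P (of_rat q) = of_rat c + (of_rat q - of_rat q0) * poly P1 (of_rat q)"
        unfolding P by (simp add: algebra_simps)
      then have "poly P1 (of_rat q) = (poly P (of_rat q) - of_rat c) / (of_rat q - of_rat q0)"
        using ne by (simp add: field_simps)
      then show ?thesis using less.prems(2)[of q] that by auto
    qed
    moreover have "infinite (S - {q0})" using less.prems(1) by simp
    ultimately obtain r1 where "P1 = map_poly of_rat r1" using less.hyps[of P1 "S - {q0}"] by auto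
    then have "P = map_poly of_rat ([:c:] + [:- q0, 1:] * r1)"
      unfolding P of_rat_hom.map_poly_hom_add map_poly_of_rat_mult
      by (simp add: of_rat_hom.map_poly_pCons_hom of_rat_minus)
    then show ?thesis by blast
  qed
qed

section \<open>Rational bases\<close>

lemma rat_independent_spans:
  assumes "\<not> rat_vs.dependent V" "V \<subseteq> rat_span W" "finite W" "card W \<le> card V"
  shows "rat_span W \<subseteq> rat_span V"
proof
  fix x assume x: "x \<in> rat_span W"
  show "x \<in> rat_span V"
  proof (rule ccontr)
    assume nx: "x \<notin> rat_span V"
    then have "\<not> rat_vs.dependent (insert x V)" using assms(1) by (simp add: rat_vs.independent_insert)
    from rat_vs.independent_span_bound[OF assms(3) this] have "card (insert x V) \<le> card W" "finite V"
      using assms(2) x by auto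
    moreover have "x \<notin> V" using nx rat_vs.span_base by auto
    ultimately show False using assms(4) by simp
  qed
qed

text \<open>Passes from families to sets, for which dependence is defined. Injectivity has to be
  derived along the way: two equal members would satisfy a relation with coefficients 1 and
  -1.\<close>

lemma rat_independent_powersI:
  fixes v :: "nat \<Rightarrow> 'a::field_char_0"
  assumes "\<And>c i. (\<Sum>i<n. of_rat (c i) * v i) = 0 \<Longrightarrow> i < n \<Longrightarrow> c i = 0"
  shows "\<not> rat_vs.dependent (v ` {..<n})" "inj_on v {..<n}"
proof -
  show inj: "inj_on v {..<n}"
  proof (rule inj_onI, rule ccontr)
    fix i j assume ij: "i \<in> {..<n}" "j \<in> {..<n}" "v i = v j" "i \<noteq> j"
    define c where "c = (\<lambda>k. if k = i then 1 else if k = j then - 1 else 0 :: rat)"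
    have "(\<Sum>k<n. of_rat (c k) * v k) = (\<Sum>k\<in>{i, j}. of_rat (c k) * v k)"
      by (rule sum.mono_neutral_right) (use ij in \<open>auto simp: c_def\<close>)
    also have "\<dots> = 0" using ij by (simp add: c_def)
    finally have "c i = 0" using assms ij(1) by blast
    then show False by (simp add: c_def)
  qed
  show "\<not> rat_vs.dependent (v ` {..<n})"
  proof (rule rat_vs.independent_if_scalars_zero)
    fix g x assume g: "(\<Sum>x\<in>v ` {..<n}. of_rat (g x) * x) = 0" "x \<in> v ` {..<n}"
    then have "(\<Sum>i<n. of_rat (g (v i)) * v i) = 0" by (simp add: sum.reindex[OF inj])
    then show "g x = 0" using assms[of "\<lambda>i. g (v i)"] g(2) by auto
  qed simp
qed

lemma rat_adjoin_int_multiple: "0 < D \<Longrightarrow> rat_adjoin (of_int D * x) = rat_adjoin (x :: 'a::field_char_0)"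
proof -
  assume "0 < D"
  have *: "rat_adjoin (of_rat q * x) \<subseteq> rat_adjoin x" for q and x :: 'a
  proof -
    have "rpoly p (of_rat q * x) = rpoly (pcompose p [:0, q:]) x" for p
      by (simp add: rpoly_pcompose mult.commute)
    then show ?thesis by (auto simp: rat_adjoin_def)
  qed
  have "of_int D * x = of_rat (of_int D) * x" "x = of_rat (1 / of_int D) * (of_int D * x)"
    using \<open>0 < D\<close> by (auto simp: of_rat_divide)
  then show ?thesis using * by (metis subset_antisym)
qed

text \<open>\<open>\<theta>\<close> and \<open>f\<close> are parameters besides \<open>K\<close>,
  since the same field is considered again with \<open>\<gamma> ^ n\<close> as its generator.
  Integrality of \<open>\<theta>\<close> puts \<open>\<int>[\<theta>]\<close> inside the ring of
  integers.\<close>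

locale primitive_number_field =
  fixes K :: "'a::field_char_0 set" and \<theta> :: 'a and f :: "rat poly"
  assumes K: "number_field K"
    and irreducible_f: "Factorial_Ring.irreducible f" and monic_f: "lead_coeff f = 1"
    and f_\<theta>: "rpoly f \<theta> = 0"
    and K_eq: "K = rat_adjoin \<theta>"
    and algebraic_int_\<theta>: "algebraic_int \<theta>"

theorem number_field_imp_primitive:
  assumes "number_field K"
  shows "\<exists>\<theta> f. primitive_number_field K \<theta> f"
proof -
  obtain t where t: "t \<in> K" "K = rat_adjoin t" using primitive_element[OF assms] by blast
  obtain g where g: "Factorial_Ring.irreducible g" "rpoly g t = 0"
    using number_field_minimal_polynomial[OF assms t(1)] by blast
  then obtain D where D: "D > 0" "algebraic_int (of_int D * t)"
    using rational_root_multiple_algebraic_int[of g t] by auto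
  have "of_int D * t \<in> rat_adjoin t" using rat_adjoin_int_multiple[OF D(1)] rat_adjoin_base by blast
  then obtain f where "Factorial_Ring.irreducible f" "lead_coeff f = 1" "rpoly f (of_int D * t) = 0"
    using number_field_minimal_polynomial[OF assms] t(2) by metis
  then have "primitive_number_field K (of_int D * t) f"
    using assms D t(2) rat_adjoin_int_multiple[OF D(1)] by unfold_locales auto
  then show ?thesis by blast
qed

section \<open>Embeddings, norm and integers in terms of a generator\<close>

context primitive_number_field
begin

text \<open>Embeddings are indexed by the image of \<open>\<theta>\<close>, so that products over
  embeddings become products over the roots of \<open>f\<close>. The embedding \<open>emb z\<close>
  with \<open>\<theta> \<mapsto> z\<close> is evaluated through an arbitrary polynomial
  representative; the choice is immaterial because \<open>f\<close> divides the difference of any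
  two.\<close>

definition Em :: "complex set" where "Em = {z. rpoly f z = 0}"

definition rep :: "'a \<Rightarrow> rat poly" where "rep x = (SOME p. rpoly p \<theta> = x)"

definition emb :: "complex \<Rightarrow> 'a \<Rightarrow> complex" where "emb z x = rpoly (rep x) z"

abbreviation d :: nat where "d \<equiv> degree f"

definition Nm :: "'a \<Rightarrow> complex" where "Nm x = (\<Prod>z\<in>Em. emb z x)"

definition Ok :: "'a set" where "Ok = ring_of_integers K"

lemma K_closed_subfield: "closed_subfield K"
  using K number_field_iff by blast

lemma K_closed [intro]:
  "0 \<in> K" "1 \<in> K" "x \<in> K \<Longrightarrow> y \<in> K \<Longrightarrow> x + y \<in> K" "x \<in> K \<Longrightarrow> y \<in> K \<Longrightarrow> x * y \<in> K"
  "x \<in> K \<Longrightarrow> - x \<in> K" "x \<in> K \<Longrightarrow> inverse x \<in> K" "x \<in> K \<Longrightarrow> y \<in> K \<Longrightarrow> x - y \<in> K"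
  "x \<in> K \<Longrightarrow> y \<in> K \<Longrightarrow> x / y \<in> K" "x \<in> K \<Longrightarrow> x ^ n \<in> K" "of_rat q \<in> K" "of_int k \<in> K" "of_nat m \<in> K"
proof -
  show a: "0 \<in> K" "1 \<in> K" "\<And>x y. x \<in> K \<Longrightarrow> y \<in> K \<Longrightarrow> x + y \<in> K" "\<And>x y. x \<in> K \<Longrightarrow> y \<in> K \<Longrightarrow> x * y \<in> K"
    "\<And>x. x \<in> K \<Longrightarrow> - x \<in> K" "\<And>x. x \<in> K \<Longrightarrow> inverse x \<in> K"
    using K_closed_subfield by (auto simp: closed_subfield_def)
  show "x \<in> K \<Longrightarrow> y \<in> K \<Longrightarrow> x - y \<in> K" using a(3)[of x "- y"] a(5) by simp
  show "x \<in> K \<Longrightarrow> y \<in> K \<Longrightarrow> x / y \<in> K" using a(4)[of x "inverse y"] a(6) by (simp add: divide_inverse)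
  show "x \<in> K \<Longrightarrow> x ^ n \<in> K" by (rule closed_subfield_power[OF K_closed_subfield])
  show r: "of_rat q \<in> K" for q by (rule of_rat_in_closed_subfield[OF K_closed_subfield])
  show "of_int k \<in> K" "of_nat m \<in> K" using r[of "of_int k"] r[of "of_nat m"] by auto
qed

lemma \<theta>_in_K: "\<theta> \<in> K"
  unfolding K_eq by (rule rat_adjoin_base)

lemma rpoly_in_K: "x \<in> K \<Longrightarrow> rpoly p x \<in> K"
  by (rule rpoly_in_closed_subfield[OF K_closed_subfield])

lemma rpoly_rep: "x \<in> K \<Longrightarrow> rpoly (rep x) \<theta> = x"
  unfolding rep_def by (rule someI_ex) (auto simp: K_eq rat_adjoin_def)

lemma f_nonzero: "f \<noteq> 0" using irreducible_f by auto

lemma d_pos: "d > 0"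
proof (rule ccontr)
  assume "\<not> d > 0"
  then obtain c where "f = [:c:]" by (auto elim: degree_eq_zeroE)
  then show False using f_\<theta> f_nonzero by auto
qed

lemma rpoly_\<theta>_eq_0_iff: "rpoly p \<theta> = 0 \<longleftrightarrow> f dvd p"
  by (rule irreducible_rpoly_zero_iff[OF irreducible_f f_\<theta>])

lemma rpoly_Em_eq_0_iff: "z \<in> Em \<Longrightarrow> rpoly p z = 0 \<longleftrightarrow> f dvd p"
  by (rule irreducible_rpoly_zero_iff[OF irreducible_f]) (simp add: Em_def)

lemma rpoly_\<theta>_eq_iff: "z \<in> Em \<Longrightarrow> rpoly p \<theta> = rpoly q \<theta> \<longleftrightarrow> rpoly p z = rpoly q z"
  using rpoly_\<theta>_eq_0_iff[of "p - q"] rpoly_Em_eq_0_iff[of z "p - q"] by simp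

lemma finite_Em [simp]: "finite Em"
  unfolding Em_def by (rule finite_rpoly_roots[OF f_nonzero])

lemma f_factorization: "map_poly of_rat f = (\<Prod>z\<in>Em. [:- z, 1:])"
proof -
  have "rsquarefree (map_poly (of_rat :: rat \<Rightarrow> complex) f)"
    unfolding rsquarefree_roots
    using irreducible_rpoly_pderiv_nonzero[OF irreducible_f]
    by (auto simp: rpoly_def of_rat_hom.map_poly_pderiv)
  from complex_poly_decompose_rsquarefree[OF this] show ?thesis
    using monic_f by (simp add: Em_def rpoly_def)
qed

lemma card_Em: "card Em = d"
proof -
  have "degree (\<Prod>z\<in>Em. [:- z, 1:]) = (\<Sum>z\<in>Em. degree [:- z, 1:])"
    by (rule degree_prod_sum_eq) auto
  then show ?thesis using arg_cong[OF f_factorization, of degree] by simp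
qed

lemma Em_nonempty: "Em \<noteq> {}"
  using card_Em d_pos by auto

lemma emb_rpoly_\<theta>: "z \<in> Em \<Longrightarrow> emb z (rpoly p \<theta>) = rpoly p z"
  unfolding emb_def using rpoly_\<theta>_eq_iff rpoly_rep rpoly_in_K[OF \<theta>_in_K] by blast

lemma emb_\<theta>: "z \<in> Em \<Longrightarrow> emb z \<theta> = z"
  using emb_rpoly_\<theta>[of z "[:0, 1:]"] by simp

lemma emb_add: "z \<in> Em \<Longrightarrow> x \<in> K \<Longrightarrow> y \<in> K \<Longrightarrow> emb z (x + y) = emb z x + emb z y"
  using emb_rpoly_\<theta>[of z "rep x + rep y"] by (simp add: rpoly_rep) (simp add: emb_def)

lemma emb_mult: "z \<in> Em \<Longrightarrow> x \<in> K \<Longrightarrow> y \<in> K \<Longrightarrow> emb z (x * y) = emb z x * emb z y"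
  using emb_rpoly_\<theta>[of z "rep x * rep y"] by (simp add: rpoly_rep) (simp add: emb_def)

lemma emb_of_rat: "z \<in> Em \<Longrightarrow> emb z (of_rat q) = of_rat q"
  using emb_rpoly_\<theta>[of z "[:q:]"] by simp

lemma emb_simps [simp]:
  assumes "z \<in> Em"
  shows "emb z 0 = 0" "emb z 1 = 1" "emb z (of_int k) = of_int k" "emb z (of_nat n) = of_nat n"
  using emb_of_rat[OF assms, of 0] emb_of_rat[OF assms, of 1] emb_of_rat[OF assms, of "of_int k"]
    emb_of_rat[OF assms, of "of_nat n"] by auto

lemma emb_minus: "z \<in> Em \<Longrightarrow> x \<in> K \<Longrightarrow> emb z (- x) = - emb z x"
  using emb_mult[of z "of_int (- 1)" x] emb_simps(3)[of z "- 1"] K_closed(11)[of "-1"] by simp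

lemma emb_diff: "z \<in> Em \<Longrightarrow> x \<in> K \<Longrightarrow> y \<in> K \<Longrightarrow> emb z (x - y) = emb z x - emb z y"
  using emb_add[of z x "- y"] emb_minus K_closed(5) by simp

lemma emb_eq_0_iff: "z \<in> Em \<Longrightarrow> x \<in> K \<Longrightarrow> emb z x = 0 \<longleftrightarrow> x = 0"
  using rpoly_\<theta>_eq_iff[of z "rep x" 0] by (simp add: rpoly_rep emb_def)

lemma emb_inverse: "z \<in> Em \<Longrightarrow> x \<in> K \<Longrightarrow> emb z (inverse x) = inverse (emb z x)"
proof (cases "x = 0")
  case False
  assume z: "z \<in> Em" and x: "x \<in> K"
  have "emb z x * emb z (inverse x) = 1"
    using emb_mult[OF z x K_closed(6)[OF x]] False z by simp
  then show ?thesis by (metis inverse_unique)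
qed simp

lemma emb_divide: "z \<in> Em \<Longrightarrow> x \<in> K \<Longrightarrow> y \<in> K \<Longrightarrow> emb z (x / y) = emb z x / emb z y"
  by (simp add: divide_inverse emb_mult emb_inverse K_closed)

lemma emb_power: "z \<in> Em \<Longrightarrow> x \<in> K \<Longrightarrow> emb z (x ^ n) = emb z x ^ n"
  by (induction n) (auto simp: emb_mult K_closed)

lemma emb_rpoly: "z \<in> Em \<Longrightarrow> x \<in> K \<Longrightarrow> emb z (rpoly p x) = rpoly p (emb z x)"
  using emb_rpoly_\<theta>[of z "pcompose p (rep x)"] by (simp add: rpoly_pcompose rpoly_rep) (simp add: emb_def)

lemma rpoly_cnj: "rpoly p (cnj z) = cnj (rpoly p z)"
proof -
  have "cnj (of_rat q) = of_rat q" for q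
    by (cases q) (simp add: of_rat_rat)
  then show ?thesis by (induction p) auto
qed

lemma cnj_Em: "z \<in> Em \<Longrightarrow> cnj z \<in> Em"
  by (simp add: Em_def rpoly_cnj)

lemma emb_cnj: "emb (cnj z) x = cnj (emb z x)"
  by (simp add: emb_def rpoly_cnj)

lemma Nm_rational:
  assumes "x \<in> K"
  shows "Nm x \<in> \<rat>"
proof -
  have "Nm x = (\<Prod>z\<in>#mset_set Em. rpoly (rep x) z)"
    by (simp add: Nm_def emb_def prod_unfold_prod_mset)
  also have "\<dots> \<in> \<rat>"
    by (rule prod_mset_roots_rational[of f]) (simp add: f_factorization prod_unfold_prod_mset)
  finally show ?thesis .
qed

lemma Nm_mult: "x \<in> K \<Longrightarrow> y \<in> K \<Longrightarrow> Nm (x * y) = Nm x * Nm y"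
  by (simp add: Nm_def emb_mult prod.distrib)

lemma Nm_eq_0_iff: "x \<in> K \<Longrightarrow> Nm x = 0 \<longleftrightarrow> x = 0"
  using Em_nonempty by (auto simp: Nm_def emb_eq_0_iff)

text \<open>At a rational \<open>q\<close> the product takes the value \<open>Nm (q - x)\<close>, so
  it is rational at all rational points, and interpolation makes its coefficients rational.\<close>

lemma char_poly_rational:
  assumes "x \<in> K"
  shows "\<exists>r. map_poly of_rat r = (\<Prod>z\<in>Em. [:- emb z x, 1:]) \<and> rpoly r x = 0 \<and> lead_coeff r = 1"
proof -
  define P where "P = (\<Prod>z\<in>Em. [:- emb z x, 1:])"
  have "poly P (of_rat q) \<in> \<rat>" for q
  proof -
    have "poly P (of_rat q) = Nm (of_rat q - x)"
      by (simp add: P_def poly_prod Nm_def emb_diff emb_of_rat assms K_closed)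
    then show ?thesis using Nm_rational assms by auto
  qed
  then obtain r where r: "P = map_poly of_rat r"
    using poly_rational_values_imp_rational[of UNIV P] infinite_UNIV_char_0 by blast
  obtain z where z: "z \<in> Em" using Em_nonempty by blast
  have "rpoly r (emb z x) = 0"
    by (simp add: rpoly_def r[symmetric] P_def poly_prod) (use z in blast)
  then have "emb z (rpoly r x) = 0" using emb_rpoly[OF z assms] by simp
  then have "rpoly r x = 0" using emb_eq_0_iff[OF z rpoly_in_K[OF assms]] by simp
  moreover have "lead_coeff P = 1" unfolding P_def by (rule lead_coeff_prod[THEN trans]) simp
  ultimately show ?thesis using r P_def by (intro exI[of _ r]) auto
qed

lemma Ok_iff: "x \<in> Ok \<longleftrightarrow> x \<in> K \<and> algebraic_int x"
  by (simp add: Ok_def ring_of_integers_def)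

lemma Ok_closed [intro]:
  "0 \<in> Ok" "1 \<in> Ok" "x \<in> Ok \<Longrightarrow> y \<in> Ok \<Longrightarrow> x + y \<in> Ok" "x \<in> Ok \<Longrightarrow> y \<in> Ok \<Longrightarrow> x * y \<in> Ok"
  "x \<in> Ok \<Longrightarrow> - x \<in> Ok" "x \<in> Ok \<Longrightarrow> y \<in> Ok \<Longrightarrow> x - y \<in> Ok"
  "x \<in> Ok \<Longrightarrow> x ^ n \<in> Ok" "of_int k \<in> Ok" "of_nat m \<in> Ok"
proof -
  show "of_int k \<in> Ok" "of_nat m \<in> Ok" for k m
    using algebraic_int_of_int[of k] algebraic_int_of_int[of "int m"] by (auto simp: Ok_iff K_closed)
qed (auto simp: Ok_iff K_closed algebraic_int_1 intro: algebraic_int_ring algebraic_int_diff algebraic_int_power)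

lemma Ok_subset: "x \<in> Ok \<Longrightarrow> x \<in> K"
  by (simp add: Ok_iff)

lemma \<theta>_in_Ok: "\<theta> \<in> Ok"
  by (simp add: Ok_iff \<theta>_in_K algebraic_int_\<theta>)

lemma emb_algebraic_int:
  assumes "z \<in> Em" "x \<in> Ok"
  shows "algebraic_int (emb z x)"
proof -
  obtain q where q: "poly (map_poly of_int q) x = 0" "lead_coeff q = 1"
    using assms(2) unfolding Ok_iff algebraic_int_altdef_ipoly by blast
  have *: "poly (map_poly of_int q) y = rpoly (map_poly of_int q) y" for y :: "'b::field_char_0"
    by (simp add: rpoly_def map_poly_map_poly o_def)
  have "poly (map_poly of_int q) (emb z x) = emb z (poly (map_poly of_int q) x)"
    unfolding * using emb_rpoly[OF assms(1) Ok_subset[OF assms(2)]] by simp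
  then show ?thesis unfolding algebraic_int_altdef_ipoly using q assms(1) by auto
qed

lemma Nm_int: "x \<in> Ok \<Longrightarrow> Nm x \<in> \<int>"
  by (rule rational_algebraic_int_is_int)
     (auto simp: Nm_def[of x] intro!: algebraic_int_prod emb_algebraic_int Nm_rational[unfolded Nm_def] Ok_subset)

lemma norm_Nm_ge_1: "x \<in> Ok \<Longrightarrow> x \<noteq> 0 \<Longrightarrow> norm (Nm x) \<ge> 1"
  using Nm_int[of x] Nm_eq_0_iff[of x] by (auto simp: Ok_subset elim!: Ints_cases)

lemma norm_Nm: "norm (Nm x) = (\<Prod>z\<in>Em. norm (emb z x))"
  by (simp add: Nm_def prod_norm)

lemma power_basis: "x \<in> K \<Longrightarrow> \<exists>c. x = (\<Sum>i<d. of_rat (c i) * \<theta> ^ i)"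
proof -
  assume x: "x \<in> K"
  define q where "q = rep x mod f"
  have "x = rpoly (rep x div f * f + q) \<theta>" using rpoly_rep[OF x] by (simp add: q_def)
  then have "x = rpoly q \<theta>" using f_\<theta> by simp
  also have "\<dots> = (\<Sum>i\<le>degree q. of_rat (coeff q i) * \<theta> ^ i)" by (rule rpoly_altdef)
  also have "\<dots> = (\<Sum>i<d. of_rat (coeff q i) * \<theta> ^ i)"
  proof (rule sum.mono_neutral_left)
    have "degree q < d" using d_pos degree_mod_less[of f "rep x"] f_nonzero by (auto simp: q_def)
    then show "{..degree q} \<subseteq> {..<d}" by auto
  qed (auto simp: coeff_eq_0)
  finally show ?thesis by blast
qed

lemma K_span: "K = rat_span ((\<lambda>i. \<theta> ^ i) ` {..<d})"
proof
  show "K \<subseteq> rat_span ((\<lambda>i. \<theta> ^ i) ` {..<d})"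
  proof
    fix x assume "x \<in> K"
    then obtain c where "x = (\<Sum>i<d. of_rat (c i) * \<theta> ^ i)" using power_basis by blast
    then show "x \<in> rat_span ((\<lambda>i. \<theta> ^ i) ` {..<d})"
      by (simp only:) (rule rat_vs.span_sum, rule rat_vs.span_scale, rule rat_vs.span_base, auto)
  qed
  show "rat_span ((\<lambda>i. \<theta> ^ i) ` {..<d}) \<subseteq> K"
    using \<theta>_in_K K_closed(9) by (intro rat_vs.span_minimal closed_subfield_subspace[OF K_closed_subfield]) auto
qed

lemma independent_family_spans:
  fixes v :: "nat \<Rightarrow> 'a"
  assumes "\<And>i. i < d \<Longrightarrow> v i \<in> K"
    and "\<And>c i. (\<Sum>i<d. of_rat (c i) * v i) = 0 \<Longrightarrow> i < d \<Longrightarrow> c i = 0"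
    and "x \<in> K"
  shows "\<exists>c. x = (\<Sum>i<d. of_rat (c i) * v i)"
proof -
  have ind: "\<not> rat_vs.dependent (v ` {..<d})" "inj_on v {..<d}"
    using assms(2) by (rule rat_independent_powersI; blast)+
  have "card ((\<lambda>i. \<theta> ^ i) ` {..<d}) \<le> card (v ` {..<d})"
    using card_image[OF ind(2)] card_image_le[of "{..<d}" "\<lambda>i. \<theta> ^ i"] by simp
  then have "rat_span ((\<lambda>i. \<theta> ^ i) ` {..<d}) \<subseteq> rat_span (v ` {..<d})"
    using assms(1) K_span by (intro rat_independent_spans ind(1)) auto
  then have "x \<in> rat_span (v ` {..<d})" using assms(3) K_span by blast
  then obtain g where "x = (\<Sum>y\<in>v ` {..<d}. of_rat (g y) * y)"
    by (subst (asm) rat_vs.span_finite) auto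
  then show ?thesis by (subst (asm) sum.reindex[OF ind(2)]) auto
qed

end

subsection \<open>Finiteness of residues\<close>

text \<open>\<open>[0, B)\<close> is cut into \<open>T\<close> pieces in each coordinate, and
  \<open>h\<close> records the box of a point. The bound on \<open>card V\<close> is demanded for
  finite \<open>V\<close> only, since an infinite set has \<open>card\<close> 0 and collides
  anyway.\<close>

lemma pigeonhole_close:
  fixes g :: "'x \<Rightarrow> 'i \<Rightarrow> real"
  assumes fin: "finite I" and B: "B > 0" and T: "T > 0"
    and range: "\<And>x i. x \<in> V \<Longrightarrow> i \<in> I \<Longrightarrow> 0 \<le> g x i \<and> g x i < B"
    and card: "finite V \<Longrightarrow> card V > T ^ card I"
  shows "\<exists>x\<in>V. \<exists>y\<in>V. x \<noteq> y \<and> (\<forall>i\<in>I. \<bar>g x i - g y i\<bar> \<le> B / real T)"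
proof -
  define h where "h = (\<lambda>x. restrict (\<lambda>i. nat \<lfloor>g x i * real T / B\<rfloor>) I)"
  have nn: "0 \<le> g x i * real T / B" if "x \<in> V" "i \<in> I" for x i
    using range[OF that] B T by (intro divide_nonneg_pos mult_nonneg_nonneg) auto
  have "h x \<in> I \<rightarrow>\<^sub>E {..<T}" if x: "x \<in> V" for x
  proof -
    have "nat \<lfloor>g x i * real T / B\<rfloor> < T" if i: "i \<in> I" for i
    proof -
      have "g x i * real T < B * real T" using range[OF x i] T by (intro mult_strict_right_mono) simp_all
      then have "g x i * real T / B < real T" using B by (simp add: pos_divide_less_eq mult.commute)
      then have "\<lfloor>g x i * real T / B\<rfloor> < int T" by (simp only: floor_less_iff of_int_of_nat_eq)
      then show ?thesis using T by (simp add: nat_less_iff)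
    qed
    then show ?thesis unfolding h_def by (intro PiE_I) simp_all
  qed
  then have sub: "h ` V \<subseteq> I \<rightarrow>\<^sub>E {..<T}" by auto
  have finE: "finite (I \<rightarrow>\<^sub>E {..<T})" using fin by (intro finite_PiE) auto
  have cardE: "card (I \<rightarrow>\<^sub>E {..<T}) = T ^ card I" using fin by (simp add: card_PiE)
  have "\<not> inj_on h V"
  proof
    assume "inj_on h V"
    then have "finite V" "card V \<le> card (I \<rightarrow>\<^sub>E {..<T})"
      using sub finE by (auto intro: inj_on_finite card_inj_on_le)
    then show False using card cardE by simp
  qed
  then obtain x y where xy: "x \<in> V" "y \<in> V" "x \<noteq> y" "h x = h y" by (auto simp: inj_on_def)
  have "\<bar>g x i - g y i\<bar> \<le> B / real T" if i: "i \<in> I" for i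
  proof -
    have "nat \<lfloor>g x i * real T / B\<rfloor> = nat \<lfloor>g y i * real T / B\<rfloor>"
      using fun_cong[OF xy(4), of i] i by (simp add: h_def)
    then have "\<lfloor>g x i * real T / B\<rfloor> = \<lfloor>g y i * real T / B\<rfloor>"
      using nn[OF xy(1) i] nn[OF xy(2) i] by (metis eq_nat_nat_iff zero_le_floor)
    then have "\<bar>g x i * real T / B - g y i * real T / B\<bar> < 1" by linarith
    then have "\<bar>(g x i - g y i) * (real T / B)\<bar> < 1" by (simp add: algebra_simps)
    then have "\<bar>g x i - g y i\<bar> * (real T / B) < 1" using B T by (simp add: abs_mult)
    then show ?thesis using B T by (simp add: field_simps)
  qed
  then show ?thesis using xy by blast
qed

lemma norm_of_rat_complex: "norm (of_rat q :: complex) = \<bar>real_of_rat q\<bar>"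
proof (cases q)
  case (Fract a b)
  have "(of_rat q :: complex) = of_int a / of_int b" "real_of_rat q = of_int a / of_int b"
    unfolding Fract(1) using Fract(2) by (simp_all only: of_rat_rat)
  moreover have "norm (of_int a / of_int b :: complex) = norm (of_int a :: complex) / norm (of_int b :: complex)"
    by (rule norm_divide)
  moreover have "\<bar>real_of_int a / of_int b\<bar> = \<bar>real_of_int a\<bar> / \<bar>real_of_int b\<bar>" by (rule abs_divide)
  ultimately show ?thesis by (simp only: norm_of_int)
qed

section \<open>Integers with bounded conjugates and residue classes\<close>

context primitive_number_field
begin

text \<open>One real coordinate for each root: at \<open>z\<close> and \<open>cnj z\<close> the
  values are Re + Im and Re - Im, which together determine \<open>emb z x\<close>. So there are
  exactly \<open>d\<close> coordinates, without choosing a root from each conjugate pair.\<close>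

definition lin :: "complex \<Rightarrow> 'a \<Rightarrow> real" where "lin z x = Re (emb z x) + Im (emb z x)"

lemma norm_emb_le_lin:
  assumes "\<bar>lin z x\<bar> \<le> e" "\<bar>lin (cnj z) x\<bar> \<le> e"
  shows "norm (emb z x) \<le> 2 * e"
proof -
  have "\<bar>Re (emb z x)\<bar> \<le> e" "\<bar>Im (emb z x)\<bar> \<le> e"
    using assms by (auto simp: lin_def emb_cnj)
  then show ?thesis using cmod_le[of "emb z x"] by linarith
qed

lemma abs_lin_le: "\<bar>lin z x\<bar> \<le> 2 * norm (emb z x)"
  using abs_Re_le_cmod[of "emb z x"] abs_Im_le_cmod[of "emb z x"] by (simp add: lin_def)

lemma lin_diff: "z \<in> Em \<Longrightarrow> x \<in> K \<Longrightarrow> y \<in> K \<Longrightarrow> lin z (x - y) = lin z x - lin z y"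
  by (simp add: lin_def emb_diff)

text \<open>The product of the conjugates has absolute value below 1, whereas the norm of a nonzero
  integer is a nonzero rational integer.\<close>

lemma Ok_eq_0I:
  assumes "x \<in> Ok" "\<And>z. z \<in> Em \<Longrightarrow> norm (emb z x) \<le> 1 / 2"
  shows "x = 0"
proof (rule ccontr)
  assume "x \<noteq> 0"
  then have "1 \<le> norm (Nm x)" using norm_Nm_ge_1[OF assms(1)] by simp
  also have "norm (Nm x) \<le> (\<Prod>z\<in>Em. 1 / 2)"
    unfolding norm_Nm by (rule prod_mono) (use assms(2) in auto)
  also have "\<dots> = (1 / 2) ^ d" by (simp add: card_Em)
  also have "\<dots> < 1" using d_pos by (simp add: power_less_one_iff)
  finally show False by simp
qed

lemma finite_bounded_integers: "finite {x \<in> Ok. \<forall>z\<in>Em. norm (emb z x) \<le> C}"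
proof (rule ccontr)
  assume inf: "infinite {x \<in> Ok. \<forall>z\<in>Em. norm (emb z x) \<le> C}" (is "infinite ?X")
  have C: "C \<ge> 0"
  proof -
    obtain x where "x \<in> ?X" using infinite_imp_nonempty[OF inf] by blast
    moreover obtain z where "z \<in> Em" using Em_nonempty by blast
    ultimately have "norm (emb z x) \<le> C" by blast
    with norm_ge_zero[of "emb z x"] show ?thesis by linarith
  qed
  \<comment> \<open>Since \<open>lin\<close> is at most \<open>2 * C\<close> in absolute value,
    shifting by \<open>2 * C\<close> moves the coordinates into \<open>[0, 4 * C]\<close>. The
    choice of \<open>T\<close> gives boxes of side at most 1/4, which becomes 1/2 for the absolute
    values of the conjugates.\<close>
  define B where "B = 4 * C + 1"
  obtain T :: nat where T: "real T \<ge> 4 * B" using real_arch_simple by blast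
  have B: "B > 0" using C by (simp add: B_def)
  have "T > 0" using T B by (intro gr0I) auto
  have "\<exists>x\<in>?X. \<exists>y\<in>?X. x \<noteq> y \<and> (\<forall>z\<in>Em. \<bar>(lin z x + 2 * C) - (lin z y + 2 * C)\<bar> \<le> B / real T)"
  proof (rule pigeonhole_close[OF _ B \<open>T > 0\<close>])
    fix x z assume "x \<in> ?X" "z \<in> Em"
    then have "norm (emb z x) \<le> C" by blast
    then have "\<bar>lin z x\<bar> \<le> 2 * C" using abs_lin_le[of z x] by linarith
    then show "0 \<le> lin z x + 2 * C \<and> lin z x + 2 * C < B" unfolding B_def using C by linarith
  qed (use inf in auto)
  then obtain x y where xy: "x \<in> ?X" "y \<in> ?X" "x \<noteq> y"
    and "\<And>z. z \<in> Em \<Longrightarrow> \<bar>lin z x - lin z y\<bar> \<le> B / real T" by auto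
  moreover have q: "B / real T \<le> 1 / 4" using T \<open>T > 0\<close> by (simp add: field_simps)
  ultimately have "\<bar>lin z x - lin z y\<bar> \<le> 1 / 4" if "z \<in> Em" for z
    using that order_trans[OF _ q] by blast
  then have "\<bar>lin z (x - y)\<bar> \<le> 1 / 4" if "z \<in> Em" for z
    using that xy by (subst lin_diff) (auto simp: Ok_iff)
  then have "norm (emb z (x - y)) \<le> 1 / 2" if "z \<in> Em" for z
    using norm_emb_le_lin[of z "x - y" "1 / 4"] that cnj_Em by auto
  then have "x - y = 0" using xy by (intro Ok_eq_0I Ok_closed) auto
  then show False using xy by simp
qed

lemma power_basis_bound:
  obtains C where "C > 0" "\<And>z c e. z \<in> Em \<Longrightarrow> (\<And>i. i < d \<Longrightarrow> \<bar>real_of_rat (c i)\<bar> \<le> e) \<Longrightarrow>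
    norm (emb z (\<Sum>i<d. of_rat (c i) * \<theta> ^ i)) \<le> e * C"
proof
  define C where "C = 1 + (\<Sum>z\<in>Em. \<Sum>i<d. norm z ^ i)"
  show "C > 0" unfolding C_def by (intro add_pos_nonneg sum_nonneg) auto
  fix z c e assume z: "z \<in> Em" and c: "\<And>i. i < d \<Longrightarrow> \<bar>real_of_rat (c i)\<bar> \<le> e"
  have e: "e \<ge> 0" using c[of 0] d_pos by linarith
  have "(\<Sum>i<d. of_rat (c i) * \<theta> ^ i) = rpoly (\<Sum>i<d. monom (c i) i) \<theta>" by (simp add: rpoly_sum)
  then have "emb z (\<Sum>i<d. of_rat (c i) * \<theta> ^ i) = (\<Sum>i<d. of_rat (c i) * z ^ i)"
    using emb_rpoly_\<theta>[OF z, of "\<Sum>i<d. monom (c i) i"] by (simp add: rpoly_sum)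
  also have "norm \<dots> \<le> (\<Sum>i<d. e * norm z ^ i)"
  proof (rule sum_norm_le)
    fix i assume "i \<in> {..<d}"
    then show "norm (of_rat (c i) * z ^ i) \<le> e * norm z ^ i"
      using c[of i] \<open>i \<in> {..<d}\<close> by (simp add: norm_mult norm_power norm_of_rat_complex mult_right_mono)
  qed
  also have "\<dots> = e * (\<Sum>i<d. norm z ^ i)" by (simp add: sum_distrib_left)
  also have "\<dots> \<le> e * (\<Sum>z\<in>Em. \<Sum>i<d. norm z ^ i)"
    by (intro mult_left_mono e member_le_sum[OF z]) (auto intro: sum_nonneg)
  also have "\<dots> \<le> e * C" unfolding C_def by (intro mult_left_mono e) auto
  finally show "norm (emb z (\<Sum>i<d. of_rat (c i) * \<theta> ^ i)) \<le> e * C" .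
qed

lemma int_combination_in_int_adjoin: "(\<Sum>i<n. of_int (c i) * \<theta> ^ i) \<in> int_adjoin \<theta>"
proof -
  have "(\<Sum>i<n. of_int (c i) * \<theta> ^ i) = poly (map_poly of_int (\<Sum>i<n. monom (c i) i)) \<theta>"
    by (simp add: of_int_poly_hom.hom_sum of_int_hom.map_poly_hom_monom poly_sum poly_monom)
  then show ?thesis by (auto simp: int_adjoin_def)
qed

lemma int_poly_in_Ok: "x \<in> Ok \<Longrightarrow> poly (map_poly of_int p) x \<in> Ok"
  by (induction p) (auto simp: of_int_hom.map_poly_pCons_hom Ok_closed)

lemma int_adjoin_subset_Ok: "x \<in> Ok \<Longrightarrow> int_adjoin x \<subseteq> Ok"
  by (auto simp: int_adjoin_def int_poly_in_Ok)

text \<open>Rounding the coordinates of \<open>x / m\<close> in the power basis leaves a difference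
  with coordinates between 0 and \<open>m\<close>, hence with bounded conjugates. The multiplier
  \<open>y\<close> is kept in \<open>\<int>[\<theta>]\<close>, so that the case \<open>m = 1\<close>
  also controls the quotient of \<open>Ok\<close> by \<open>\<int>[\<theta>]\<close>.\<close>

lemma finite_residues:
  assumes "m > (0::int)"
  shows "\<exists>R. finite R \<and> R \<subseteq> Ok \<and> (\<forall>x\<in>Ok. \<exists>y\<in>int_adjoin \<theta>. x - of_int m * y \<in> R)"
proof -
  obtain C where C: "C > 0" "\<And>z c e. z \<in> Em \<Longrightarrow> (\<And>i. i < d \<Longrightarrow> \<bar>real_of_rat (c i)\<bar> \<le> e) \<Longrightarrow>
    norm (emb z (\<Sum>i<d. of_rat (c i) * \<theta> ^ i)) \<le> e * C" using power_basis_bound by metis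
  define R where "R = {x \<in> Ok. \<forall>z\<in>Em. norm (emb z x) \<le> real_of_int m * C}"
  have "\<exists>y\<in>int_adjoin \<theta>. x - of_int m * y \<in> R" if x: "x \<in> Ok" for x
  proof -
    obtain c where c: "x = (\<Sum>i<d. of_rat (c i) * \<theta> ^ i)" using power_basis[OF Ok_subset[OF x]] by blast
    define k where "k = (\<lambda>i. \<lfloor>c i / of_int m\<rfloor>)"
    define y where "y = (\<Sum>i<d. of_int (k i) * \<theta> ^ i)"
    have y: "y \<in> int_adjoin \<theta>" unfolding y_def by (rule int_combination_in_int_adjoin)
    then have "y \<in> Ok" using int_adjoin_subset_Ok[OF \<theta>_in_Ok] by blast
    have eq: "x - of_int m * y = (\<Sum>i<d. of_rat (c i - of_int m * of_int (k i)) * \<theta> ^ i)"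
      unfolding c y_def by (simp add: sum_distrib_left sum_subtractf of_rat_diff of_rat_mult algebra_simps)
    have b: "\<bar>real_of_rat (c i - of_int m * of_int (k i))\<bar> \<le> real_of_int m" for i
    proof -
      have "of_int (k i) \<le> c i / of_int m" "c i / of_int m < of_int (k i) + 1"
        unfolding k_def by linarith+
      then have "0 \<le> c i - of_int m * of_int (k i)" "c i - of_int m * of_int (k i) \<le> of_int m"
        using assms by (auto simp: field_simps)
      then have "0 \<le> real_of_rat (c i - of_int m * of_int (k i))"
        "real_of_rat (c i - of_int m * of_int (k i)) \<le> real_of_rat (of_int m)"
        by (simp_all only: zero_le_of_rat_iff of_rat_less_eq)
      then show ?thesis by simp
    qed
    have "norm (emb z (x - of_int m * y)) \<le> real_of_int m * C" if "z \<in> Em" for z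
      unfolding eq by (rule C(2)[OF that b])
    then have "x - of_int m * y \<in> R"
      unfolding R_def using x \<open>y \<in> Ok\<close> by (auto simp: Ok_closed)
    then show ?thesis using y by blast
  qed
  moreover have "finite R" unfolding R_def by (rule finite_bounded_integers)
  ultimately show ?thesis unfolding R_def by blast
qed

lemma finite_residues_Ok:
  assumes "m > (0::int)"
  shows "\<exists>R. finite R \<and> R \<subseteq> Ok \<and> (\<forall>x\<in>Ok. \<exists>y\<in>Ok. x - of_int m * y \<in> R)"
  using finite_residues[OF assms] int_adjoin_subset_Ok[OF \<theta>_in_Ok] by (meson subsetD)

text \<open>The finite set \<open>R\<close> for \<open>m = 1\<close> meets every class modulo
  \<open>\<int>[\<theta>]\<close>; each of its elements has a denominator, and \<open>E\<close> is
  the product of these.\<close>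

lemma Ok_multiple_in_int_adjoin: "\<exists>D>0. \<forall>x\<in>Ok. of_int D * x \<in> int_adjoin \<theta>"
proof -
  obtain R where R: "finite R" "R \<subseteq> Ok" "\<forall>x\<in>Ok. \<exists>y\<in>int_adjoin \<theta>. x - of_int 1 * y \<in> R"
    using finite_residues[of 1] by auto
  have cl: "x + y \<in> int_adjoin \<theta>" if "x \<in> int_adjoin \<theta>" "y \<in> int_adjoin \<theta>" for x y
  proof -
    from that obtain p q where "x = poly (map_poly of_int p) \<theta>" "y = poly (map_poly of_int q) \<theta>"
      by (auto simp: int_adjoin_def)
    then have "x + y = poly (map_poly of_int (p + q)) \<theta>" by (simp add: of_int_hom.map_poly_hom_add)
    then show ?thesis by (auto simp: int_adjoin_def)
  qed
  have ml: "of_int k * x \<in> int_adjoin \<theta>" if "x \<in> int_adjoin \<theta>" for x k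
  proof -
    from that obtain p where "x = poly (map_poly of_int p) \<theta>" by (auto simp: int_adjoin_def)
    then have "of_int k * x = poly (map_poly of_int (smult k p)) \<theta>" by (simp add: of_int_hom.map_poly_hom_smult)
    then show ?thesis by (auto simp: int_adjoin_def)
  qed
  have "\<exists>D>0. of_int D * x \<in> int_adjoin \<theta>" if "x \<in> K" for x
  proof -
    obtain D q where D: "D > 0" "smult (of_int D) (rep x) = map_poly rat_of_int q" using clear_denominators by blast
    have "of_int D * x = rpoly (smult (of_int D) (rep x)) \<theta>" using rpoly_rep[OF that] by simp
    also have "\<dots> = poly (map_poly of_int q) \<theta>" unfolding D(2) rpoly_def by (simp add: map_poly_map_poly o_def)
    finally show ?thesis using D(1) by (auto simp: int_adjoin_def)
  qed
  then have "\<forall>x\<in>R. \<exists>D>0. of_int D * x \<in> int_adjoin \<theta>" using R(2) Ok_subset by blast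
  then have "\<exists>D. \<forall>r\<in>R. D r > 0 \<and> of_int (D r) * r \<in> int_adjoin \<theta>" by (rule bchoice)
  then obtain D where D: "\<And>r. r \<in> R \<Longrightarrow> D r > 0 \<and> of_int (D r) * r \<in> int_adjoin \<theta>" by blast
  define E where "E = prod D R"
  have "of_int E * x \<in> int_adjoin \<theta>" if x: "x \<in> Ok" for x
  proof -
    obtain y where y: "y \<in> int_adjoin \<theta>" "x - y \<in> R" using R(3) x by auto
    have "E = D (x - y) * prod D (R - {x - y})" unfolding E_def using R(1) y(2) by (rule prod.remove)
    then have "of_int E * (x - y) = of_int (prod D (R - {x - y})) * (of_int (D (x - y)) * (x - y))"
      by (simp add: mult_ac)
    also have "\<dots> \<in> int_adjoin \<theta>" by (rule ml) (use D[OF y(2)] in blast)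
    finally have "of_int E * (x - y) + of_int E * y \<in> int_adjoin \<theta>" using ml[OF y(1)] by (rule cl)
    then show ?thesis by (simp add: algebra_simps)
  qed
  moreover have "E > 0" unfolding E_def using D by (intro prod_pos) auto
  ultimately show ?thesis by blast
qed

text \<open>A substitute for Euclidean division. Two of the \<open>T ^ d + 1\<close> multiples
  \<open>0, x, ..., T ^ d * x\<close> have their fractional coordinates in the same one of
  \<open>T ^ d\<close> boxes, so their difference is close to an integer of \<open>K\<close>. The
  bound \<open>T ^ d\<close> is uniform in \<open>x\<close>.\<close>

lemma hurwitz:
  "\<exists>M>0. \<forall>x\<in>K. \<exists>t\<in>{1..M::nat}. \<exists>w\<in>Ok. norm (Nm (of_nat t * x - w)) < 1"
proof -
  obtain C where C: "C > 0" "\<And>z c e. z \<in> Em \<Longrightarrow> (\<And>i. i < d \<Longrightarrow> \<bar>real_of_rat (c i)\<bar> \<le> e) \<Longrightarrow>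
    norm (emb z (\<Sum>i<d. of_rat (c i) * \<theta> ^ i)) \<le> e * C" using power_basis_bound by metis
  \<comment> \<open>Boxes of side \<open>1 / T\<close> then give conjugates of absolute value at
    most \<open>C / T \<le> 1 / 2\<close>, hence a norm below 1.\<close>
  obtain T :: nat where T: "real T \<ge> 2 * C" using real_arch_simple by blast
  have "T > 0" using T C by (intro gr0I) auto
  have "\<exists>t\<in>{1..T ^ d}. \<exists>w\<in>Ok. norm (Nm (of_nat t * x - w)) < 1" if x: "x \<in> K" for x
  proof -
    obtain c where c: "x = (\<Sum>i<d. of_rat (c i) * \<theta> ^ i)" using power_basis[OF x] by blast
    define k where "k = (\<lambda>t i. \<lfloor>of_nat t * c i\<rfloor>)"
    define g where "g = (\<lambda>t i. of_nat t * c i - of_int (k t i))"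
    have g: "0 \<le> g t i" "g t i < 1" for t i unfolding g_def k_def by linarith+
    have "\<exists>t\<in>{0..T ^ d}. \<exists>s\<in>{0..T ^ d}. t \<noteq> s \<and>
      (\<forall>i\<in>{..<d}. \<bar>real_of_rat (g t i) - real_of_rat (g s i)\<bar> \<le> 1 / real T)"
      by (rule pigeonhole_close[OF _ _ \<open>T > 0\<close>]) (auto simp: g)
    then obtain t s where ts: "t \<le> T ^ d" "s \<le> T ^ d" "t \<noteq> s"
      "\<And>i. i < d \<Longrightarrow> \<bar>real_of_rat (g t i) - real_of_rat (g s i)\<bar> \<le> 1 / real T" by auto
    have main: "\<exists>w\<in>Ok. norm (Nm (of_nat (t - s) * x - w)) < 1"
      if le: "s \<le> t" and h: "\<And>i. i < d \<Longrightarrow> \<bar>real_of_rat (g t i) - real_of_rat (g s i)\<bar> \<le> 1 / real T" for s t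
    proof
      define w where "w = (\<Sum>i<d. of_int (k t i - k s i) * \<theta> ^ i)"
      show wO: "w \<in> Ok" unfolding w_def
        by (rule subsetD[OF int_adjoin_subset_Ok[OF \<theta>_in_Ok] int_combination_in_int_adjoin])
      have eq: "of_nat (t - s) * x - w = (\<Sum>i<d. of_rat (g t i - g s i) * \<theta> ^ i)"
      proof -
        have "g t i - g s i = of_nat (t - s) * c i - of_int (k t i - k s i)" for i
          using le by (simp add: g_def of_nat_diff algebra_simps)
        then have "of_rat (g t i - g s i) * \<theta> ^ i
            = of_nat (t - s) * (of_rat (c i) * \<theta> ^ i) - of_int (k t i - k s i) * \<theta> ^ i" for i
          by (simp add: of_rat_diff of_rat_mult left_diff_distrib mult.assoc)
        then show ?thesis unfolding c w_def by (simp only: sum_subtractf sum_distrib_left)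
      qed
      have "norm (emb z (of_nat (t - s) * x - w)) \<le> 1 / 2" if "z \<in> Em" for z
      proof -
        have "norm (emb z (of_nat (t - s) * x - w)) \<le> 1 / real T * C"
          unfolding eq using h by (intro C(2)[OF that]) (simp only: of_rat_diff)
        also have "\<dots> \<le> 1 / 2" using T \<open>T > 0\<close> by (simp add: field_simps)
        finally show ?thesis .
      qed
      then have "norm (Nm (of_nat (t - s) * x - w)) \<le> (\<Prod>z\<in>Em. 1 / 2)"
        unfolding norm_Nm by (intro prod_mono) auto
      also have "\<dots> = (1 / 2) ^ d" by (simp add: card_Em)
      also have "\<dots> < 1" using d_pos by (simp add: power_less_one_iff)
      finally show "norm (Nm (of_nat (t - s) * x - w)) < 1" .
    qed
    show ?thesis
    proof (cases "s \<le> t")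
      case True
      moreover have "t - s \<in> {1..T ^ d}" using True ts by auto
      ultimately show ?thesis using main[of s t] ts(4) by blast
    next
      case False
      have "\<bar>real_of_rat (g s i) - real_of_rat (g t i)\<bar> \<le> 1 / real T" if "i < d" for i
        using ts(4)[OF that] by (simp only: abs_minus_commute)
      then have "\<exists>w\<in>Ok. norm (Nm (of_nat (s - t) * x - w)) < 1" using main[of t s] False by simp
      moreover have "s - t \<in> {1..T ^ d}" using False ts by auto
      ultimately show ?thesis by blast
    qed
  qed
  moreover have "T ^ d > 0" using \<open>T > 0\<close> by simp
  ultimately show ?thesis by blast
qed

subsection \<open>Ideals of the ring of integers\<close>

abbreviation OR :: "'a ring" where "OR \<equiv> subring_of Ok"

definition is_ideal :: "'a set \<Rightarrow> bool"
  where "is_ideal A \<longleftrightarrow> A \<subseteq> Ok \<and> 0 \<in> A \<and> (\<forall>x\<in>A. \<forall>y\<in>A. x + y \<in> A) \<and> (\<forall>x\<in>A. \<forall>r\<in>Ok. r * x \<in> A)"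

lemma is_idealD:
  assumes "is_ideal A"
  shows "x \<in> A \<Longrightarrow> x \<in> Ok" "0 \<in> A" "x \<in> A \<Longrightarrow> y \<in> A \<Longrightarrow> x + y \<in> A"
    "x \<in> A \<Longrightarrow> r \<in> Ok \<Longrightarrow> r * x \<in> A" "x \<in> A \<Longrightarrow> r \<in> Ok \<Longrightarrow> x * r \<in> A"
    "x \<in> A \<Longrightarrow> - x \<in> A" "x \<in> A \<Longrightarrow> y \<in> A \<Longrightarrow> x - y \<in> A"
proof -
  show *: "x \<in> A \<Longrightarrow> x \<in> Ok" "0 \<in> A" "x \<in> A \<Longrightarrow> y \<in> A \<Longrightarrow> x + y \<in> A"
    "x \<in> A \<Longrightarrow> r \<in> Ok \<Longrightarrow> r * x \<in> A" for x y r
    using assms by (auto simp: is_ideal_def)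
  show "x \<in> A \<Longrightarrow> r \<in> Ok \<Longrightarrow> x * r \<in> A" using *(4)[of x r] by (simp add: mult.commute)
  show m: "x \<in> A \<Longrightarrow> - x \<in> A" for x using *(4)[of x "- 1"] Ok_closed by auto
  show "x \<in> A \<Longrightarrow> y \<in> A \<Longrightarrow> x - y \<in> A" using *(3)[of x "- y"] m by simp
qed

lemma OR_cring: "cring OR"
proof (rule cringI)
  show "abelian_group OR"
    by (rule abelian_groupI) (auto simp: Ok_closed algebra_simps intro!: bexI[of _ "- _"])
  show "Group.comm_monoid OR"
    by (rule comm_monoidI) (auto simp: Ok_closed)
qed (auto simp: algebra_simps)

lemma OR_minus: "x \<in> Ok \<Longrightarrow> \<ominus>\<^bsub>OR\<^esub> x = - x"
proof -
  assume x: "x \<in> Ok"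
  interpret cring OR by (rule OR_cring)
  show ?thesis by (rule minus_equality) (use x Ok_closed in auto)
qed

lemma ideal_iff: "ideal A OR \<longleftrightarrow> is_ideal A"
proof
  assume A: "ideal A OR"
  note S = ideal.axioms(1)[OF A]
  show "is_ideal A" unfolding is_ideal_def
    using additive_subgroup.a_subset[OF S] additive_subgroup.zero_closed[OF S]
      additive_subgroup.a_closed[OF S] ideal.I_l_closed[OF A] by auto
next
  assume A: "is_ideal A"
  interpret cring OR by (rule OR_cring)
  show "ideal A OR"
  proof (rule idealI)
    show "subgroup A (add_monoid OR)"
    proof (rule group.subgroupI[OF a_group])
      show "A \<subseteq> carrier (add_monoid OR)" using A by (auto dest: is_idealD)
      show "A \<noteq> {}" using is_idealD(2)[OF A] by auto
      fix a assume a: "a \<in> A"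
      have "inv\<^bsub>add_monoid OR\<^esub> a = - a" using OR_minus[OF is_idealD(1)[OF A a]] by (simp add: a_inv_def)
      then show "inv\<^bsub>add_monoid OR\<^esub> a \<in> A" using is_idealD(6)[OF A a] by simp
      fix b assume "b \<in> A"
      then show "a \<otimes>\<^bsub>add_monoid OR\<^esub> b \<in> A" using is_idealD(3)[OF A a] by simp
    qed
  qed (use A in \<open>auto dest: is_idealD(4,5) intro: ring_axioms\<close>)
qed

abbreviation iprod :: "'a set \<Rightarrow> 'a set \<Rightarrow> 'a set" where "iprod A B \<equiv> ideal_prod OR A B"

abbreviation ipow :: "'a set \<Rightarrow> nat \<Rightarrow> 'a set" where "ipow A n \<equiv> A [^]\<^bsub>ideals_set OR\<^esub> n"

lemma iprod_mem: "a \<in> A \<Longrightarrow> b \<in> B \<Longrightarrow> a * b \<in> iprod A B"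
  using ideal_prod.prod[of a A b B OR] by simp

lemma iprod_add: "x \<in> iprod A B \<Longrightarrow> y \<in> iprod A B \<Longrightarrow> x + y \<in> iprod A B"
  using ideal_prod.sum[of x OR A B y] by simp

lemma iprod_induct [consumes 1, case_names prod sum]:
  assumes "x \<in> iprod A B" and "\<And>a b. a \<in> A \<Longrightarrow> b \<in> B \<Longrightarrow> P (a * b)"
    and "\<And>x y. P x \<Longrightarrow> P y \<Longrightarrow> P (x + y)"
  shows "P x"
  using assms(1) by (induction rule: ideal_prod.induct) (use assms(2,3) in auto)

lemma is_ideal_iprod: "is_ideal A \<Longrightarrow> is_ideal B \<Longrightarrow> is_ideal (iprod A B)"
  using ring.ideal_prod_is_ideal[OF cring.axioms(1)[OF OR_cring]] by (simp add: ideal_iff)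

lemma is_ideal_Ok: "is_ideal Ok"
  by (auto simp: is_ideal_def Ok_closed)

lemma ideals_monoid: "Group.comm_monoid (ideals_set OR)"
  by (rule cring.ideals_set_is_comm_monoid[OF OR_cring])

lemma ipow_0: "ipow A 0 = Ok"
  by (simp add: ideals_set_def)

lemma ipow_Suc: "ipow A (Suc n) = iprod (ipow A n) A"
  by (simp add: ideals_set_def)

lemma is_ideal_ipow: "is_ideal A \<Longrightarrow> is_ideal (ipow A n)"
  by (induction n) (auto simp only: ipow_0 ipow_Suc is_ideal_Ok is_ideal_iprod)

lemma ipow_add: "is_ideal A \<Longrightarrow> ipow A (m + n) = iprod (ipow A m) (ipow A n)"
  using monoid.nat_pow_mult[OF comm_monoid.axioms(1)[OF ideals_monoid], of A m n]
  by (simp add: ideals_set_def ideal_iff)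

lemma ipow_1: "is_ideal A \<Longrightarrow> ipow A 1 = A"
  using monoid.nat_pow_eone[OF comm_monoid.axioms(1)[OF ideals_monoid], of A]
  by (simp add: ideals_set_def ideal_iff)

lemma iprod_subset: "is_ideal A \<Longrightarrow> is_ideal B \<Longrightarrow> iprod A B \<subseteq> A"
proof
  fix x assume AB: "is_ideal A" "is_ideal B" and "x \<in> iprod A B"
  from this(3) show "x \<in> A"
    by (induction rule: iprod_induct) (use AB in \<open>auto intro: is_idealD(3,5)[OF AB(1)] dest: is_idealD(1)[OF AB(2)]\<close>)
qed

lemma ipow_mono: "is_ideal A \<Longrightarrow> m \<le> n \<Longrightarrow> ipow A n \<subseteq> ipow A m"
proof -
  assume A: "is_ideal A" and "m \<le> n"
  then have "ipow A n = iprod (ipow A m) (ipow A (n - m))" using ipow_add[OF A, of m "n - m"] by simp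
  then show ?thesis using iprod_subset A is_ideal_ipow by simp
qed

lemma power_in_ipow: "is_ideal A \<Longrightarrow> a \<in> A \<Longrightarrow> a ^ n \<in> ipow A n"
proof (induction n)
  case 0
  then show ?case by (simp only: ipow_0 power_0 Ok_closed)
next
  case (Suc n)
  then have "a ^ n * a \<in> iprod (ipow A n) A" by (intro iprod_mem) auto
  then show ?case by (simp only: ipow_Suc power_Suc2)
qed

section \<open>Finiteness and cancellation of ideals\<close>

lemma in_K_rational_multiple:
  assumes "x \<in> K"
  shows "\<exists>D>0. of_int D * x \<in> Ok"
proof -
  obtain f where "f \<noteq> 0" "rpoly f x = 0"
    using number_field_minimal_polynomial[OF K assms] by (metis Factorial_Ring.irreducible_def)
  then obtain D where "D > 0" "algebraic_int (of_int D * x)"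
    using rational_root_multiple_algebraic_int by blast
  then show ?thesis using assms by (auto simp: Ok_iff intro!: K_closed)
qed

lemma divides_positive_integer:
  assumes "a \<in> Ok" "a \<noteq> 0"
  shows "\<exists>N>0. \<exists>b\<in>Ok. a * b = of_int N"
proof -
  obtain D where D: "D > 0" "of_int D * inverse a \<in> Ok"
    using in_K_rational_multiple[of "inverse a"] assms by (auto simp: Ok_iff intro: K_closed)
  then have "a * (of_int D * inverse a) = of_int D" using assms by (simp add: field_simps)
  then show ?thesis using D by blast
qed

lemma ideal_contains_positive_integer:
  assumes "is_ideal A" "A \<noteq> {0}"
  shows "\<exists>N>0. of_int N \<in> A"
proof -
  obtain a where a: "a \<in> A" "a \<noteq> 0" using assms is_idealD(2) by blast
  obtain N b where "N > 0" "b \<in> Ok" "a * b = of_int N"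
    using divides_positive_integer[of a] a is_idealD(1)[OF assms(1)] by metis
  then show ?thesis using is_idealD(5)[OF assms(1) a(1)] by metis
qed

text \<open>An ideal containing \<open>m\<close> is a union of classes modulo \<open>m\<close>, so
  it is determined by its intersection with the finite set \<open>R\<close>.\<close>

lemma finite_ideals_containing:
  assumes "m > (0::int)"
  shows "finite {A. is_ideal A \<and> of_int m \<in> A}"
proof -
  obtain R where R: "finite R" "R \<subseteq> Ok" "\<forall>x\<in>Ok. \<exists>y\<in>Ok. x - of_int m * y \<in> R"
    using finite_residues_Ok[OF assms] by blast
  have "inj_on (\<lambda>A. A \<inter> R) {A. is_ideal A \<and> of_int m \<in> A}"
  proof (rule inj_onI)
    have "A \<subseteq> B" if A: "is_ideal A" "of_int m \<in> A" and B: "is_ideal B" "of_int m \<in> B"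
      and eq: "A \<inter> R = B \<inter> R" for A B
    proof
      fix x assume x: "x \<in> A"
      then obtain y where y: "y \<in> Ok" "x - of_int m * y \<in> R" using R(3) is_idealD(1)[OF A(1)] by blast
      have "x - of_int m * y \<in> A" by (rule is_idealD(7)[OF A(1) x is_idealD(5)[OF A(1) A(2) y(1)]])
      then have "x - of_int m * y \<in> B" using y(2) eq by blast
      then have "(x - of_int m * y) + of_int m * y \<in> B"
        by (rule is_idealD(3)[OF B(1) _ is_idealD(5)[OF B(1) B(2) y(1)]])
      then show "x \<in> B" by simp
    qed
    then show "A = B" if "A \<in> {A. is_ideal A \<and> of_int m \<in> A}" "B \<in> {A. is_ideal A \<and> of_int m \<in> A}"
      "A \<inter> R = B \<inter> R" for A B using that by (metis (no_types, lifting) mem_Collect_eq subset_antisym)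
  qed
  moreover have "finite ((\<lambda>A. A \<inter> R) ` {A. is_ideal A \<and> of_int m \<in> A})"
    by (rule finite_subset[of _ "Pow R"]) (use R(1) in auto)
  ultimately show ?thesis by (rule finite_imageD[rotated])
qed

text \<open>All \<open>N * w ^ k\<close> are integral and fall into finitely many classes modulo
  \<open>N\<close>. A repetition for \<open>i < j\<close> makes \<open>w ^ j - w ^ i\<close>
  integral, so \<open>w\<close> is a root of a monic polynomial with integral coefficients.\<close>

lemma almost_integral_imp_integral:
  assumes w: "w \<in> K" and a: "a \<in> Ok" "a \<noteq> 0" and pw: "\<And>k. w ^ k * a \<in> Ok"
  shows "w \<in> Ok"
proof -
  obtain N b where N: "N > 0" "b \<in> Ok" "a * b = of_int N" using divides_positive_integer[OF a] by blast
  have Nw: "of_int N * w ^ k \<in> Ok" for k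
  proof -
    have eq: "of_int N * w ^ k = (w ^ k * a) * b" unfolding N(3)[symmetric] by (simp only: mult_ac)
    show ?thesis unfolding eq by (rule Ok_closed(4)[OF pw N(2)])
  qed
  obtain R where R: "finite R" "R \<subseteq> Ok" "\<forall>x\<in>Ok. \<exists>y\<in>Ok. x - of_int N * y \<in> R"
    using finite_residues_Ok[OF N(1)] by blast
  have "\<forall>k. \<exists>y\<in>Ok. of_int N * w ^ k - of_int N * y \<in> R" using R(3) Nw by blast
  then obtain y where y: "\<And>k. y k \<in> Ok" "\<And>k. of_int N * w ^ k - of_int N * y k \<in> R" by metis
  define h where "h = (\<lambda>k::nat. of_int N * w ^ k - of_int N * y k)"
  have "finite (range h)" by (rule finite_subset[OF _ R(1)]) (auto simp: h_def y(2))
  then have "\<not> inj h" using finite_imageD[of h UNIV] by auto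
  then obtain i j where ij: "i < j" "h i = h j" by (metis injI linorder_neqE_nat)
  then have "of_int N * (w ^ j - w ^ i) = of_int N * (y j - y i)" by (simp add: h_def algebra_simps)
  then have eq: "w ^ j - w ^ i = y j - y i" using N(1) by simp
  have "algebraic_int w"
  proof (rule algebraic_int_root[of "y j - y i" "monom 1 j - monom 1 i"])
    show "algebraic_int (y j - y i)" using y(1) Ok_closed(6) Ok_iff by blast
    show "poly (monom 1 j - monom 1 i) w = y j - y i"
      by (simp only: poly_diff poly_monom mult_1_left eq)
    show "\<forall>k. coeff (monom 1 j - monom 1 i :: 'a poly) k \<in> \<int>" by auto
    have lt: "degree (monom 1 i :: 'a poly) < degree (monom 1 j :: 'a poly)" using ij(1) by (simp add: degree_monom_eq)
    have "degree (monom 1 j + - monom 1 i :: 'a poly) = j"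
      using lt by (subst degree_add_eq_left) (auto simp: degree_monom_eq)
    then have dg: "degree (monom 1 j - monom 1 i :: 'a poly) = j" by simp
    then show "lead_coeff (monom 1 j - monom 1 i :: 'a poly) = 1" using ij(1) by simp
    show "degree (monom 1 j - monom 1 i :: 'a poly) > 0" using dg ij(1) by simp
  qed
  then show ?thesis using w by (simp add: Ok_iff)
qed

lemma multiplier_integral:
  assumes A: "is_ideal A" "A \<noteq> {0}" and w: "w \<in> K" and mul: "\<And>a. a \<in> A \<Longrightarrow> w * a \<in> A"
  shows "w \<in> Ok"
proof -
  obtain a where a: "a \<in> A" "a \<noteq> 0" using A is_idealD(2) by blast
  have "w ^ k * a \<in> A" for k
    by (induction k) (use a mul in \<open>auto simp: mult.assoc\<close>)
  then show ?thesis using almost_integral_imp_integral[OF w _ a(2)] a is_idealD(1)[OF A(1)] by blast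
qed

text \<open>Gaussian elimination modulo \<open>B\<close>. A factor \<open>c\<close> congruent to 1
  on the left avoids division: the relation for \<open>g0\<close> is solved with the factor
  \<open>c' = c0 - b0 g0\<close>, again congruent to 1, and the other relations are multiplied by
  \<open>c'\<close> before substituting. When the remaining generators vanish,
  \<open>c' * g0 = 0\<close> with \<open>g0 \<noteq> 0\<close>, so \<open>c' = 0\<close> and
  \<open>1 \<in> B\<close>.\<close>

lemma determinant_free_nakayama:
  assumes B: "is_ideal B" and "finite G" "\<exists>g\<in>G. g \<noteq> 0"
    and "\<And>g. g \<in> G \<Longrightarrow> \<exists>c b. 1 - c \<in> B \<and> (\<forall>g'\<in>G. b g' \<in> B) \<and> c * g = (\<Sum>g'\<in>G. b g' * g')"
  shows "1 \<in> B"
  using assms(2-)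
proof (induction G)
  case (insert g0 G)
  obtain c0 b0 where 0: "1 - c0 \<in> B" "\<forall>g'\<in>insert g0 G. b0 g' \<in> B" "c0 * g0 = (\<Sum>g'\<in>insert g0 G. b0 g' * g')"
    using insert.prems(2)[OF insertI1] by metis
  define c' where "c' = c0 - b0 g0"
  have c': "c' * g0 = (\<Sum>g'\<in>G. b0 g' * g')"
    using 0(3) insert.hyps by (simp add: c'_def algebra_simps)
  have "(1 - c0) + b0 g0 \<in> B" using 0 is_idealD(3)[OF B] by auto
  then have c'B: "1 - c' \<in> B" by (simp add: c'_def algebra_simps)
  then have c'O: "c' \<in> Ok" using is_idealD(1)[OF B c'B] Ok_closed(6)[OF Ok_closed(2), of "1 - c'"] by simp
  show ?case
  proof (cases "\<exists>g\<in>G. g \<noteq> 0")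
    case False
    then have "(\<Sum>g'\<in>G. b0 g' * g') = 0" by (intro sum.neutral) auto
    then have "c' * g0 = 0" using c' by simp
    then have "c' = 0" using False insert.prems(1) by auto
    then show ?thesis using c'B by simp
  next
    case True
    show ?thesis
    proof (rule insert.IH[OF True])
      fix g assume g: "g \<in> G"
      then obtain c b where cb: "1 - c \<in> B" "\<forall>g'\<in>insert g0 G. b g' \<in> B" "c * g = (\<Sum>g'\<in>insert g0 G. b g' * g')"
        using insert.prems(2)[OF insertI2[OF g]] by metis
      have "c * g = b g0 * g0 + (\<Sum>g'\<in>G. b g' * g')"
        by (simp only: cb(3) sum.insert[OF insert.hyps(1,2)])
      then have "(c' * c) * g = c' * (b g0 * g0 + (\<Sum>g'\<in>G. b g' * g'))" by (simp only: mult.assoc)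
      also have "\<dots> = b g0 * (c' * g0) + c' * (\<Sum>g'\<in>G. b g' * g')" by (simp add: algebra_simps)
      also have "\<dots> = (\<Sum>g'\<in>G. (b g0 * b0 g' + c' * b g') * g')"
        unfolding c' by (simp add: sum_distrib_left sum.distrib algebra_simps)
      finally have e: "(c' * c) * g = (\<Sum>g'\<in>G. (b g0 * b0 g' + c' * b g') * g')" .
      have "(1 - c') + c' * (1 - c) \<in> B" by (rule is_idealD(3)[OF B c'B is_idealD(4)[OF B cb(1) c'O]])
      then have "1 - c' * c \<in> B" by (simp add: algebra_simps)
      moreover have "b g0 * b0 g' + c' * b g' \<in> B" if "g' \<in> G" for g'
      proof -
        have "b g0 \<in> B" "b0 g' \<in> B" "b g' \<in> B" using that cb(2) 0(2) by auto
        then show ?thesis using is_idealD(3)[OF B is_idealD(4)[OF B _ is_idealD(1)[OF B]] is_idealD(4)[OF B _ c'O]] by blast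
      qed
      ultimately show "\<exists>c b. 1 - c \<in> B \<and> (\<forall>g'\<in>G. b g' \<in> B) \<and> c * g = (\<Sum>g'\<in>G. b g' * g')"
        using e by (intro exI[of _ "c' * c"] exI[of _ "\<lambda>g'. b g0 * b0 g' + c' * b g'"]) auto
    qed
  qed
qed simp

text \<open>A positive integer \<open>N\<close> in \<open>A\<close> generates it together with the
  finitely many residues modulo \<open>N\<close> that lie in \<open>A\<close>.\<close>

lemma ideal_finitely_generated:
  assumes A: "is_ideal A" "A \<noteq> {0}"
  shows "\<exists>G. finite G \<and> G \<subseteq> A \<and> (\<exists>g\<in>G. g \<noteq> 0) \<and> (\<forall>x\<in>A. \<exists>r. (\<forall>g\<in>G. r g \<in> Ok) \<and> x = (\<Sum>g\<in>G. r g * g))"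
proof -
  obtain N where N: "N > 0" "of_int N \<in> A" using ideal_contains_positive_integer[OF A] by blast
  obtain R where R: "finite R" "R \<subseteq> Ok" "\<forall>x\<in>Ok. \<exists>y\<in>Ok. x - of_int N * y \<in> R"
    using finite_residues_Ok[OF N(1)] by blast
  define G where "G = insert (of_int N) (R \<inter> A)"
  have G: "finite G" "G \<subseteq> A" using R N by (auto simp: G_def)
  have "\<exists>r. (\<forall>g\<in>G. r g \<in> Ok) \<and> x = (\<Sum>g\<in>G. r g * g)" if x: "x \<in> A" for x
  proof -
    obtain y where y: "y \<in> Ok" "x - of_int N * y \<in> R" using R(3) is_idealD(1)[OF A(1) x] by blast
    define s where "s = x - of_int N * y"
    have "s \<in> A" unfolding s_def by (rule is_idealD(7)[OF A(1) x is_idealD(5)[OF A(1) N(2) y(1)]])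
    then have s: "s \<in> G" using y(2) by (auto simp: G_def s_def)
    \<comment> \<open>The two indicators are added, because \<open>s\<close> may coincide with
      \<open>of_int N\<close>.\<close>
    define r where "r = (\<lambda>g. (if g = of_int N then y else 0) + (if g = s then 1 else 0))"
    have "(\<Sum>g\<in>G. r g * g) = (\<Sum>g\<in>G. (if g = of_int N then y * g else 0)) + (\<Sum>g\<in>G. if g = s then g else 0)"
      unfolding sum.distrib[symmetric] by (rule sum.cong) (auto simp: r_def algebra_simps)
    also have "\<dots> = y * of_int N + s" using G(1) s by (simp add: G_def)
    also have "\<dots> = x" by (simp add: s_def algebra_simps)
    finally have "x = (\<Sum>g\<in>G. r g * g)" by simp
    moreover have "\<forall>g\<in>G. r g \<in> Ok" using y(1) by (auto simp: r_def intro!: Ok_closed)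
    ultimately show ?thesis by blast
  qed
  then show ?thesis using G N(1) by (intro exI[of _ G]) (auto simp: G_def)
qed

text \<open>Each generator of \<open>A\<close> is a combination of the generators with coefficients
  in \<open>B\<close>, so the Nakayama argument applies with every \<open>c = 1\<close>. This
  cancellation law stands in for inverses of ideals.\<close>

lemma iprod_eq_self_imp_one:
  assumes A: "is_ideal A" "A \<noteq> {0}" and B: "is_ideal B" and sub: "A \<subseteq> iprod A B"
  shows "1 \<in> B"
proof -
  obtain G where G: "finite G" "G \<subseteq> A" "\<exists>g\<in>G. g \<noteq> 0"
    "\<forall>x\<in>A. \<exists>r. (\<forall>g\<in>G. r g \<in> Ok) \<and> x = (\<Sum>g\<in>G. r g * g)"
    using ideal_finitely_generated[OF A] by blast
  have comb: "\<exists>b. (\<forall>g\<in>G. b g \<in> B) \<and> x = (\<Sum>g\<in>G. b g * g)" if "x \<in> iprod A B" for x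
    using that
  proof (induction rule: iprod_induct)
    case (prod a b)
    obtain r where r: "\<forall>g\<in>G. r g \<in> Ok" "a = (\<Sum>g\<in>G. r g * g)" using G(4) prod(1) by blast
    have 1: "a * b = (\<Sum>g\<in>G. (r g * b) * g)"
      unfolding r(2) sum_distrib_right by (rule sum.cong) (simp_all add: mult_ac)
    have 2: "\<forall>g\<in>G. r g * b \<in> B" using r(1) prod(2) is_idealD(4)[OF B] by blast
    show ?case by (intro exI[of _ "\<lambda>g. r g * b"] conjI 1 2)
  next
    case (sum x y)
    from sum(1) obtain b where b: "\<forall>g\<in>G. b g \<in> B" "x = (\<Sum>g\<in>G. b g * g)" by blast
    from sum(2) obtain c where c: "\<forall>g\<in>G. c g \<in> B" "y = (\<Sum>g\<in>G. c g * g)" by blast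
    have 1: "x + y = (\<Sum>g\<in>G. (b g + c g) * g)"
      unfolding b(2) c(2) by (simp only: distrib_right sum.distrib)
    have 2: "\<forall>g\<in>G. b g + c g \<in> B" using b(1) c(1) is_idealD(3)[OF B] by blast
    show ?case by (intro exI[of _ "\<lambda>g. b g + c g"] conjI 1 2)
  qed
  show ?thesis
  proof (rule determinant_free_nakayama[OF B G(1,3)])
    fix g assume "g \<in> G"
    then have "g \<in> iprod A B" using G(2) sub by blast
    from comb[OF this] obtain b where "\<forall>g\<in>G. b g \<in> B" "1 * g = (\<Sum>g\<in>G. b g * g)" by (auto simp only: mult_1_left)
    moreover have "1 - 1 \<in> B" using is_idealD(2)[OF B] by simp
    ultimately show "\<exists>c b. 1 - c \<in> B \<and> (\<forall>g'\<in>G. b g' \<in> B) \<and> c * g = (\<Sum>g'\<in>G. b g' * g')"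
      by blast
  qed
qed

section \<open>Finiteness of ideal classes and principal powers\<close>

lemma norm_Nm_nat: "x \<in> Ok \<Longrightarrow> \<exists>n::nat. norm (Nm x) = real n"
proof -
  assume "x \<in> Ok"
  then obtain k :: int where "Nm x = of_int k" using Nm_int by (auto elim: Ints_cases)
  then have "norm (Nm x) = real (nat \<bar>k\<bar>)" by simp
  then show ?thesis by blast
qed

text \<open>Let \<open>\<beta>\<close> be nonzero of minimal norm in \<open>A\<close>. With
  \<open>t\<close> and \<open>w\<close> obtained from \<open>hurwitz\<close> for
  \<open>a / \<beta>\<close>, the element \<open>t * a - w * \<beta>\<close> of \<open>A\<close> has
  smaller norm and vanishes. The factorial of \<open>M\<close> is a common multiple of all possible
  \<open>t\<close>.\<close>

lemma ideal_class_bound: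
  "\<exists>m::int. m > 0 \<and> (\<forall>A. is_ideal A \<longrightarrow> A \<noteq> {0} \<longrightarrow>
     (\<exists>\<beta>\<in>A. \<beta> \<noteq> 0 \<and> (\<forall>a\<in>A. \<exists>w\<in>Ok. of_int m * a = w * \<beta>)))"
proof -
  obtain M where M: "M > 0" "\<forall>x\<in>K. \<exists>t\<in>{1..M::nat}. \<exists>w\<in>Ok. norm (Nm (of_nat t * x - w)) < 1"
    using hurwitz by blast
  have "\<exists>\<beta>\<in>A. \<beta> \<noteq> 0 \<and> (\<forall>a\<in>A. \<exists>w\<in>Ok. of_int (fact M) * a = w * \<beta>)"
    if A: "is_ideal A" "A \<noteq> {0}" for A
  proof -
    define Q where "Q = (\<lambda>x. x \<in> A \<and> x \<noteq> 0)"
    obtain x0 where "Q x0" using A is_idealD(2) unfolding Q_def by blast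
    from ex_has_least_nat[of Q x0 "\<lambda>x. nat \<lfloor>norm (Nm x)\<rfloor>", OF this]
    obtain \<beta> where \<beta>: "Q \<beta>" and min: "\<And>y. Q y \<Longrightarrow> nat \<lfloor>norm (Nm \<beta>)\<rfloor> \<le> nat \<lfloor>norm (Nm y)\<rfloor>" by metis
    have \<beta>A: "\<beta> \<in> A" "\<beta> \<noteq> 0" using \<beta> by (auto simp: Q_def)
    have \<beta>O: "\<beta> \<in> Ok" by (rule is_idealD(1)[OF A(1) \<beta>A(1)])
    have \<beta>K: "\<beta> \<in> K" by (rule Ok_subset[OF \<beta>O])
    have min': "norm (Nm \<beta>) \<le> norm (Nm y)" if y: "y \<in> A" "y \<noteq> 0" for y
    proof -
      obtain k where k: "norm (Nm \<beta>) = real k" using norm_Nm_nat[OF \<beta>O] by blast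
      obtain l where l: "norm (Nm y) = real l" using norm_Nm_nat[OF is_idealD(1)[OF A(1) y(1)]] by blast
      have "k \<le> l" using min[of y] y unfolding Q_def k l by simp
      then show ?thesis unfolding k l by simp
    qed
    have "\<exists>w\<in>Ok. of_int (fact M) * a = w * \<beta>" if a: "a \<in> A" for a
    proof -
      have aO: "a \<in> Ok" by (rule is_idealD(1)[OF A(1) a])
      have aK: "a \<in> K" by (rule Ok_subset[OF aO])
      have "a / \<beta> \<in> K" by (rule K_closed(8)[OF aK \<beta>K])
      then obtain t w where t: "t \<in> {1..M}" and w: "w \<in> Ok"
        and lt: "norm (Nm (of_nat t * (a / \<beta>) - w)) < 1"
        using M(2) by blast
      define y where "y = of_nat t * a - w * \<beta>"
      have yA: "y \<in> A" unfolding y_def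
        by (rule is_idealD(7)[OF A(1) is_idealD(4)[OF A(1) a Ok_closed(9)] is_idealD(4)[OF A(1) \<beta>A(1) w]])
      have y: "y = (of_nat t * (a / \<beta>) - w) * \<beta>" using \<beta>A(2) by (simp add: y_def field_simps)
      have "Nm y = Nm (of_nat t * (a / \<beta>) - w) * Nm \<beta>" unfolding y
        by (rule Nm_mult) (intro K_closed aK \<beta>K Ok_subset[OF w])+
      then have e: "norm (Nm y) = norm (Nm (of_nat t * (a / \<beta>) - w)) * norm (Nm \<beta>)" by (simp only: norm_mult)
      have pos: "norm (Nm \<beta>) > 0" using norm_Nm_ge_1[OF \<beta>O \<beta>A(2)] by linarith
      have "norm (Nm y) < norm (Nm \<beta>)" unfolding e using mult_strict_right_mono[OF lt pos] by (simp only: mult_1_left)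
      then have "y = 0" using min'[OF yA] by force
      then have ta: "of_nat t * a = w * \<beta>" by (simp add: y_def)
      have "t dvd fact M" using t by (intro dvd_fact) auto
      then obtain s where s: "fact M = t * s" by (auto elim: dvdE)
      have "(of_int (fact M) :: 'a) = of_nat (fact M)" by (simp only: of_int_fact of_nat_fact)
      then have "of_int (fact M) * a = of_nat s * (of_nat t * a)" unfolding s by (simp only: of_nat_mult mult_ac)
      also have "\<dots> = (of_nat s * w) * \<beta>" unfolding ta by (simp only: mult_ac)
      finally show ?thesis using Ok_closed(4)[OF Ok_closed(9) w] by blast
    qed
    then show ?thesis using \<beta>A by blast
  qed
  moreover have "(fact M :: int) > 0" by simp
  ultimately show ?thesis by blast
qed

lemma ipow_nonzero: "is_ideal P \<Longrightarrow> P \<noteq> {0} \<Longrightarrow> ipow P n \<noteq> {0}"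
proof -
  assume P: "is_ideal P" "P \<noteq> {0}"
  then obtain p where p: "p \<in> P" "p \<noteq> 0" using is_idealD(2) by blast
  then have "p ^ n \<in> ipow P n" "p ^ n \<noteq> 0" using power_in_ipow[OF P(1)] by auto
  then show ?thesis by blast
qed

text \<open>Only finitely many ideals contain \<open>m\<close>, so two powers of \<open>P\<close>
  lie in the same class, say \<open>P ^ j = w P ^ i\<close> with \<open>i < j\<close>. Cancelling
  \<open>P ^ i\<close> shows that \<open>P ^ (j - i)\<close> is generated by
  \<open>w\<close>.\<close>

lemma ideal_power_principal:
  assumes P: "is_ideal P" "P \<noteq> {0}"
  shows "\<exists>h>0. \<exists>\<pi>\<in>Ok. \<pi> \<noteq> 0 \<and> ipow P h = (\<lambda>x. \<pi> * x) ` Ok"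
proof -
  define A where "A = (\<lambda>n. ipow P n)"
  have A: "is_ideal (A n)" "A n \<noteq> {0}" for n
    unfolding A_def by (rule is_ideal_ipow[OF P(1)], rule ipow_nonzero[OF P])
  obtain m :: int where m: "m > 0" "\<And>B. is_ideal B \<Longrightarrow> B \<noteq> {0} \<Longrightarrow>
      \<exists>\<beta>\<in>B. \<beta> \<noteq> 0 \<and> (\<forall>a\<in>B. \<exists>w\<in>Ok. of_int m * a = w * \<beta>)"
    using ideal_class_bound by blast
  have m0: "(of_int m :: 'a) \<noteq> 0" using m(1) by simp
  have "\<forall>n. \<exists>\<beta>. \<beta> \<in> A n \<and> \<beta> \<noteq> 0 \<and> (\<forall>a\<in>A n. \<exists>w\<in>Ok. of_int m * a = w * \<beta>)"
    using m(2)[OF A] by blast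
  then obtain \<beta> where \<beta>: "\<And>n. \<beta> n \<in> A n" "\<And>n. \<beta> n \<noteq> 0"
      "\<And>n a. a \<in> A n \<Longrightarrow> \<exists>w\<in>Ok. of_int m * a = w * \<beta> n"
    by (auto dest!: choice)
  have \<beta>K: "\<beta> n \<in> K" for n by (rule Ok_subset[OF is_idealD(1)[OF A(1) \<beta>(1)]])
  \<comment> \<open>\<open>B n\<close> is the integral ideal \<open>(m / \<beta> n) A n\<close>, a
    representative of the class of \<open>P ^ n\<close>; it contains \<open>m\<close> because
    \<open>\<beta> n\<close> lies in \<open>A n\<close>.\<close>
  define B where "B = (\<lambda>n. {w \<in> Ok. \<exists>a\<in>A n. of_int m * a = w * \<beta> n})"
  have B: "is_ideal (B n)" "of_int m \<in> B n" for n
  proof -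
    show "of_int m \<in> B n" unfolding B_def using \<beta>(1) Ok_closed(8) by blast
    show "is_ideal (B n)" unfolding is_ideal_def
    proof (intro conjI ballI)
      show "B n \<subseteq> Ok" by (auto simp: B_def)
      show "0 \<in> B n" unfolding B_def using is_idealD(2)[OF A(1)] Ok_closed(1) by force
      fix x assume "x \<in> B n"
      then obtain a where x: "x \<in> Ok" "a \<in> A n" "of_int m * a = x * \<beta> n" by (auto simp: B_def)
      {
        fix y assume "y \<in> B n"
        then obtain b where y: "y \<in> Ok" "b \<in> A n" "of_int m * b = y * \<beta> n" by (auto simp: B_def)
        have "of_int m * (a + b) = (x + y) * \<beta> n" by (simp only: distrib_left distrib_right x(3) y(3))
        then show "x + y \<in> B n" unfolding B_def using Ok_closed(3)[OF x(1) y(1)] is_idealD(3)[OF A(1) x(2) y(2)] by blast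
      }
      fix r assume r: "r \<in> Ok"
      have "of_int m * (r * a) = (r * x) * \<beta> n" using x(3) by (metis mult.assoc mult.left_commute)
      then show "r * x \<in> B n" unfolding B_def using Ok_closed(4)[OF r x(1)] is_idealD(4)[OF A(1) x(2) r] by blast
    qed
  qed
  have "finite (range B)"
    by (rule finite_subset[OF _ finite_ideals_containing[OF m(1)]]) (use B in auto)
  then have "\<not> inj B" using finite_imageD[of B UNIV] by auto
  then obtain i j where ij: "i < j" "B i = B j" by (metis injI linorder_neqE_nat)
  have transfer: "a * (\<beta> l / \<beta> k) \<in> A l" if hk: "a \<in> A k" and Bkl: "B k = B l" for a k l
  proof -
    obtain w where w: "w \<in> Ok" "of_int m * a = w * \<beta> k" using \<beta>(3)[OF hk] by blast
    have "w \<in> B k" unfolding B_def by (intro CollectI conjI bexI[of _ a] hk w)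
    then have "w \<in> B l" by (simp only: Bkl)
    then obtain a' where a': "a' \<in> A l" "of_int m * a' = w * \<beta> l" by (auto simp: B_def)
    have "of_int m * (a * (\<beta> l / \<beta> k)) = (w * \<beta> k) * (\<beta> l / \<beta> k)" unfolding w(2)[symmetric] by (simp only: mult.assoc)
    also have "\<dots> = of_int m * a'" unfolding a'(2) using \<beta>(2)[of k] by simp
    finally have "a * (\<beta> l / \<beta> k) = a'" using mult_left_cancel[OF m0] by blast
    then show ?thesis using a'(1) by simp
  qed
  define w where "w = \<beta> j / \<beta> i"
  define h where "h = j - i"
  have w0: "w \<noteq> 0" using \<beta>(2) by (simp add: w_def)
  have wK: "w \<in> K" unfolding w_def by (rule K_closed(8)[OF \<beta>K \<beta>K])
  have t1: "a * w \<in> A j" if "a \<in> A i" for a unfolding w_def by (rule transfer[OF that ij(2)])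
  have t2: "b / w \<in> A i" if "b \<in> A j" for b
  proof -
    have "b / w = b * (\<beta> i / \<beta> j)" using \<beta>(2) by (simp add: w_def)
    then show ?thesis using transfer[OF that ij(2)[symmetric]] by simp
  qed
  have Aj: "A j = iprod (A i) (A h)" unfolding A_def h_def using ipow_add[OF P(1), of i "j - i"] ij(1) by simp
  have sub: "A j \<subseteq> A i" unfolding A_def using ipow_mono[OF P(1)] ij(1) by simp
  have wO: "w \<in> Ok"
  proof (rule multiplier_integral[OF A wK])
    fix a assume "a \<in> A i"
    then show "w * a \<in> A i" using t1[of a] sub by (auto simp: mult.commute)
  qed
  have cO: "c / w \<in> Ok" if c: "c \<in> A h" for c
  proof (rule multiplier_integral[OF A(1,2)[of i]])
    show "c / w \<in> K" by (rule K_closed(8)[OF Ok_subset[OF is_idealD(1)[OF A(1) c]] wK])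
    fix a assume "a \<in> A i"
    then have "a * c \<in> A j" unfolding Aj using c by (rule iprod_mem)
    then have "(a * c) / w \<in> A i" by (rule t2)
    then show "c / w * a \<in> A i" by (simp add: mult.commute)
  qed
  \<comment> \<open>From \<open>w * A i \<subseteq> A j = A i * A h\<close> follows
    \<open>A i \<subseteq> A i * C\<close>, and cancellation puts 1 into \<open>C\<close>, that is,
    \<open>w\<close> into \<open>A h\<close>.\<close>
  define C where "C = (\<lambda>c. c / w) ` A h"
  have C: "is_ideal C" unfolding is_ideal_def
  proof (intro conjI ballI)
    show "C \<subseteq> Ok" using cO by (auto simp: C_def)
    show "0 \<in> C" unfolding C_def using is_idealD(2)[OF A(1)] by force
    fix x assume "x \<in> C"
    then obtain a where a: "x = a / w" "a \<in> A h" unfolding C_def by (rule imageE)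
    {
      fix y assume "y \<in> C"
      then obtain b where b: "y = b / w" "b \<in> A h" unfolding C_def by (rule imageE)
      have "x + y = (a + b) / w" by (simp only: a(1) b(1) add_divide_distrib)
      then show "x + y \<in> C" unfolding C_def by (rule image_eqI[OF _ is_idealD(3)[OF A(1) a(2) b(2)]])
    }
    fix r assume "r \<in> Ok"
    then have ra: "r * a \<in> A h" by (rule is_idealD(4)[OF A(1) a(2)])
    have "r * x = (r * a) / w" by (simp only: a(1) times_divide_eq_right)
    then show "r * x \<in> C" unfolding C_def by (rule image_eqI[OF _ ra])
  qed
  have step: "x / w \<in> iprod (A i) C" if "x \<in> iprod (A i) (A h)" for x
    using that
  proof (induction rule: iprod_induct)
    case (prod a b)
    then have "a * (b / w) \<in> iprod (A i) C" by (intro iprod_mem) (auto simp: C_def)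
    then show ?case by simp
  next
    case (sum x y)
    then have "x / w + y / w \<in> iprod (A i) C" by (rule iprod_add)
    then show ?case by (simp only: add_divide_distrib)
  qed
  have "1 \<in> C"
  proof (rule iprod_eq_self_imp_one[OF A C])
    show "A i \<subseteq> iprod (A i) C"
    proof
      fix a assume "a \<in> A i"
      then have "(a * w) / w \<in> iprod (A i) C" using t1 step Aj by blast
      then show "a \<in> iprod (A i) C" using w0 by simp
    qed
  qed
  then obtain c where c: "1 = c / w" "c \<in> A h" unfolding C_def by (rule imageE)
  then have "c = w" using w0 by (simp add: field_simps)
  then have wA: "w \<in> A h" using c(2) by simp
  have "A h = (\<lambda>x. w * x) ` Ok"
  proof
    show "A h \<subseteq> (\<lambda>x. w * x) ` Ok"
    proof
      fix c assume "c \<in> A h"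
      then show "c \<in> (\<lambda>x. w * x) ` Ok" using cO w0 by (intro image_eqI[of _ _ "c / w"]) auto
    qed
    show "(\<lambda>x. w * x) ` Ok \<subseteq> A h" using is_idealD(5)[OF A(1) wA] by auto
  qed
  moreover have "h > 0" using ij(1) by (simp add: h_def)
  ultimately show ?thesis using wO w0 unfolding A_def by blast
qed

section \<open>Prime ideals\<close>

lemma finite_primesD:
  assumes "P \<in> finite_primes K"
  shows "is_ideal P" "P \<noteq> {0}" "1 \<notin> P" "a \<in> Ok \<Longrightarrow> b \<in> Ok \<Longrightarrow> a * b \<in> P \<Longrightarrow> a \<in> P \<or> b \<in> P"
proof -
  have p: "primeideal P OR" "P \<noteq> {0}" using assms by (auto simp: finite_primes_def Ok_def)
  show P: "is_ideal P" using primeideal.axioms(1)[OF p(1)] by (simp add: ideal_iff)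
  show "P \<noteq> {0}" by fact
  show "1 \<notin> P"
  proof
    assume "1 \<in> P"
    then have "Ok \<subseteq> P" using is_idealD(4)[OF P, of 1] by auto
    then have "P = carrier OR" using is_idealD(1)[OF P] by auto
    then show False using primeideal.I_notcarr[OF p(1)] by simp
  qed
  show "a \<in> Ok \<Longrightarrow> b \<in> Ok \<Longrightarrow> a * b \<in> P \<Longrightarrow> a \<in> P \<or> b \<in> P"
    using primeideal.I_prime[OF p(1), of a b] by simp
qed

lemma finite_primesI:
  assumes P: "is_ideal P" "P \<noteq> {0}" "1 \<notin> P"
    and "\<And>a b. a \<in> Ok \<Longrightarrow> b \<in> Ok \<Longrightarrow> a * b \<in> P \<Longrightarrow> a \<in> P \<or> b \<in> P"
  shows "P \<in> finite_primes K"
proof -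
  have "primeideal P OR"
  proof (rule primeidealI)
    show "ideal P OR" using P(1) by (simp add: ideal_iff)
    show "cring OR" by (rule OR_cring)
    show "carrier OR \<noteq> P" using P(3) Ok_closed(2) by auto
  qed (use assms(4) in auto)
  then show ?thesis using P(2) by (auto simp: finite_primes_def Ok_def)
qed

lemma prime_power_mem:
  assumes "P \<in> finite_primes K" "a \<in> Ok" "a ^ n \<in> P"
  shows "a \<in> P"
  using assms(3)
proof (induction n)
  case 0
  then show ?case using finite_primesD(3)[OF assms(1)] by simp
next
  case (Suc n)
  then show ?case using finite_primesD(4)[OF assms(1,2) Ok_closed(7)[OF assms(2)]] by auto
qed

text \<open>For \<open>y\<close> in \<open>Q\<close> but not in \<open>P\<close>, the powers of
  \<open>y\<close> repeat modulo \<open>P\<close>, so \<open>y ^ i * (y ^ (j - i) - 1)\<close> is in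
  \<open>P\<close> and with it the second factor. Then \<open>Q\<close> contains both
  \<open>y ^ (j - i) - 1\<close> and \<open>y ^ (j - i)\<close>, hence 1.\<close>

lemma finite_primes_maximal:
  assumes P: "P \<in> finite_primes K" and Q: "Q \<in> finite_primes K" and sub: "P \<subseteq> Q"
  shows "P = Q"
proof (rule ccontr)
  assume "P \<noteq> Q"
  then obtain y where y: "y \<in> Q" "y \<notin> P" using sub by blast
  note IP = finite_primesD[OF P] and IQ = finite_primesD[OF Q]
  have yO: "y \<in> Ok" by (rule is_idealD(1)[OF IQ(1) y(1)])
  obtain m where m: "m > 0" "of_int m \<in> P" using ideal_contains_positive_integer[OF IP(1,2)] by blast
  obtain R where R: "finite R" "R \<subseteq> Ok" "\<forall>x\<in>Ok. \<exists>z\<in>Ok. x - of_int m * z \<in> R"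
    using finite_residues_Ok[OF m(1)] by blast
  have "\<forall>k. \<exists>z. z \<in> Ok \<and> y ^ k - of_int m * z \<in> R" using R(3) Ok_closed(7)[OF yO] by blast
  then obtain z where z: "\<And>k. z k \<in> Ok" "\<And>k. y ^ k - of_int m * z k \<in> R" by (auto dest!: choice)
  define g where "g = (\<lambda>k::nat. y ^ k - of_int m * z k)"
  have "finite (range g)" by (rule finite_subset[OF _ R(1)]) (auto simp: g_def z(2))
  then have "\<not> inj g" using finite_imageD[of g UNIV] by auto
  then obtain i j where ij: "i < j" "g i = g j" by (metis injI linorder_neqE_nat)
  have "y ^ j - y ^ i = of_int m * (z j - z i)" using ij(2) by (simp add: g_def algebra_simps)
  moreover have "of_int m * (z j - z i) \<in> P" by (rule is_idealD(5)[OF IP(1) m(2) Ok_closed(6)[OF z(1) z(1)]])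
  ultimately have "y ^ j - y ^ i \<in> P" by simp
  moreover have "y ^ j - y ^ i = y ^ i * (y ^ (j - i) - 1)"
    using ij(1) by (simp add: right_diff_distrib power_add[symmetric])
  ultimately have "y ^ i * (y ^ (j - i) - 1) \<in> P" by simp
  then have "y ^ i \<in> P \<or> y ^ (j - i) - 1 \<in> P"
    by (rule finite_primesD(4)[OF P Ok_closed(7)[OF yO] Ok_closed(6)[OF Ok_closed(7)[OF yO] Ok_closed(2)]])
  then have "y ^ (j - i) - 1 \<in> Q" using prime_power_mem[OF P yO] y(2) sub by blast
  moreover have "y ^ (j - i) \<in> Q"
  proof -
    obtain k where "j - i = Suc k" using ij(1) by (metis Suc_diff_Suc)
    then show ?thesis using is_idealD(5)[OF IQ(1) y(1) Ok_closed(7)[OF yO]] by simp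
  qed
  ultimately have "y ^ (j - i) - (y ^ (j - i) - 1) \<in> Q" using is_idealD(7)[OF IQ(1)] by blast
  then show False using IQ(3) by simp
qed

text \<open>The product of generators of principal powers of the primes in \<open>T\<close>. A prime
  containing the generator \<open>\<pi>\<close> of \<open>P ^ h\<close> contains \<open>P\<close>,
  so it equals \<open>P\<close> by maximality.\<close>

lemma exists_element_with_primes:
  assumes "finite T" "T \<subseteq> finite_primes K"
  shows "\<exists>\<delta>\<in>Ok. \<delta> \<noteq> 0 \<and> (\<forall>Q\<in>finite_primes K. \<delta> \<in> Q \<longleftrightarrow> Q \<in> T)"
  using assms
proof (induction T)
  case empty
  show ?case using finite_primesD(3) by (intro bexI[of _ 1]) (auto intro: Ok_closed)
next
  case (insert P T)
  then obtain \<delta> where \<delta>: "\<delta> \<in> Ok" "\<delta> \<noteq> 0" "\<And>Q. Q \<in> finite_primes K \<Longrightarrow> \<delta> \<in> Q \<longleftrightarrow> Q \<in> T" by auto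
  have P: "P \<in> finite_primes K" using insert.prems by simp
  note IP = finite_primesD[OF P]
  obtain h \<pi> where h: "h > 0" "\<pi> \<in> Ok" "\<pi> \<noteq> 0" "ipow P h = (\<lambda>x. \<pi> * x) ` Ok"
    using ideal_power_principal[OF IP(1,2)] by blast
  have \<pi>P: "\<pi> \<in> ipow P h" unfolding h(4) using Ok_closed(2) by (intro image_eqI[of _ _ 1]) auto
  have "\<pi> \<in> Q \<longleftrightarrow> Q = P" if Q: "Q \<in> finite_primes K" for Q
  proof
    assume "Q = P"
    have "ipow P h \<subseteq> ipow P 1" using h(1) by (intro ipow_mono[OF IP(1)]) simp
    then show "\<pi> \<in> Q" using \<pi>P ipow_1[OF IP(1)] \<open>Q = P\<close> by auto
  next
    assume "\<pi> \<in> Q"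
    have "P \<subseteq> Q"
    proof
      fix p assume p: "p \<in> P"
      have pO: "p \<in> Ok" by (rule is_idealD(1)[OF IP(1) p])
      have "p ^ h \<in> ipow P h" by (rule power_in_ipow[OF IP(1) p])
      then obtain x where "x \<in> Ok" "p ^ h = \<pi> * x" unfolding h(4) by blast
      then have "p ^ h \<in> Q" using is_idealD(5)[OF finite_primesD(1)[OF Q] \<open>\<pi> \<in> Q\<close>] by simp
      then show "p \<in> Q" by (rule prime_power_mem[OF Q pO])
    qed
    then show "Q = P" using finite_primes_maximal[OF P Q] by simp
  qed
  moreover have "\<pi> * \<delta> \<in> Q \<longleftrightarrow> \<pi> \<in> Q \<or> \<delta> \<in> Q" if Q: "Q \<in> finite_primes K" for Q
    using finite_primesD(4)[OF Q h(2) \<delta>(1)] is_idealD(4)[OF finite_primesD(1)[OF Q] _ h(2)]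
      is_idealD(5)[OF finite_primesD(1)[OF Q] _ \<delta>(1)] by blast
  ultimately show ?case using \<delta> h(2,3)
    by (intro bexI[of _ "\<pi> * \<delta>"]) (auto intro: Ok_closed)
qed

subsection \<open>Valuations and S-integers\<close>

lemma iprod_principal_left:
  assumes "x \<in> iprod ((\<lambda>y. a * y) ` Ok) B" "is_ideal B"
  shows "\<exists>b\<in>B. x = a * b"
  using assms(1)
proof (induction rule: iprod_induct)
  case (prod u b)
  then obtain y where y: "u = a * y" "y \<in> Ok" by blast
  have "u * b = a * (y * b)" by (simp only: y(1) mult.assoc)
  then show ?case using is_idealD(4)[OF assms(2) prod(2) y(2)] by blast
next
  case (sum u v)
  then obtain b c where "b \<in> B" "u = a * b" "c \<in> B" "v = a * c" by blast
  moreover from this have "u + v = a * (b + c)" by (simp only: distrib_left)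
  ultimately show ?case using is_idealD(3)[OF assms(2)] by blast
qed

lemma ipow_principal:
  assumes P: "is_ideal P" and h: "ipow P h = (\<lambda>x. \<pi> * x) ` Ok" and \<pi>: "\<pi> \<in> Ok"
  shows "ipow P (h * k) = (\<lambda>x. \<pi> ^ k * x) ` Ok"
proof (induction k)
  case 0
  then show ?case by (simp add: ideals_set_def)
next
  case (Suc k)
  have eq: "ipow P (h * Suc k) = iprod (ipow P (h * k)) (ipow P h)"
    using ipow_add[OF P, of "h * k" h] by (simp add: add.commute)
  show ?case
  proof
    show "ipow P (h * Suc k) \<subseteq> (\<lambda>x. \<pi> ^ Suc k * x) ` Ok"
    proof
      fix x assume "x \<in> ipow P (h * Suc k)"
      then have "x \<in> iprod ((\<lambda>x. \<pi> ^ k * x) ` Ok) (ipow P h)" unfolding eq Suc.IH .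
      then obtain b where b: "b \<in> ipow P h" "x = \<pi> ^ k * b"
        using iprod_principal_left[OF _ is_ideal_ipow[OF P]] by blast
      then obtain y where "y \<in> Ok" "b = \<pi> * y" unfolding h by blast
      then show "x \<in> (\<lambda>x. \<pi> ^ Suc k * x) ` Ok" using b(2)
        by (intro image_eqI[of _ _ y]) (simp_all add: mult_ac)
    qed
    show "(\<lambda>x. \<pi> ^ Suc k * x) ` Ok \<subseteq> ipow P (h * Suc k)"
    proof
      fix x assume "x \<in> (\<lambda>x. \<pi> ^ Suc k * x) ` Ok"
      then obtain y where y: "y \<in> Ok" "x = \<pi> ^ Suc k * y" by blast
      have "\<pi> ^ k * 1 \<in> ipow P (h * k)" unfolding Suc.IH using Ok_closed(2) by blast
      moreover have "\<pi> * y \<in> ipow P h" unfolding h using y(1) by blast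
      ultimately have "(\<pi> ^ k * 1) * (\<pi> * y) \<in> ipow P (h * Suc k)" unfolding eq by (rule iprod_mem)
      then show "x \<in> ipow P (h * Suc k)" using y(2) by (simp add: mult_ac)
    qed
  qed
qed

lemma ipow_product_mem:
  assumes "is_ideal P" "a \<in> ipow P m" "b \<in> ipow P n"
  shows "a * b \<in> ipow P (m + n)"
  unfolding ipow_add[OF assms(1)] using assms(2,3) by (rule iprod_mem)

end

text \<open>\<open>h\<close> and \<open>\<pi>\<close> are carried along because they make
  \<open>P\<close> invertible: its inverse is \<open>P ^ (h - 1) / \<pi>\<close>.\<close>

locale prime_of_number_field = primitive_number_field +
  fixes P :: "'a set" and h :: nat and \<pi> :: 'a
  assumes P: "P \<in> finite_primes K" and h: "h > 0" "ipow P h = (\<lambda>x. \<pi> * x) ` Ok"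
    and \<pi>: "\<pi> \<in> Ok" "\<pi> \<noteq> 0"
begin

lemmas IP = finite_primesD[OF P]

lemma ipow_h: "ipow P (h * k) = (\<lambda>x. \<pi> ^ k * x) ` Ok"
  by (rule ipow_principal[OF IP(1) h(2) \<pi>(1)])

text \<open>Otherwise \<open>a\<close> is divisible by all powers of \<open>\<pi>\<close>, so that
  \<open>inverse \<pi>\<close> is almost integral and hence integral, and \<open>P ^ h\<close> is
  the unit ideal. This is what makes the \<open>GREATEST\<close> in \<open>ideal_order\<close>
  meaningful.\<close>

lemma not_in_all_powers:
  assumes "a \<in> Ok" "a \<noteq> 0"
  shows "\<exists>n. a \<notin> ipow P n"
proof (rule ccontr)
  assume "\<not> ?thesis"
  then have *: "a \<in> ipow P n" for n by blast
  have "inverse \<pi> \<in> Ok"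
  proof (rule almost_integral_imp_integral[OF K_closed(6)[OF Ok_subset[OF \<pi>(1)]] assms])
    fix k
    obtain y where y: "y \<in> Ok" "a = \<pi> ^ k * y" using *[of "h * k"] unfolding ipow_h by blast
    have "inverse \<pi> ^ k * a = y" unfolding y(2) using \<pi>(2) by (simp add: power_inverse)
    then show "inverse \<pi> ^ k * a \<in> Ok" using y(1) by simp
  qed
  then have "\<pi> * inverse \<pi> \<in> ipow P h" unfolding h(2) by blast
  then have "1 \<in> ipow P h" using \<pi>(2) by simp
  moreover have "ipow P h \<subseteq> ipow P 1" using h(1) by (intro ipow_mono[OF IP(1)]) simp
  ultimately show False using IP(3) ipow_1[OF IP(1)] by auto
qed

abbreviation od :: "'a \<Rightarrow> nat" where "od \<equiv> ideal_order K P"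

lemma mem_ipow_iff:
  assumes a: "a \<in> Ok" "a \<noteq> 0"
  shows "a \<in> ipow P n \<longleftrightarrow> n \<le> od a"
proof -
  obtain N where N: "a \<notin> ipow P N" using not_in_all_powers[OF a] by blast
  have bound: "n \<le> N" if "a \<in> ipow P n" for n
    using that N ipow_mono[OF IP(1), of N n] by (meson le_cases subsetD)
  have od: "od a = (GREATEST n. a \<in> ipow P n)" by (simp add: ideal_order_def Ok_def)
  have z: "a \<in> ipow P 0" using a(1) by (simp only: ipow_0)
  have mem: "a \<in> ipow P (od a)" unfolding od by (rule GreatestI_nat[where P = "\<lambda>n. a \<in> ipow P n", OF z bound])
  show ?thesis
  proof
    assume "a \<in> ipow P n"
    then show "n \<le> od a" unfolding od by (rule Greatest_le_nat[where P = "\<lambda>n. a \<in> ipow P n", OF _ bound])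
  next
    assume "n \<le> od a"
    then show "a \<in> ipow P n" using mem ipow_mono[OF IP(1)] by blast
  qed
qed

text \<open>\<open>P ^ ((h - 1) m) / \<pi> ^ m\<close> is the inverse of the fractional ideal \<open>P ^ m\<close>.\<close>

lemma exists_complement:
  assumes a: "a \<in> Ok" "a \<noteq> 0"
  shows "\<exists>c\<in>ipow P ((h - 1) * od a). \<exists>u\<in>Ok. u \<notin> P \<and> a * c = \<pi> ^ od a * u"
proof (rule ccontr)
  assume no: "\<not> ?thesis"
  define m where "m = od a"
  have am: "a \<in> ipow P m" unfolding m_def using mem_ipow_iff[OF a] by simp
  have hm: "(h - 1) * m + m = h * m" using h(1) by (cases h) simp_all
  have cu: "\<exists>u\<in>P. a * c = \<pi> ^ m * u" if c: "c \<in> ipow P ((h - 1) * m)" for c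
  proof -
    have "c * a \<in> ipow P (h * m)" using ipow_product_mem[OF IP(1) c am] by (simp only: hm)
    then obtain u where u: "c * a = \<pi> ^ m * u" "u \<in> Ok" unfolding ipow_h by (rule imageE)
    then have "a * c = \<pi> ^ m * u" by (simp only: mult.commute)
    then show ?thesis using no u(2) c unfolding m_def[symmetric] by blast
  qed
  \<comment> \<open>If every \<open>u\<close> lies in \<open>P\<close>, multiplication by
    \<open>a\<close> sends \<open>P ^ (h m)\<close> into \<open>\<pi> ^ m P ^ (m + 1)\<close>;
    applied to \<open>\<pi> ^ m\<close> itself this puts \<open>a\<close> into
    \<open>P ^ (m + 1)\<close>, against the choice of \<open>m\<close>.\<close>
  have claim: "\<exists>y\<in>ipow P (Suc m). a * x = \<pi> ^ m * y" if "x \<in> iprod (ipow P ((h - 1) * m)) (ipow P m)" for x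
    using that
  proof (induction rule: iprod_induct)
    case (prod c p)
    obtain u where u: "u \<in> P" "a * c = \<pi> ^ m * u" using cu[OF prod(1)] by blast
    have "p * u \<in> ipow P (Suc m)" unfolding ipow_Suc using prod(2) u(1) by (rule iprod_mem)
    moreover have "a * (c * p) = \<pi> ^ m * (p * u)" using u(2) by (metis mult.assoc mult.commute)
    ultimately show ?case by blast
  next
    case (sum x x')
    then obtain y y' where y: "y \<in> ipow P (Suc m)" "a * x = \<pi> ^ m * y"
      "y' \<in> ipow P (Suc m)" "a * x' = \<pi> ^ m * y'" by blast
    have "a * (x + x') = \<pi> ^ m * (y + y')" by (simp only: distrib_left y(2,4))
    then show ?case using is_idealD(3)[OF is_ideal_ipow[OF IP(1)] y(1,3)] by blast
  qed
  have "\<pi> ^ m * 1 \<in> ipow P (h * m)" unfolding ipow_h using Ok_closed(2) by blast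
  then have "\<pi> ^ m \<in> iprod (ipow P ((h - 1) * m)) (ipow P m)"
    using ipow_add[OF IP(1), of "(h - 1) * m" m] by (simp only: hm mult_1_right)
  then obtain y where y: "y \<in> ipow P (Suc m)" "a * \<pi> ^ m = \<pi> ^ m * y" using claim by blast
  then have "a = y" using \<pi>(2) by (simp add: mult.commute)
  then have "a \<in> ipow P (Suc m)" using y(1) by simp
  then show False using mem_ipow_iff[OF a, of "Suc m"] by (simp add: m_def)
qed

text \<open>If \<open>a * b\<close> were in the power after \<open>m + n\<close>, multiplying by
  complements of \<open>a\<close> and \<open>b\<close> would put
  \<open>\<pi> ^ (m + n) * (u * u')\<close> into \<open>\<pi> ^ (m + n) P\<close>, so
  \<open>u * u' \<in> P\<close> with both factors outside the prime \<open>P\<close>.\<close>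

lemma od_mult:
  assumes a: "a \<in> Ok" "a \<noteq> 0" and b: "b \<in> Ok" "b \<noteq> 0"
  shows "od (a * b) = od a + od b"
proof -
  define m where "m = od a"
  define n where "n = od b"
  have ab: "a * b \<in> Ok" "a * b \<noteq> 0" using a b by (auto intro: Ok_closed)
  have "a \<in> ipow P m" "b \<in> ipow P n" using mem_ipow_iff a b by (auto simp: m_def n_def)
  then have "a * b \<in> ipow P (m + n)" by (rule ipow_product_mem[OF IP(1)])
  then have ge: "m + n \<le> od (a * b)" using mem_ipow_iff[OF ab] by simp
  have "\<not> Suc (m + n) \<le> od (a * b)"
  proof
    assume "Suc (m + n) \<le> od (a * b)"
    then have 1: "a * b \<in> ipow P (Suc (m + n))" by (rule mem_ipow_iff[OF ab, THEN iffD2])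
    obtain c u where c: "c \<in> ipow P ((h - 1) * m)" "u \<in> Ok" "u \<notin> P" "a * c = \<pi> ^ m * u"
      using exists_complement[OF a] unfolding m_def by blast
    obtain c' u' where c': "c' \<in> ipow P ((h - 1) * n)" "u' \<in> Ok" "u' \<notin> P" "b * c' = \<pi> ^ n * u'"
      using exists_complement[OF b] unfolding n_def by blast
    have "(a * b) * (c * c') \<in> ipow P (Suc (m + n) + ((h - 1) * m + (h - 1) * n))"
      by (rule ipow_product_mem[OF IP(1) 1 ipow_product_mem[OF IP(1) c(1) c'(1)]])
    also have "Suc (m + n) + ((h - 1) * m + (h - 1) * n) = Suc (h * (m + n))"
      using h(1) by (cases h) (simp_all add: algebra_simps)
    finally have "(a * b) * (c * c') \<in> iprod ((\<lambda>x. \<pi> ^ (m + n) * x) ` Ok) P"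
      by (simp only: ipow_Suc ipow_h)
    then obtain y where y: "y \<in> P" "(a * b) * (c * c') = \<pi> ^ (m + n) * y"
      using iprod_principal_left[OF _ IP(1)] by blast
    have "(a * b) * (c * c') = (a * c) * (b * c')" by (simp only: mult_ac)
    also have "\<dots> = \<pi> ^ (m + n) * (u * u')" unfolding c(4) c'(4) by (simp only: power_add mult_ac)
    finally have "(a * b) * (c * c') = \<pi> ^ (m + n) * (u * u')" .
    then have "\<pi> ^ (m + n) * (u * u') = \<pi> ^ (m + n) * y" by (rule trans[OF sym y(2)])
    then have "u * u' = y" using \<pi>(2) by simp
    then have "u * u' \<in> P" using y(1) by simp
    then show False using IP(4)[OF c(2) c'(2)] c(3) c'(3) by blast
  qed
  then show ?thesis using ge unfolding m_def n_def by linarith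
qed

text \<open>Cross-multiplying two fractions for the same element and applying \<open>od_mult\<close>
  shows that the \<open>THE\<close> in the definition has a unique witness.\<close>

lemma prime_valuation_quotient:
  assumes a: "a \<in> Ok" "a \<noteq> 0" and b: "b \<in> Ok" "b \<noteq> 0"
  shows "prime_valuation K P (a / b) = int (od a) - int (od b)"
  unfolding prime_valuation_def Ok_def[symmetric]
proof (rule the_equality)
  show "\<exists>a'\<in>Ok - {0}. \<exists>b'\<in>Ok - {0}. a / b = a' / b' \<and> int (od a) - int (od b) = int (od a') - int (od b')"
    using a b by (intro bexI[of _ a] bexI[of _ b]) auto
  fix v assume "\<exists>a'\<in>Ok - {0}. \<exists>b'\<in>Ok - {0}. a / b = a' / b' \<and> v = int (od a') - int (od b')"
  then obtain a' b' where a': "a' \<in> Ok" "a' \<noteq> 0" and b': "b' \<in> Ok" "b' \<noteq> 0"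
    and eq: "a / b = a' / b'" and v: "v = int (od a') - int (od b')" by auto
  have "a * b' = a' * b" using eq b b' by (simp add: field_simps)
  then have "od a + od b' = od a' + od b" using od_mult[OF a b'] od_mult[OF a' b] by simp
  then show "v = int (od a) - int (od b)" unfolding v by linarith
qed

end

section \<open>The ring of S-integers as a localization\<close>

context primitive_number_field
begin

lemma prime_localeI:
  assumes "P \<in> finite_primes K"
  shows "\<exists>h \<pi>. prime_of_number_field K \<theta> f P h \<pi>"
proof -
  obtain h \<pi> where "h > 0" "\<pi> \<in> Ok" "\<pi> \<noteq> 0" "ipow P h = (\<lambda>x. \<pi> * x) ` Ok"
    using ideal_power_principal[OF finite_primesD(1,2)[OF assms]] by blast
  then have "prime_of_number_field K \<theta> f P h \<pi>"
    using assms by unfold_locales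
  then show ?thesis by blast
qed

text \<open>An ideal maximal among those that contain \<open>I\<close> and miss every power of
  \<open>\<delta>\<close> is prime. A maximal one exists because only finitely many ideals contain
  \<open>m\<close>.\<close>

lemma exists_prime_avoiding_powers:
  assumes I: "is_ideal I" "of_int m \<in> I" "m > 0" and \<delta>: "\<delta> \<in> Ok" and no: "\<And>k. \<delta> ^ k \<notin> I"
  shows "\<exists>P\<in>finite_primes K. I \<subseteq> P \<and> \<delta> \<notin> P"
proof -
  define F where "F = {A. is_ideal A \<and> of_int m \<in> A} \<inter> {A. \<forall>k. \<delta> ^ k \<notin> A}"
  have "finite F" unfolding F_def using finite_ideals_containing[OF I(3)] by blast
  moreover have "I \<in> F" using I no by (simp add: F_def)
  ultimately obtain P where P: "P \<in> F" "I \<subseteq> P" and max: "\<And>A. A \<in> F \<Longrightarrow> P \<subseteq> A \<Longrightarrow> P = A"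
    using finite_has_maximal2 by metis
  have PI: "is_ideal P" "of_int m \<in> P" and Pno: "\<And>k. \<delta> ^ k \<notin> P" using P(1) by (auto simp: F_def)
  \<comment> \<open>By maximality \<open>P + a Ok\<close> must contain a power of
    \<open>\<delta>\<close>; multiplying two such expressions yields primality below.\<close>
  have enlarge: "\<exists>k. \<exists>p\<in>P. \<exists>r\<in>Ok. \<delta> ^ k = p + a * r" if a: "a \<in> Ok" "a \<notin> P" for a
  proof (rule ccontr)
    assume none: "\<not> ?thesis"
    define A where "A = {x. \<exists>p\<in>P. \<exists>r\<in>Ok. x = p + a * r}"
    have AI: "p + a * r \<in> A" if "p \<in> P" "r \<in> Ok" for p r using that by (auto simp: A_def)
    have AE: "\<exists>p r. p \<in> P \<and> r \<in> Ok \<and> x = p + a * r" if "x \<in> A" for x using that by (auto simp: A_def)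
    have sub: "P \<subseteq> A"
    proof
      fix p assume "p \<in> P"
      then show "p \<in> A" using AI[of p 0] Ok_closed(1) by simp
    qed
    have "is_ideal A" unfolding is_ideal_def
    proof (intro conjI ballI)
      show "A \<subseteq> Ok"
      proof
        fix x assume "x \<in> A"
        then obtain p r where "p \<in> P" "r \<in> Ok" "x = p + a * r" using AE by blast
        then show "x \<in> Ok" using Ok_closed(3)[OF is_idealD(1)[OF PI(1)] Ok_closed(4)[OF a(1)]] by simp
      qed
      show "0 \<in> A" using sub is_idealD(2)[OF PI(1)] by blast
      fix x assume "x \<in> A"
      then obtain p r where x: "p \<in> P" "r \<in> Ok" "x = p + a * r" using AE by blast
      {
        fix y assume "y \<in> A"
        then obtain q s where y: "q \<in> P" "s \<in> Ok" "y = q + a * s" using AE by blast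
        have "x + y = (p + q) + a * (r + s)" by (simp only: x(3) y(3) distrib_left ac_simps)
        then show "x + y \<in> A" using AI[OF is_idealD(3)[OF PI(1) x(1) y(1)] Ok_closed(3)[OF x(2) y(2)]] by simp
      }
      fix t assume t: "t \<in> Ok"
      have "t * x = t * p + a * (t * r)" by (simp only: x(3) distrib_left mult.left_commute)
      then show "t * x \<in> A" using AI[OF is_idealD(4)[OF PI(1) x(1) t] Ok_closed(4)[OF t x(2)]] by simp
    qed
    moreover have "\<delta> ^ k \<notin> A" for k
    proof
      assume "\<delta> ^ k \<in> A"
      then obtain p r where "p \<in> P" "r \<in> Ok" "\<delta> ^ k = p + a * r" using AE by blast
      then show False using none by blast
    qed
    ultimately have "A \<in> F" using sub PI(2) by (auto simp: F_def)
    then have "P = A" using sub by (rule max)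
    moreover have "0 + a * 1 \<in> A" by (rule AI[OF is_idealD(2)[OF PI(1)] Ok_closed(2)])
    ultimately show False using a(2) by simp
  qed
  have "P \<in> finite_primes K"
  proof (rule finite_primesI[OF PI(1)])
    show "P \<noteq> {0}" using PI(2) I(3) by auto
    show "1 \<notin> P" using Pno[of 0] by simp
    fix a b assume a: "a \<in> Ok" and b: "b \<in> Ok" and ab: "a * b \<in> P"
    show "a \<in> P \<or> b \<in> P"
    proof (rule ccontr)
      assume "\<not> ?thesis"
      then obtain k p r l q s where 1: "p \<in> P" "r \<in> Ok" "\<delta> ^ k = p + a * r" and 2: "q \<in> P" "s \<in> Ok" "\<delta> ^ l = q + b * s"
        using enlarge[OF a] enlarge[OF b] by metis
      have "\<delta> ^ (k + l) = p * (q + b * s) + ((a * r) * q + (a * b) * (r * s))"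
        unfolding power_add 1(3) 2(3) by (simp only: distrib_left distrib_right ac_simps)
      moreover have "p * (q + b * s) \<in> P" unfolding 2(3)[symmetric] by (rule is_idealD(5)[OF PI(1) 1(1) Ok_closed(7)[OF \<delta>]])
      moreover have "(a * r) * q \<in> P" by (rule is_idealD(4)[OF PI(1) 2(1) Ok_closed(4)[OF a 1(2)]])
      moreover have "(a * b) * (r * s) \<in> P" by (rule is_idealD(5)[OF PI(1) ab Ok_closed(4)[OF 1(2) 2(2)]])
      ultimately have "\<delta> ^ (k + l) \<in> P" using is_idealD(3)[OF PI(1)] by metis
      then show False using Pno by blast
    qed
  qed
  moreover have "\<delta> \<notin> P" using Pno[of 1] by simp
  ultimately show ?thesis using P(2) by blast
qed

lemma K_quotient:
  assumes "x \<in> K"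
  obtains a m where "a \<in> Ok" "m > 0" "x = a / of_int m"
proof -
  obtain D where D: "D > 0" "of_int D * x \<in> Ok" using in_K_rational_multiple[OF assms] by blast
  then have "x = (of_int D * x) / of_int D" by simp
  then show ?thesis using that D by blast
qed

text \<open>The nontrivial inclusion looks at the ideal \<open>I\<close> of denominators of
  \<open>x\<close>. If it contains no power of \<open>\<delta>\<close>, some prime \<open>P\<close>
  outside \<open>S\<close> contains \<open>I\<close>; but \<open>x\<close> has nonnegative valuation
  there, which provides a denominator of \<open>x\<close> outside \<open>P\<close>.\<close>

theorem S_integers_eq:
  assumes \<delta>: "\<delta> \<in> Ok" "\<delta> \<noteq> 0" and S: "\<And>P. P \<in> finite_primes K \<Longrightarrow> \<delta> \<in> P \<longleftrightarrow> Inr P \<in> S"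
  shows "S_integers K S = {x \<in> K. \<exists>k. \<delta> ^ k * x \<in> Ok}"
proof (intro Set.set_eqI iffI)
  fix x assume "x \<in> {x \<in> K. \<exists>k. \<delta> ^ k * x \<in> Ok}"
  then obtain k where x: "x \<in> K" and k: "\<delta> ^ k * x \<in> Ok" by blast
  have "x = 0 \<or> prime_valuation K P x \<ge> 0" if Pr: "P \<in> finite_primes K" "Inr P \<notin> S" for P
  proof (cases "x = 0")
    case False
    obtain h \<pi> where "prime_of_number_field K \<theta> f P h \<pi>" using prime_localeI[OF Pr(1)] by blast
    then interpret prime_of_number_field K \<theta> f P h \<pi> .
    have "\<delta> \<notin> P" using S Pr by simp
    then have "\<delta> ^ k \<notin> P" using prime_power_mem[OF Pr(1) \<delta>(1)] by blast
    then have "od (\<delta> ^ k) = 0"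
      using mem_ipow_iff[OF Ok_closed(7)[OF \<delta>(1)], of k 1] ipow_1[OF IP(1)] \<delta>(2) by simp
    moreover have "x = (\<delta> ^ k * x) / \<delta> ^ k" using \<delta>(2) by simp
    ultimately have "prime_valuation K P x = int (od (\<delta> ^ k * x))"
      using prime_valuation_quotient[OF k _ Ok_closed(7)[OF \<delta>(1)], of k] False \<delta>(2) by simp
    then show ?thesis by simp
  qed simp
  then show "x \<in> S_integers K S" using x by (auto simp: S_integers_def)
next
  fix x assume xS: "x \<in> S_integers K S"
  then have x: "x \<in> K" by (simp add: S_integers_def)
  define I where "I = {c \<in> Ok. c * x \<in> Ok}"
  have I: "is_ideal I" unfolding is_ideal_def
  proof (intro conjI ballI)
    show "I \<subseteq> Ok" by (auto simp: I_def)
    show "0 \<in> I" using Ok_closed(1) by (simp add: I_def)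
    fix c assume "c \<in> I"
    then have c: "c \<in> Ok" "c * x \<in> Ok" by (auto simp: I_def)
    {
      fix b assume "b \<in> I"
      then have b: "b \<in> Ok" "b * x \<in> Ok" by (auto simp: I_def)
      show "c + b \<in> I" unfolding I_def using Ok_closed(3)[OF c(1) b(1)] Ok_closed(3)[OF c(2) b(2)]
        by (simp add: distrib_right)
    }
    fix r assume r: "r \<in> Ok"
    show "r * c \<in> I" unfolding I_def using Ok_closed(4)[OF r c(1)] Ok_closed(4)[OF r c(2)]
      by (simp add: mult.assoc)
  qed
  obtain a m where am: "a \<in> Ok" "m > 0" "x = a / of_int m" using K_quotient[OF x] by blast
  have "of_int m * x = a" using am(2,3) by simp
  then have mI: "of_int m \<in> I" unfolding I_def using am(1) Ok_closed(8)[of m] by simp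
  have "\<exists>k. \<delta> ^ k \<in> I"
  proof (rule ccontr)
    assume "\<not> ?thesis"
    then obtain P where Pr: "P \<in> finite_primes K" "I \<subseteq> P" "\<delta> \<notin> P"
      using exists_prime_avoiding_powers[OF I mI am(2) \<delta>(1)] by blast
    then have "Inr P \<notin> S" using S by blast
    then have "x = 0 \<or> prime_valuation K P x \<ge> 0" using xS Pr(1) by (auto simp: S_integers_def)
    moreover have x0: "x \<noteq> 0"
    proof
      assume "x = 0"
      then have "1 \<in> I" using Ok_closed(1,2) by (simp add: I_def)
      then show False using Pr(2) finite_primesD(3)[OF Pr(1)] by blast
    qed
    ultimately have val: "prime_valuation K P x \<ge> 0" by blast
    obtain h \<pi> where "prime_of_number_field K \<theta> f P h \<pi>" using prime_localeI[OF Pr(1)] by blast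
    then interpret prime_of_number_field K \<theta> f P h \<pi> .
    define b where "b = (of_int m :: 'a)"
    have b: "b \<in> Ok" "b \<noteq> 0" using am(2) Ok_closed(8) by (simp_all add: b_def)
    have a0: "a \<noteq> 0" using x0 am(3) by auto
    have xab: "x = a / b" using am(3) by (simp add: b_def)
    have le: "od b \<le> od a" using val prime_valuation_quotient[OF am(1) a0 b] unfolding xab by linarith
    \<comment> \<open>\<open>u\<close> is the denominator prime to \<open>P\<close>: because
      \<open>od b \<le> od a\<close>, also \<open>c * a\<close> is divisible by
      \<open>\<pi> ^ od b\<close>, and cancelling this power leaves \<open>u * x\<close>
      integral.\<close>
    obtain c u where c: "c \<in> ipow P ((h - 1) * od b)" "u \<in> Ok" "u \<notin> P" "b * c = \<pi> ^ od b * u"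
      using exists_complement[OF b] by blast
    have "a \<in> ipow P (od b)" using mem_ipow_iff[OF am(1) a0] le by simp
    from ipow_product_mem[OF IP(1) c(1) this] have "c * a \<in> ipow P (h * od b)"
      using h(1) by (cases h) (simp_all add: add.commute)
    then obtain v where v: "c * a = \<pi> ^ od b * v" "v \<in> Ok" unfolding ipow_h by (rule imageE)
    have "\<pi> ^ od b * (u * x) = (b * c) * x" unfolding c(4) by (simp only: mult.assoc)
    also have "\<dots> = c * a" unfolding xab using b(2) by simp
    finally have "u * x = v" unfolding v(1) using \<pi>(2) by simp
    then have "u \<in> I" unfolding I_def using c(2) v(2) by simp
    then show False using Pr(2) c(3) by blast
  qed
  then show "x \<in> {x \<in> K. \<exists>k. \<delta> ^ k * x \<in> Ok}" using x by (auto simp: I_def)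
qed

subsection \<open>Units\<close>

lemma power_basis_independent:
  assumes "(\<Sum>i<d. of_rat (c i) * \<theta> ^ i) = 0" "i < d"
  shows "c i = 0"
proof -
  define p where "p = (\<Sum>i<d. monom (c i) i)"
  have "rpoly p \<theta> = 0" using assms(1) by (simp add: p_def rpoly_sum)
  then have dvd: "f dvd p" by (simp add: rpoly_\<theta>_eq_0_iff)
  have "degree p < d" unfolding p_def
    using d_pos by (intro degree_sum_less) (auto intro: le_less_trans[OF degree_monom_le])
  then have "p = 0" using dvd_imp_degree_le[OF dvd] by fastforce
  moreover have "coeff p i = c i" using assms(2) by (simp add: p_def coeff_sum sum.delta)
  ultimately show ?thesis by simp
qed

lemma card_Em_minus_pair:
  assumes "z0 \<in> Em"
  shows "card (Em - {z0, cnj z0}) + card {z0, cnj z0} = d" "card {z0, cnj z0} \<ge> 1"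
proof -
  have sub: "{z0, cnj z0} \<subseteq> Em" using assms cnj_Em by simp
  show "card (Em - {z0, cnj z0}) + card {z0, cnj z0} = d"
    using card_Diff_subset[OF _ sub] card_mono[OF finite_Em sub] card_Em by simp
  show "card {z0, cnj z0} \<ge> 1" by (cases "z0 = cnj z0") auto
qed

text \<open>Dirichlet's box argument: the coefficients range over a cube of side \<open>t ^ s\<close> and the
  \<open>s\<close> real coordinates away from \<open>z0\<close> are cut into \<open>t ^ d\<close> pieces.\<close>

lemma exists_small_element:
  assumes z0: "z0 \<in> Em"
  shows "\<exists>C>0. \<forall>t::nat. t > 0 \<longrightarrow> (\<exists>a\<in>Ok. a \<noteq> 0 \<and> norm (Nm a) \<le> C \<and>
    (\<forall>z\<in>Em - {z0, cnj z0}. norm (emb z a) \<le> C / real t))"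
proof -
  obtain C where C: "C > 0" "\<And>z c e. z \<in> Em \<Longrightarrow> (\<And>i. i < d \<Longrightarrow> \<bar>real_of_rat (c i)\<bar> \<le> e) \<Longrightarrow>
    norm (emb z (\<Sum>i<d. of_rat (c i) * \<theta> ^ i)) \<le> e * C" using power_basis_bound by metis
  define k where "k = card {z0, cnj z0}"
  define s where "s = card (Em - {z0, cnj z0})"
  have sk: "s + k = d" "k \<ge> 1" using card_Em_minus_pair[OF z0] by (auto simp: s_def k_def)
  \<comment> \<open>\<open>k\<close> is 1 or 2, and \<open>s\<close> counts the remaining roots.
    There the shifted coordinates stay below \<open>5 * t ^ s * C\<close>, the boxes have side
    \<open>5 * C / t ^ k\<close>, and passing to absolute values doubles this to
    \<open>10 * C / t ^ k\<close>. In the norm the powers of \<open>t\<close> cancel: \<open>(t ^ s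
    * C) ^ k * (10 * C / t ^ k) ^ s = C ^ k * (10 * C) ^ s\<close>.\<close>
  define C' where "C' = max (10 * C) (C ^ k * (10 * C) ^ s)"
  have "\<exists>a\<in>Ok. a \<noteq> 0 \<and> norm (Nm a) \<le> C' \<and>
    (\<forall>z\<in>Em - {z0, cnj z0}. norm (emb z a) \<le> C' / real t)" if t: "t > 0" for t :: nat
  proof -
    define V where "V = {..<d} \<rightarrow>\<^sub>E {0..t ^ s}"
    define e where "e = (\<lambda>x::nat \<Rightarrow> nat. (\<Sum>i<d. of_rat (of_nat (x i)) * \<theta> ^ i))"
    have eO: "e x \<in> Ok" for x
    proof -
      have eq: "e x = (\<Sum>i<d. of_int (int (x i)) * \<theta> ^ i)" by (simp add: e_def)
      show ?thesis unfolding eq by (rule subsetD[OF int_adjoin_subset_Ok[OF \<theta>_in_Ok] int_combination_in_int_adjoin])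
    qed
    have eK: "e x \<in> K" for x by (rule Ok_subset[OF eO])
    define B where "B = 5 * (real (t ^ s) * C)"
    have ts: "real (t ^ s) * C > 0" using C(1) t by simp
    have Bpos: "B > 0" using ts by (simp add: B_def)
    have xle: "x i \<le> t ^ s" if "x \<in> V" "i < d" for x i using that by (auto simp: V_def PiE_def Pi_def)
    have enorm: "norm (emb z (e x)) \<le> real (t ^ s) * C" if "x \<in> V" "z \<in> Em" for x z
      unfolding e_def
    proof (rule C(2)[OF that(2)])
      fix i assume "i < d"
      have "\<bar>real_of_rat (of_nat (x i))\<bar> = real (x i)" by simp
      also have "\<dots> \<le> real (t ^ s)" using xle[OF that(1) \<open>i < d\<close>] by (simp only: of_nat_le_iff)
      finally show "\<bar>real_of_rat (of_nat (x i))\<bar> \<le> real (t ^ s)" .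
    qed
    have "\<exists>x\<in>V. \<exists>y\<in>V. x \<noteq> y \<and> (\<forall>z\<in>Em - {z0, cnj z0}.
      \<bar>(lin z (e x) + 2 * (real (t ^ s) * C)) - (lin z (e y) + 2 * (real (t ^ s) * C))\<bar> \<le> B / real (t ^ d))"
    proof (rule pigeonhole_close)
      show "finite (Em - {z0, cnj z0})" by simp
      show "B > 0" by fact
      show "t ^ d > 0" using t by simp
      have "card V = Suc (t ^ s) ^ d" unfolding V_def by (simp add: card_PiE)
      moreover have "(t ^ s) ^ d < Suc (t ^ s) ^ d" using d_pos by (intro power_strict_mono) auto
      moreover have "(t ^ s) ^ d = (t ^ d) ^ s" by (simp only: power_mult[symmetric] mult.commute)
      ultimately show "card V > (t ^ d) ^ card (Em - {z0, cnj z0})" by (simp add: s_def)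
      fix x z assume x: "x \<in> V" and z: "z \<in> Em - {z0, cnj z0}"
      have "\<bar>lin z (e x)\<bar> \<le> 2 * (real (t ^ s) * C)" using abs_lin_le[of z "e x"] enorm[OF x, of z] z by fastforce
      then show "0 \<le> lin z (e x) + 2 * (real (t ^ s) * C) \<and> lin z (e x) + 2 * (real (t ^ s) * C) < B"
        unfolding B_def using ts by linarith
    qed
    then obtain x y where x: "x \<in> V" and y: "y \<in> V" and "x \<noteq> y"
      and close: "\<And>z. z \<in> Em - {z0, cnj z0} \<Longrightarrow> \<bar>lin z (e x) - lin z (e y)\<bar> \<le> B / real (t ^ d)" by auto
    define a where "a = e x - e y"
    have aO: "a \<in> Ok" unfolding a_def by (rule Ok_closed(6)[OF eO eO])
    have aK: "a \<in> K" by (rule Ok_subset[OF aO])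
    have a_eq: "a = (\<Sum>i<d. of_rat (of_nat (x i) - of_nat (y i)) * \<theta> ^ i)"
      unfolding a_def e_def by (simp only: sum_subtractf[symmetric] of_rat_diff left_diff_distrib)
    have a0: "a \<noteq> 0"
    proof
      assume "a = 0"
      then have "rat_of_nat (x i) - of_nat (y i) = 0" if "i < d" for i
        using power_basis_independent[of "\<lambda>i. of_nat (x i) - of_nat (y i)" i] a_eq that by simp
      then have "x i = y i" if "i \<in> {..<d}" for i using that by auto
      then have "x = y" using x y unfolding V_def by (intro PiE_ext)
      then show False using \<open>x \<noteq> y\<close> by blast
    qed
    have far: "norm (emb z a) \<le> real (t ^ s) * C" if "z \<in> Em" for z
      unfolding a_eq
    proof (rule C(2)[OF that])
      fix i assume "i < d"
      have "real_of_rat (of_nat (x i) - of_nat (y i)) = real (x i) - real (y i)" by (simp add: of_rat_diff)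
      moreover have "real (x i) \<le> real (t ^ s)" "real (y i) \<le> real (t ^ s)"
        using xle[OF x \<open>i < d\<close>] xle[OF y \<open>i < d\<close>] by (simp_all only: of_nat_le_iff)
      ultimately show "\<bar>real_of_rat (of_nat (x i) - of_nat (y i))\<bar> \<le> real (t ^ s)" by linarith
    qed
    have td: "real (t ^ d) = real (t ^ s) * real (t ^ k)" using sk(1) by (simp add: power_add[symmetric])
    have near: "norm (emb z a) \<le> 10 * C / real (t ^ k)" if z: "z \<in> Em - {z0, cnj z0}" for z
    proof -
      \<comment> \<open>The absolute value at \<open>z\<close> needs the coordinate at
        \<open>cnj z\<close> too, and the excluded pair is closed under conjugation.\<close>
      have cz: "cnj z \<in> Em - {z0, cnj z0}" using z cnj_Em by auto
      have eq: "B / real (t ^ d) = 5 * C / real (t ^ k)" unfolding B_def td using t by (simp add: field_simps)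
      have "\<bar>lin z a\<bar> \<le> 5 * C / real (t ^ k)" "\<bar>lin (cnj z) a\<bar> \<le> 5 * C / real (t ^ k)"
        using close[OF z] close[OF cz] z cz unfolding a_def eq by (simp_all add: lin_diff eK)
      from norm_emb_le_lin[OF this] show ?thesis by simp
    qed
    have pw: "real (t ^ k) \<ge> real t" using t sk(2) self_le_power[of t k] by simp
    have "norm (emb z a) \<le> C' / real t" if z: "z \<in> Em - {z0, cnj z0}" for z
    proof -
      have "norm (emb z a) \<le> 10 * C / real (t ^ k)" by (rule near[OF z])
      also have "\<dots> \<le> 10 * C / real t" using pw t C(1) by (intro divide_left_mono) auto
      also have "\<dots> \<le> C' / real t" using t by (intro divide_right_mono) (auto simp: C'_def)
      finally show ?thesis .
    qed
    moreover have "norm (Nm a) \<le> C'"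
    proof -
      have sub: "{z0, cnj z0} \<subseteq> Em" using z0 cnj_Em by simp
      have "norm (Nm a) = (\<Prod>z\<in>{z0, cnj z0}. norm (emb z a)) * (\<Prod>z\<in>Em - {z0, cnj z0}. norm (emb z a))"
        unfolding norm_Nm by (subst prod.subset_diff[OF sub]) (simp_all add: mult.commute)
      also have "\<dots> \<le> (\<Prod>z\<in>{z0, cnj z0}. real (t ^ s) * C) * (\<Prod>z\<in>Em - {z0, cnj z0}. 10 * C / real (t ^ k))"
      proof (rule mult_mono)
        show "(\<Prod>z\<in>{z0, cnj z0}. norm (emb z a)) \<le> (\<Prod>z\<in>{z0, cnj z0}. real (t ^ s) * C)"
          by (rule prod_mono) (use far sub in auto)
        show "(\<Prod>z\<in>Em - {z0, cnj z0}. norm (emb z a)) \<le> (\<Prod>z\<in>Em - {z0, cnj z0}. 10 * C / real (t ^ k))"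
          by (rule prod_mono) (use near in auto)
        show "0 \<le> (\<Prod>z\<in>{z0, cnj z0}. real (t ^ s) * C)" using ts by (intro prod_nonneg) auto
        show "0 \<le> (\<Prod>z\<in>Em - {z0, cnj z0}. norm (emb z a))" by (intro prod_nonneg) auto
      qed
      also have "\<dots> = (real (t ^ s) * C) ^ k * (10 * C / real (t ^ k)) ^ s"
        by (simp only: prod_constant k_def s_def)
      also have "\<dots> = C ^ k * (10 * C) ^ s"
      proof -
        have "real (t ^ s) ^ k = real (t ^ k) ^ s"
          by (simp only: of_nat_power power_mult[symmetric] mult.commute)
        moreover have "real (t ^ k) ^ s \<noteq> 0" using t by simp
        ultimately show ?thesis by (simp only: power_mult_distrib power_divide) (use t in \<open>simp add: field_simps\<close>)
      qed
      also have "\<dots> \<le> C'" by (simp add: C'_def)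
      finally show ?thesis .
    qed
    ultimately show ?thesis using aO a0 by blast
  qed
  moreover have "C' > 0" using C(1) by (simp add: C'_def less_max_iff_disj)
  ultimately show ?thesis by blast
qed

section \<open>Units and separation of absolute values\<close>

lemma algebraic_int_of_emb:
  assumes "z \<in> Em" "x \<in> K" "algebraic_int (emb z x)"
  shows "x \<in> Ok"
proof -
  obtain q where q: "poly (map_poly of_int q) (emb z x) = 0" "lead_coeff q = 1"
    using assms(3) unfolding algebraic_int_altdef_ipoly by blast
  have *: "poly (map_poly of_int q) y = rpoly (map_poly of_int q) y" for y :: "'b::field_char_0"
    by (simp add: rpoly_def map_poly_map_poly o_def)
  have "emb z (poly (map_poly of_int q) x) = 0"
    using q(1) unfolding * by (simp add: emb_rpoly[OF assms(1,2)])
  then have "poly (map_poly of_int q) x = 0"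
    unfolding * using emb_eq_0_iff[OF assms(1) rpoly_in_K[OF assms(2)]] by blast
  then show ?thesis using assms(2) q(2) unfolding Ok_iff algebraic_int_altdef_ipoly by blast
qed

text \<open>The norm divided by one conjugate is the product of the others. These live in
  \<open>complex\<close>, so integrality is shown there and pulled back along
  \<open>emb z\<close>.\<close>

lemma Nm_multiple:
  assumes a: "a \<in> Ok" "a \<noteq> 0"
  shows "\<exists>n. Nm a = of_int n \<and> of_int n / a \<in> Ok"
proof -
  obtain n where n: "Nm a = of_int n" using Nm_int[OF a(1)] by (auto elim: Ints_cases)
  obtain z where z: "z \<in> Em" using Em_nonempty by blast
  have aK: "a \<in> K" by (rule Ok_subset[OF a(1)])
  have "Nm a = emb z a * (\<Prod>w\<in>Em - {z}. emb w a)" unfolding Nm_def by (rule prod.remove[OF finite_Em z])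
  moreover have "emb z a \<noteq> 0" using emb_eq_0_iff[OF z aK] a(2) by simp
  moreover have "emb z (of_int n / a) = of_int n / emb z a"
    using emb_divide[OF z K_closed(11) aK] z by simp
  ultimately have "emb z (of_int n / a) = (\<Prod>w\<in>Em - {z}. emb w a)" using n by (simp add: field_simps)
  moreover have "algebraic_int (\<Prod>w\<in>Em - {z}. emb w a)"
    by (rule algebraic_int_prod) (use emb_algebraic_int[OF _ a(1)] in blast)
  ultimately have "algebraic_int (emb z (of_int n / a))" by simp
  then have "of_int n / a \<in> Ok" by (rule algebraic_int_of_emb[OF z K_closed(8)[OF K_closed(11) aK]])
  then show ?thesis using n by blast
qed

lemma is_ideal_principal: "a \<in> Ok \<Longrightarrow> is_ideal ((\<lambda>x. a * x) ` Ok)"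
proof -
  assume a: "a \<in> Ok"
  show ?thesis unfolding is_ideal_def
  proof (intro conjI ballI)
    show "(\<lambda>x. a * x) ` Ok \<subseteq> Ok" using Ok_closed(4)[OF a] by blast
    show "0 \<in> (\<lambda>x. a * x) ` Ok" using Ok_closed(1) by (intro image_eqI[of _ _ 0]) auto
    fix x assume "x \<in> (\<lambda>x. a * x) ` Ok"
    then obtain u where u: "x = a * u" "u \<in> Ok" by (rule imageE)
    {
      fix y assume "y \<in> (\<lambda>x. a * x) ` Ok"
      then obtain v where v: "y = a * v" "v \<in> Ok" by (rule imageE)
      have "x + y = a * (u + v)" by (simp only: u(1) v(1) distrib_left)
      then show "x + y \<in> (\<lambda>x. a * x) ` Ok" by (rule image_eqI[OF _ Ok_closed(3)[OF u(2) v(2)]])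
    }
    fix r assume r: "r \<in> Ok"
    have "r * x = a * (r * u)" by (simp only: u(1) mult.left_commute)
    then show "r * x \<in> (\<lambda>x. a * x) ` Ok" by (rule image_eqI[OF _ Ok_closed(4)[OF r u(2)]])
  qed
qed

lemma same_ideal_quotient:
  assumes ab: "a \<in> Ok" "b \<in> Ok" "b \<noteq> 0" and eq: "(\<lambda>x. a * x) ` Ok = (\<lambda>x. b * x) ` Ok"
  shows "a / b \<in> Ok"
proof -
  have "a * 1 \<in> (\<lambda>x. b * x) ` Ok" unfolding eq[symmetric] using Ok_closed(2) by blast
  then obtain u where "a * 1 = b * u" "u \<in> Ok" by (rule imageE)
  then show ?thesis using ab(3) by simp
qed

text \<open>\<open>a\<close> divides its norm, a nonzero integer of absolute value at most
  \<open>C\<close>, and this in turn divides the factorial \<open>m\<close>. So all these ideals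
  contain \<open>m\<close>, as only finitely many ideals do.\<close>

lemma finite_principal_ideals_bounded_norm:
  "finite ((\<lambda>a. (\<lambda>x. a * x) ` Ok) ` {a \<in> Ok. a \<noteq> 0 \<and> norm (Nm a) \<le> C})"
proof -
  define m :: int where "m = fact (nat \<lceil>C\<rceil>)"
  have m: "m > 0" by (simp add: m_def)
  have "of_int m \<in> (\<lambda>x. a * x) ` Ok" if a: "a \<in> Ok" "a \<noteq> 0" "norm (Nm a) \<le> C" for a
  proof -
    obtain n where n: "Nm a = of_int n" "of_int n / a \<in> Ok" using Nm_multiple[OF a(1,2)] by blast
    have "of_int \<bar>n\<bar> \<le> C" using a(3) n(1) by simp
    then have le: "nat \<bar>n\<bar> \<le> nat \<lceil>C\<rceil>" by linarith
    have "n \<noteq> 0" using norm_Nm_ge_1[OF a(1,2)] n(1) by auto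
    then have "nat \<bar>n\<bar> dvd fact (nat \<lceil>C\<rceil>)" using le by (intro dvd_fact) auto
    then have "int (nat \<bar>n\<bar>) dvd int (fact (nat \<lceil>C\<rceil>))" by (simp only: int_dvd_int_iff)
    then have "n dvd m" by (simp add: m_def)
    then obtain q where q: "m = n * q" by (auto elim: dvdE)
    have "of_int m = a * ((of_int n / a) * of_int q)" unfolding q using a(2) by simp
    then show ?thesis by (rule image_eqI[OF _ Ok_closed(4)[OF n(2) Ok_closed(8)]])
  qed
  then have "(\<lambda>a. (\<lambda>x. a * x) ` Ok) ` {a \<in> Ok. a \<noteq> 0 \<and> norm (Nm a) \<le> C} \<subseteq> {A. is_ideal A \<and> of_int m \<in> A}"
    using is_ideal_principal by blast
  then show ?thesis using finite_ideals_containing[OF m] finite_subset by blast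
qed

text \<open>Take elements \<open>a n\<close> of bounded norm that become small away from the pair of
  \<open>z0\<close>. Infinitely many generate the same ideal, and their quotients are units. If
  units never distinguished \<open>z0\<close> from \<open>z1\<close>, the ratio of the absolute
  values of \<open>a n\<close> at \<open>z0\<close> and \<open>z1\<close> would be constant along
  these \<open>n\<close>, so smallness at \<open>z1\<close> would spread to \<open>z0\<close>, and
  \<open>a n\<close> would be 0 for large \<open>n\<close>.\<close>

lemma exists_separating_unit:
  assumes z0: "z0 \<in> Em" and z1: "z1 \<in> Em" "z1 \<noteq> z0" "z1 \<noteq> cnj z0"
  shows "\<exists>\<epsilon>\<in>Ok. inverse \<epsilon> \<in> Ok \<and> \<epsilon> \<noteq> 0 \<and> norm (emb z0 \<epsilon>) \<noteq> norm (emb z1 \<epsilon>)"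
proof (rule ccontr)
  assume no: "\<not> ?thesis"
  obtain C where C: "C > 0" "\<forall>t::nat. t > 0 \<longrightarrow> (\<exists>a\<in>Ok. a \<noteq> 0 \<and> norm (Nm a) \<le> C \<and>
    (\<forall>z\<in>Em - {z0, cnj z0}. norm (emb z a) \<le> C / real t))" using exists_small_element[OF z0] by blast
  have "\<forall>n. \<exists>a. a \<in> Ok \<and> a \<noteq> 0 \<and> norm (Nm a) \<le> C \<and>
    (\<forall>z\<in>Em - {z0, cnj z0}. norm (emb z a) \<le> C / real (Suc n))" using C(2) by blast
  then obtain a where a: "\<And>n. a n \<in> Ok" "\<And>n. a n \<noteq> 0" "\<And>n. norm (Nm (a n)) \<le> C"
    "\<And>n z. z \<in> Em - {z0, cnj z0} \<Longrightarrow> norm (emb z (a n)) \<le> C / real (Suc n)" by (auto dest!: choice)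
  define J where "J = (\<lambda>n. (\<lambda>x. a n * x) ` Ok)"
  have "finite (range J)"
    by (rule finite_subset[OF _ finite_principal_ideals_bounded_norm[of C]]) (use a(1,2,3) in \<open>auto simp: J_def\<close>)
  then obtain n0 where inf: "infinite {n. J n = J n0}"
    using pigeonhole_infinite[of UNIV J] infinite_UNIV_nat by auto
  have aK: "a n \<in> K" for n by (rule Ok_subset[OF a(1)])
  have nz: "norm (emb z (a n)) > 0" if "z \<in> Em" for z n using emb_eq_0_iff[OF that aK] a(2) by simp
  define \<rho> where "\<rho> = norm (emb z0 (a n0)) / norm (emb z1 (a n0))"
  have \<rho>: "\<rho> > 0" using nz[OF z0] nz[OF z1(1)] by (simp add: \<rho>_def)
  have ratio: "norm (emb z0 (a n)) = \<rho> * norm (emb z1 (a n))" if n: "J n = J n0" for n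
  proof -
    define \<epsilon> where "\<epsilon> = a n / a n0"
    have "\<epsilon> \<in> Ok" unfolding \<epsilon>_def using same_ideal_quotient[OF a(1) a(1) a(2)] n unfolding J_def by blast
    moreover have "inverse \<epsilon> \<in> Ok"
    proof -
      have "inverse \<epsilon> = a n0 / a n" by (simp add: \<epsilon>_def)
      then show ?thesis using same_ideal_quotient[OF a(1) a(1) a(2)] n[symmetric] unfolding J_def by metis
    qed
    moreover have "\<epsilon> \<noteq> 0" using a(2) by (simp add: \<epsilon>_def)
    ultimately have "norm (emb z0 \<epsilon>) = norm (emb z1 \<epsilon>)" using no by blast
    then have "norm (emb z0 (a n)) / norm (emb z0 (a n0)) = norm (emb z1 (a n)) / norm (emb z1 (a n0))"
      unfolding \<epsilon>_def by (simp add: emb_divide[OF z0 aK aK] emb_divide[OF z1(1) aK aK] norm_divide)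
    then show ?thesis using nz[OF z0, of n0] nz[OF z1(1), of n0] by (simp add: \<rho>_def field_simps)
  qed
  \<comment> \<open>The factor \<open>\<rho>\<close> serves the roots \<open>z0\<close> and
    \<open>cnj z0\<close>, the factor 1 all the others; both bounds are then at most 1/2.\<close>
  obtain t :: nat where t: "real t \<ge> 2 * (max 1 \<rho> * C)" using real_arch_simple by blast
  have "\<forall>m. \<exists>n\<ge>m. n \<in> {n. J n = J n0}" by (rule iffD1[OF infinite_nat_iff_unbounded_le inf])
  then have "\<exists>n\<ge>t. n \<in> {n. J n = J n0}" by (rule spec)
  then obtain n where n: "n \<ge> t" "J n = J n0" by (elim exE conjE CollectE)
  have nt: "2 * (max 1 \<rho> * C) \<le> real (Suc n)" using t n(1) by linarith
  have small: "max 1 \<rho> * (C / real (Suc n)) \<le> 1 / 2" using nt by (simp add: field_simps)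
  have small1: "norm (emb z1 (a n)) \<le> C / real (Suc n)" using a(4) z1 by blast
  have Cn: "C / real (Suc n) > 0" using C(1) by simp
  have "norm (emb z (a n)) \<le> 1 / 2" if z: "z \<in> Em" for z
  proof (cases "z \<in> {z0, cnj z0}")
    case True
    then have "norm (emb z (a n)) = norm (emb z0 (a n))" by (auto simp: emb_cnj)
    also have "\<dots> \<le> \<rho> * (C / real (Suc n))" unfolding ratio[OF n(2)]
      using \<rho> small1 by (intro mult_left_mono) auto
    also have "\<dots> \<le> max 1 \<rho> * (C / real (Suc n))" using Cn by (intro mult_right_mono) auto
    also have "\<dots> \<le> 1 / 2" by (rule small)
    finally show ?thesis .
  next
    case False
    then have "norm (emb z (a n)) \<le> 1 * (C / real (Suc n))" using a(4) z by simp
    also have "\<dots> \<le> max 1 \<rho> * (C / real (Suc n))" using Cn by (intro mult_right_mono) auto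
    also have "\<dots> \<le> 1 / 2" by (rule small)
    finally show ?thesis .
  qed
  then have "a n = 0" by (rule Ok_eq_0I[OF a(1)])
  then show False using a(2) by blast
qed

lemma unit_notin_prime:
  assumes "P \<in> finite_primes K" "\<epsilon> \<in> Ok" "inverse \<epsilon> \<in> Ok" "\<epsilon> \<noteq> 0"
  shows "\<epsilon> \<notin> P"
proof
  assume "\<epsilon> \<in> P"
  then have "\<epsilon> * inverse \<epsilon> \<in> P" by (rule is_idealD(5)[OF finite_primesD(1)[OF assms(1)] _ assms(3)])
  then show False using assms(4) finite_primesD(3)[OF assms(1)] by simp
qed

text \<open>The equation says \<open>(a / b) ^ N = e / c\<close>, which determines \<open>N\<close>
  because \<open>a / b \<noteq> 1\<close>.\<close>

lemma geometric_coincidence_finite: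
  fixes a b c e :: real
  assumes "a > 0" "b > 0" "a \<noteq> b" "c > 0" "e > 0"
  shows "finite {N::nat. a ^ N * c = b ^ N * e}"
proof -
  have "N = M" if "a ^ N * c = b ^ N * e" "a ^ M * c = b ^ M * e" for N M
  proof -
    have q: "(a / b) ^ N = e / c" "(a / b) ^ M = e / c"
      using that assms by (simp_all add: power_divide field_simps)
    have "real N * ln (a / b) = ln ((a / b) ^ N)" "real M * ln (a / b) = ln ((a / b) ^ M)"
      using assms by (simp_all add: ln_realpow)
    then have "real N * ln (a / b) = real M * ln (a / b)" using q by simp
    moreover have "ln (a / b) \<noteq> 0" using assms by (simp add: ln_div)
    ultimately show ?thesis by simp
  qed
  then have "{N. a ^ N * c = b ^ N * e} \<subseteq> {N0}" if "a ^ N0 * c = b ^ N0 * e" for N0 using that by blast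
  then show ?thesis
    by (cases "\<exists>N0. a ^ N0 * c = b ^ N0 * e") (auto intro: finite_subset)
qed

text \<open>A pair not yet separated by \<open>\<gamma>\<close> is separated by
  \<open>\<gamma> ^ N * \<epsilon>\<close> for every \<open>N\<close>, with a unit
  \<open>\<epsilon>\<close> that separates it, because the factors coming from
  \<open>\<gamma>\<close> agree there. The pairs already separated exclude only finitely many
  \<open>N\<close>.\<close>

lemma exists_separated_multiple:
  assumes \<delta>: "\<delta> \<in> Ok" "\<delta> \<noteq> 0" and "finite Q"
    and "\<And>z w. (z, w) \<in> Q \<Longrightarrow> z \<in> Em \<and> w \<in> Em \<and> w \<noteq> z \<and> w \<noteq> cnj z"
  shows "\<exists>\<gamma>\<in>Ok. \<gamma> \<noteq> 0 \<and> (\<forall>P\<in>finite_primes K. \<gamma> \<in> P \<longleftrightarrow> \<delta> \<in> P) \<and>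
    (\<forall>(z, w)\<in>Q. norm (emb z \<gamma>) \<noteq> norm (emb w \<gamma>))"
  using assms(3,4)
proof (induction Q)
  case empty
  show ?case using \<delta> by auto
next
  case (insert q Q)
  have "\<exists>\<gamma>\<in>Ok. \<gamma> \<noteq> 0 \<and> (\<forall>P\<in>finite_primes K. \<gamma> \<in> P \<longleftrightarrow> \<delta> \<in> P) \<and>
    (\<forall>(z, w)\<in>Q. norm (emb z \<gamma>) \<noteq> norm (emb w \<gamma>))"
    by (rule insert.IH) (rule insert.prems, erule insertI2)
  then obtain \<gamma> where \<gamma>12: "\<gamma> \<in> Ok" "\<gamma> \<noteq> 0"
    and \<gamma>3: "\<forall>P\<in>finite_primes K. \<gamma> \<in> P \<longleftrightarrow> \<delta> \<in> P"
    and sep0: "\<forall>(z, w)\<in>Q. norm (emb z \<gamma>) \<noteq> norm (emb w \<gamma>)" by (elim bexE conjE)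
  note \<gamma> = \<gamma>12 bspec[OF \<gamma>3]
  have sep: "norm (emb z \<gamma>) \<noteq> norm (emb w \<gamma>)" if "(z, w) \<in> Q" for z w
    using bspec[OF sep0 that] by (simp only: prod.case simp_thms)
  obtain z w where q: "q = (z, w)" by (cases q)
  have zw: "z \<in> Em" "w \<in> Em" "w \<noteq> z" "w \<noteq> cnj z" using insert.prems[of z w] q by auto
  show ?case
  proof (cases "norm (emb z \<gamma>) = norm (emb w \<gamma>)")
    case False
    then have "\<forall>(z, w)\<in>insert q Q. norm (emb z \<gamma>) \<noteq> norm (emb w \<gamma>)" using sep0 q by simp
    then show ?thesis using \<gamma>12 \<gamma>3 by blast
  next
    case True
    obtain \<epsilon> where \<epsilon>: "\<epsilon> \<in> Ok" "inverse \<epsilon> \<in> Ok" "\<epsilon> \<noteq> 0" "norm (emb z \<epsilon>) \<noteq> norm (emb w \<epsilon>)"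
      using exists_separating_unit[OF zw] by (elim bexE conjE)
    have \<gamma>K: "\<gamma> \<in> K" and \<epsilon>K: "\<epsilon> \<in> K" using Ok_subset \<gamma>(1) \<epsilon>(1) by auto
    have pos: "norm (emb u \<gamma>) > 0" "norm (emb u \<epsilon>) > 0" if "u \<in> Em" for u
      using emb_eq_0_iff[OF that] \<gamma>K \<epsilon>K \<gamma>(2) \<epsilon>(3) by auto
    \<comment> \<open>Exponents at which an old pair would coincide again. The exponent 0 is
      excluded as well, since without a factor \<open>\<gamma>\<close> the primes containing it
      would be lost.\<close>
    define bad where "bad = (\<Union>(u, v)\<in>Q. {N::nat. norm (emb u \<gamma>) ^ N * norm (emb u \<epsilon>) = norm (emb v \<gamma>) ^ N * norm (emb v \<epsilon>)})"
    have "finite bad" unfolding bad_def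
    proof (rule finite_UN_I[OF insert.hyps(1)], clarify)
      fix u v assume uv: "(u, v) \<in> Q"
      then have "u \<in> Em" "v \<in> Em" using insert.prems by auto
      then show "finite {N::nat. norm (emb u \<gamma>) ^ N * norm (emb u \<epsilon>) = norm (emb v \<gamma>) ^ N * norm (emb v \<epsilon>)}"
        using pos sep[OF uv] by (intro geometric_coincidence_finite)
    qed
    then have "finite (insert 0 bad)" by simp
    then obtain N where "N \<notin> insert 0 bad" using ex_new_if_finite infinite_UNIV_nat by blast
    then have N: "N > 0" "N \<notin> bad" by auto
    define g where "g = \<gamma> ^ N * \<epsilon>"
    have gn: "norm (emb u g) = norm (emb u \<gamma>) ^ N * norm (emb u \<epsilon>)" if "u \<in> Em" for u
      unfolding g_def using that \<gamma>K \<epsilon>K by (simp add: emb_mult emb_power norm_mult norm_power K_closed)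
    have "g \<in> Ok" unfolding g_def by (rule Ok_closed(4)[OF Ok_closed(7)[OF \<gamma>(1)] \<epsilon>(1)])
    moreover have "g \<noteq> 0" using \<gamma>(2) \<epsilon>(3) by (simp add: g_def)
    moreover have "g \<in> P \<longleftrightarrow> \<delta> \<in> P" if P: "P \<in> finite_primes K" for P
    proof -
      have "g \<in> P \<longleftrightarrow> \<gamma> \<in> P"
      proof
        assume "g \<in> P"
        then have "\<gamma> ^ N \<in> P" using finite_primesD(4)[OF P Ok_closed(7)[OF \<gamma>(1)] \<epsilon>(1)] unit_notin_prime[OF P \<epsilon>(1-3)]
          unfolding g_def by blast
        then show "\<gamma> \<in> P" by (rule prime_power_mem[OF P \<gamma>(1)])
      next
        assume "\<gamma> \<in> P"
        moreover have "g = \<gamma> * (\<gamma> ^ (N - 1) * \<epsilon>)" using N(1) by (cases N) (simp_all add: g_def mult.assoc)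
        ultimately show "g \<in> P"
          using is_idealD(5)[OF finite_primesD(1)[OF P] _ Ok_closed(4)[OF Ok_closed(7)[OF \<gamma>(1)] \<epsilon>(1)]] by simp
      qed
      then show ?thesis using \<gamma>(3)[OF P] by simp
    qed
    moreover have "norm (emb u g) \<noteq> norm (emb v g)" if uv: "(u, v) \<in> insert q Q" for u v
    proof (cases "(u, v) \<in> Q")
      case True
      then have "u \<in> Em" "v \<in> Em" using insert.prems by auto
      then show ?thesis using N(2) True by (auto simp: bad_def gn)
    next
      case False
      then have "u = z" "v = w" using uv q by auto
      then show ?thesis using zw(1,2) \<epsilon>(4) True pos[OF zw(2)] by (simp add: gn)
    qed
    ultimately show ?thesis by blast
  qed
qed

end

subsection \<open>CM fields and finite index\<close>

lemma ring_hom_closed_subfield: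
  assumes L: "closed_subfield L" and \<sigma>: "\<sigma> \<in> Ring.ring_hom (subring_of L) (ring_of_type_algebra :: complex ring)"
  shows "x \<in> L \<Longrightarrow> y \<in> L \<Longrightarrow> \<sigma> (x + y) = \<sigma> x + \<sigma> y"
    "x \<in> L \<Longrightarrow> y \<in> L \<Longrightarrow> \<sigma> (x * y) = \<sigma> x * \<sigma> y" "\<sigma> 1 = 1" "\<sigma> 0 = 0"
    "\<sigma> (of_rat q) = of_rat q"
proof -
  note L' = L[unfolded closed_subfield_def]
  show add: "x \<in> L \<Longrightarrow> y \<in> L \<Longrightarrow> \<sigma> (x + y) = \<sigma> x + \<sigma> y" for x y
    using ring_hom_add[OF \<sigma>, of x y] by simp
  show mult: "x \<in> L \<Longrightarrow> y \<in> L \<Longrightarrow> \<sigma> (x * y) = \<sigma> x * \<sigma> y" for x y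
    using ring_hom_mult[OF \<sigma>, of x y] by simp
  show one: "\<sigma> 1 = 1" using ring_hom_one[OF \<sigma>] by simp
  show zero: "\<sigma> 0 = 0" using add[of 0 0] L' by simp
  have nat: "\<sigma> (of_nat n) = of_nat n" for n
  proof (induction n)
    case (Suc n)
    have "of_nat n \<in> L" using of_rat_in_closed_subfield[OF L, of "of_nat n"] by simp
    then show ?case using add[of 1 "of_nat n"] L' Suc one by simp
  qed (use zero in simp)
  have int: "\<sigma> (of_int k) = of_int k" for k
  proof -
    have "of_int k \<in> L" "of_nat n \<in> L" for k n
      using of_rat_in_closed_subfield[OF L, of "of_int k"] of_rat_in_closed_subfield[OF L, of "of_nat n"] by simp_all
    then have s: "\<sigma> (of_int k + of_nat n) = \<sigma> (of_int k) + of_nat n" for k n using add nat by simp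
    \<comment> \<open>This holds for either sign of \<open>k\<close>, so negative integers are
      reached by additivity alone.\<close>
    have "(of_int k :: 'a) + of_nat (nat (- k)) = of_nat (nat k)"
      by (cases "k \<ge> 0") simp_all
    then have "\<sigma> (of_int k) + of_nat (nat (- k)) = of_nat (nat k)" using s[of k "nat (- k)"] nat by simp
    then show ?thesis by (cases "k \<ge> 0") (simp_all add: add_eq_0_iff2)
  qed
  show "\<sigma> (of_rat q) = of_rat q"
  proof (cases q)
    case (Fract a b)
    have "of_rat q * of_int b = (of_int a :: 'a)" "of_rat q * of_int b = (of_int a :: complex)"
      unfolding Fract(1) using Fract(2) by (simp_all add: of_rat_rat)
    moreover have "\<sigma> (of_rat q * of_int b) = \<sigma> (of_rat q) * of_int b"
      using mult[of "of_rat q" "of_int b"] of_rat_in_closed_subfield[OF L, of q]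
        of_rat_in_closed_subfield[OF L, of "of_int b"] int by simp
    ultimately have "\<sigma> (of_rat q) * of_int b = of_rat q * of_int b" using int[of a] by metis
    moreover have "(of_int b :: complex) \<noteq> 0" using Fract(2) by simp
    ultimately show ?thesis using mult_right_cancel by blast
  qed
qed

lemma ring_hom_rpoly:
  assumes L: "closed_subfield L" and \<sigma>: "\<sigma> \<in> Ring.ring_hom (subring_of L) (ring_of_type_algebra :: complex ring)"
    and x: "x \<in> L"
  shows "\<sigma> (rpoly p x) = rpoly p (\<sigma> x)"
proof (induction p)
  case 0
  then show ?case using ring_hom_closed_subfield(4)[OF L \<sigma>] by simp
next
  case (pCons a p)
  have "rpoly p x \<in> L" by (rule rpoly_in_closed_subfield[OF L x])
  moreover from this have "x * rpoly p x \<in> L" using x L by (auto simp: closed_subfield_def)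
  ultimately show ?case using x ring_hom_closed_subfield[OF L \<sigma>] of_rat_in_closed_subfield[OF L, of a] pCons.IH
    by simp
qed

lemma rpoly_eq_0I:
  fixes p :: "rat poly" and V :: "complex set"
  assumes "finite V" "degree p < card V" "\<And>v. v \<in> V \<Longrightarrow> rpoly p v = 0"
  shows "p = 0"
proof (rule ccontr)
  assume p: "p \<noteq> 0"
  define q where "q = (map_poly of_rat p :: complex poly)"
  have q: "q \<noteq> 0" "degree q = degree p" using p by (simp_all add: q_def map_poly_eq_0_iff)
  have "V \<subseteq> {x. poly q x = 0}" using assms(3) by (auto simp: q_def rpoly_def)
  then have "card V \<le> card {x. poly q x = 0}" by (intro card_mono poly_roots_finite q(1))
  also have "\<dots> \<le> degree q" by (rule card_poly_roots_bound[OF q(1)])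
  finally show False using assms(2) q(2) by simp
qed

lemma degree_sum_monom_less: "n > 0 \<Longrightarrow> degree (\<Sum>i<n. monom (c i :: rat) i) < n"
  by (intro degree_sum_less) (auto intro: le_less_trans[OF degree_monom_le])

lemma coeff_sum_monom: "i < n \<Longrightarrow> coeff (\<Sum>i<n. monom (c i :: rat) i) i = c i"
  by (simp add: coeff_sum sum.delta)

lemma sum_lessThan_add:
  fixes g :: "nat \<Rightarrow> 'a::comm_monoid_add"
  shows "(\<Sum>i<m + n. g i) = (\<Sum>i<m. g i) + (\<Sum>i<n. g (m + i))"
  by (induction n) (simp_all add: add.assoc)

section \<open>Additive subgroups, cosets and rings generated by one element\<close>

lemma subring_of_abelian_group:
  assumes "0 \<in> A" "\<And>x y. x \<in> A \<Longrightarrow> y \<in> A \<Longrightarrow> x + y \<in> A" "\<And>x. x \<in> A \<Longrightarrow> - x \<in> (A :: 'a::field_char_0 set)"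
  shows "abelian_group (subring_of A)"
  by (rule abelian_groupI) (use assms in \<open>auto simp: algebra_simps intro!: bexI[of _ "- _"]\<close>)

lemma subring_of_additive_subgroup:
  assumes A: "0 \<in> A" "\<And>x y. x \<in> A \<Longrightarrow> y \<in> A \<Longrightarrow> x + y \<in> A" "\<And>x. x \<in> A \<Longrightarrow> - x \<in> (A :: 'a::field_char_0 set)"
    and H: "H \<subseteq> A" "0 \<in> H" "\<And>x y. x \<in> H \<Longrightarrow> y \<in> H \<Longrightarrow> x + y \<in> H" "\<And>x. x \<in> H \<Longrightarrow> - x \<in> H"
  shows "additive_subgroup H (subring_of A)"
proof -
  interpret abelian_group "subring_of A" by (rule subring_of_abelian_group[OF A])
  have inv: "inv\<^bsub>add_monoid (subring_of A)\<^esub> x = - x" if "x \<in> A" for x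
    using minus_equality[of "- x" x] that A(3) by (simp add: a_inv_def)
  show ?thesis
  proof (rule additive_subgroup.intro, rule group.subgroupI[OF a_group])
    show "H \<subseteq> carrier (add_monoid (subring_of A))" "H \<noteq> {}" using H by auto
    fix a assume a: "a \<in> H"
    then show "inv\<^bsub>add_monoid (subring_of A)\<^esub> a \<in> H" using inv[of a] H by auto
    fix b assume "b \<in> H"
    then show "a \<otimes>\<^bsub>add_monoid (subring_of A)\<^esub> b \<in> H" using H(3) a by simp
  qed
qed

lemma subring_of_coset_eqI:
  assumes "\<And>x y. x \<in> H \<Longrightarrow> y \<in> H \<Longrightarrow> x + y \<in> H" "\<And>x. x \<in> H \<Longrightarrow> - x \<in> (H :: 'a::field_char_0 set)" "x - y \<in> H"
  shows "H +>\<^bsub>subring_of A\<^esub> x = H +>\<^bsub>subring_of A\<^esub> y"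
proof -
  have *: "H +>\<^bsub>subring_of A\<^esub> u \<subseteq> H +>\<^bsub>subring_of A\<^esub> v" if "u - v \<in> H" for u v
  proof
    fix w assume "w \<in> H +>\<^bsub>subring_of A\<^esub> u"
    then obtain h where h: "h \<in> H" "w = h + u" by (auto simp: a_r_coset_def r_coset_def)
    have "w = (h + (u - v)) + v" using h(2) by simp
    moreover have "h + (u - v) \<in> H" by (rule assms(1)[OF h(1) that])
    ultimately have "\<exists>h'\<in>H. w = h' + v" by (rule bexI)
    then show "w \<in> H +>\<^bsub>subring_of A\<^esub> v" by (simp add: a_r_coset_def r_coset_def)
  qed
  have "- (x - y) \<in> H" using assms(2,3) by blast
  then show ?thesis using *[of x y] *[of y x] assms(3) by simp
qed

lemma int_adjoin_ring:
  shows "1 \<in> int_adjoin x" "0 \<in> int_adjoin x" "x \<in> int_adjoin (x :: 'a::field_char_0)"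
    "a \<in> int_adjoin x \<Longrightarrow> b \<in> int_adjoin x \<Longrightarrow> a + b \<in> int_adjoin x"
    "a \<in> int_adjoin x \<Longrightarrow> b \<in> int_adjoin x \<Longrightarrow> a * b \<in> int_adjoin x"
    "a \<in> int_adjoin x \<Longrightarrow> - a \<in> int_adjoin x"
    "of_int k \<in> int_adjoin x" "a \<in> int_adjoin x \<Longrightarrow> a ^ n \<in> int_adjoin x"
proof -
  have c: "of_int k \<in> int_adjoin x" for k
    unfolding int_adjoin_def by (rule image_eqI[of _ _ "[:k:]"]) (simp_all add: of_int_hom.map_poly_pCons_hom)
  show "of_int k \<in> int_adjoin x" by (rule c)
  show one: "1 \<in> int_adjoin x" using c[of 1] by simp
  show "0 \<in> int_adjoin x" using c[of 0] by simp
  show "x \<in> int_adjoin x"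
    unfolding int_adjoin_def by (rule image_eqI[of _ _ "[:0, 1:]"]) (simp_all add: of_int_hom.map_poly_pCons_hom)
  show "a + b \<in> int_adjoin x" if "a \<in> int_adjoin x" "b \<in> int_adjoin x"
  proof -
    from that obtain p q where "a = poly (map_poly of_int p) x" "b = poly (map_poly of_int q) x"
      by (auto simp: int_adjoin_def)
    then have "a + b = poly (map_poly of_int (p + q)) x" by (simp add: of_int_hom.map_poly_hom_add)
    then show ?thesis by (auto simp: int_adjoin_def)
  qed
  show mult: "a * b \<in> int_adjoin x" if "a \<in> int_adjoin x" "b \<in> int_adjoin x" for a b
  proof -
    from that obtain p q where "a = poly (map_poly of_int p) x" "b = poly (map_poly of_int q) x"
      by (auto simp: int_adjoin_def)
    then have "a * b = poly (map_poly of_int (p * q)) x" by (simp add: of_int_poly_hom.hom_mult)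
    then show ?thesis by (auto simp: int_adjoin_def)
  qed
  show "- a \<in> int_adjoin x" if "a \<in> int_adjoin x" using mult[OF c[of "- 1"] that] by simp
  show "a ^ n \<in> int_adjoin x" if "a \<in> int_adjoin x"
    by (induction n) (use one mult that in auto)
qed

lemma int_adjoin_least:
  assumes "x \<in> R" "\<And>k. of_int k \<in> R" "\<And>a b. a \<in> R \<Longrightarrow> b \<in> R \<Longrightarrow> a + b \<in> R"
    "\<And>a b. a \<in> R \<Longrightarrow> b \<in> R \<Longrightarrow> a * b \<in> (R :: 'a::field_char_0 set)"
  shows "int_adjoin x \<subseteq> R"
proof
  fix y assume "y \<in> int_adjoin x"
  then obtain p where "y = poly (map_poly of_int p) x" by (auto simp: int_adjoin_def)
  moreover have "poly (map_poly of_int p) x \<in> R"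
    using assms(2)[of 0] by (induction p) (auto simp: of_int_hom.map_poly_pCons_hom intro: assms)
  ultimately show "y \<in> R" by simp
qed

text \<open>Dividing a monic relation of degree \<open>m\<close> by \<open>x ^ (m - 1)\<close>
  expresses \<open>x\<close> through nonnegative powers of \<open>inverse x\<close>.\<close>

lemma algebraic_int_in_adjoin_inverse:
  assumes "algebraic_int (x :: 'a::field_char_0)" "x \<noteq> 0"
  shows "x \<in> int_adjoin (inverse x)"
proof -
  obtain m a where m: "m > 0" "x ^ m = (\<Sum>i<m. of_int (a i) * x ^ i)"
    using algebraic_int_power_relation[OF assms(1)] by blast
  have "x = inverse x ^ (m - 1) * x ^ m" using m(1) assms(2)
    by (cases m) (simp_all add: power_inverse)
  also have "\<dots> = (\<Sum>i<m. of_int (a i) * inverse x ^ (m - 1 - i))"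
    unfolding m(2) sum_distrib_left
  proof (rule sum.cong)
    fix i assume "i \<in> {..<m}"
    then have "inverse x ^ (m - 1) = inverse x ^ (m - 1 - i) * inverse x ^ i"
      by (simp add: power_add[symmetric])
    then have "inverse x ^ (m - 1) * (of_int (a i) * x ^ i) = of_int (a i) * inverse x ^ (m - 1 - i) * (inverse x ^ i * x ^ i)"
      by (simp only: mult_ac)
    also have "inverse x ^ i * x ^ i = 1" using assms(2) by (simp add: power_mult_distrib[symmetric])
    finally show "inverse x ^ (m - 1) * (of_int (a i) * x ^ i) = of_int (a i) * inverse x ^ (m - 1 - i)" by simp
  qed simp
  also have "\<dots> \<in> int_adjoin (inverse x)"
  proof -
    have sumcl: "sum g A \<in> int_adjoin (inverse x)" if "\<And>i. g i \<in> int_adjoin (inverse x)" for g :: "nat \<Rightarrow> 'a" and A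
      by (induction A rule: infinite_finite_induct) (auto intro: int_adjoin_ring that)
    show ?thesis by (rule sumcl) (intro int_adjoin_ring(3,5,7,8))
  qed
  finally show ?thesis .
qed

section \<open>Coinciding embeddings and CM fields\<close>

context primitive_number_field
begin

text \<open>A rational relation of degree below \<open>d\<close> for \<open>b\<close> would vanish
  at the \<open>d\<close> distinct conjugates of \<open>b\<close>. So the first \<open>d\<close>
  powers of \<open>b\<close> are independent and span \<open>K\<close>.\<close>

lemma emb_injective_imp_primitive:
  assumes b: "b \<in> Ok" and inj: "inj_on (\<lambda>z. emb z b) Em"
  shows "\<exists>g. primitive_number_field K b g"
proof -
  have bK: "b \<in> K" by (rule Ok_subset[OF b])
  have ind: "c i = 0" if s: "(\<Sum>i<d. of_rat (c i) * b ^ i) = 0" and i: "i < d" for c i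
  proof -
    define p where "p = (\<Sum>i<d. monom (c i) i)"
    have p0: "rpoly p b = 0" using s by (simp add: p_def rpoly_sum)
    have "p = 0"
    proof (rule rpoly_eq_0I[of "(\<lambda>z. emb z b) ` Em"])
      show "degree p < card ((\<lambda>z. emb z b) ` Em)"
        unfolding card_image[OF inj] card_Em p_def using d_pos by (rule degree_sum_monom_less)
      fix v assume "v \<in> (\<lambda>z. emb z b) ` Em"
      then obtain z where z: "z \<in> Em" "v = emb z b" by blast
      then show "rpoly p v = 0" using emb_rpoly[OF z(1) bK, of p] p0 by simp
    qed simp
    then show ?thesis using coeff_sum_monom[OF i, of c] by (simp add: p_def)
  qed
  have "x \<in> rat_adjoin b" if x: "x \<in> K" for x
  proof -
    obtain c where "x = (\<Sum>i<d. of_rat (c i) * b ^ i)"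
      using independent_family_spans[of "\<lambda>i. b ^ i" x] K_closed(9)[OF bK] ind x by blast
    then have "x = rpoly (\<Sum>i<d. monom (c i) i) b" by (simp add: rpoly_sum)
    then show ?thesis by (auto simp: rat_adjoin_def)
  qed
  then have "K = rat_adjoin b" using rat_adjoin_subset[OF K_closed_subfield bK] by blast
  moreover obtain g where "Factorial_Ring.irreducible g" "lead_coeff g = 1" "rpoly g b = 0"
    using number_field_minimal_polynomial[OF K bK] by blast
  ultimately have "primitive_number_field K b g"
    using K b Ok_iff by unfold_locales auto
  then show ?thesis by blast
qed

text \<open>The derivative of the characteristic polynomial vanishes at a root exactly when the root
  is repeated, which here means that the fibre has a second element. The point is that this
  condition is a rational polynomial equation in \<open>b\<close>, the same for all
  embeddings.\<close>

lemma emb_multiple_root: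
  assumes b: "b \<in> K"
    and R: "map_poly of_rat r = (\<Prod>z\<in>Em. [:- emb z b, 1:])" and z: "z \<in> Em"
  shows "rpoly (pderiv r) (emb z b) = 0 \<longleftrightarrow> (\<exists>w\<in>Em. w \<noteq> z \<and> emb w b = emb z b)"
proof -
  have "(\<Prod>w\<in>Em. [:- emb w b, 1:]) = [:- emb z b, 1:] * (\<Prod>w\<in>Em - {z}. [:- emb w b, 1:])"
    by (rule prod.remove[OF finite_Em z])
  then have "rpoly (pderiv r) (emb z b) = poly (\<Prod>w\<in>Em - {z}. [:- emb w b, 1:]) (emb z b)"
    unfolding rpoly_def of_rat_hom.map_poly_pderiv R
    by (simp only: pderiv_mult poly_add poly_mult) (simp add: pderiv_pCons)
  also have "\<dots> = (\<Prod>w\<in>Em - {z}. emb z b - emb w b)" by (simp add: poly_prod)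
  finally have "rpoly (pderiv r) (emb z b) = 0 \<longleftrightarrow> (\<exists>w\<in>Em - {z}. emb z b = emb w b)" by simp
  then show ?thesis by (metis DiffD1 DiffD2 DiffI singletonD singletonI)
qed

text \<open>The order of vanishing of the characteristic polynomial of \<open>b\<close> at \<open>emb z b\<close> does not
  depend on \<open>z\<close>, so that all fibres of \<open>z \<mapsto> emb z b\<close> have the same size.\<close>

lemma emb_fibres:
  assumes b: "b \<in> K" and z: "z \<in> Em" and w: "w \<in> Em" "w \<noteq> z" "emb w b = emb z b" and u: "u \<in> Em"
  shows "\<exists>v\<in>Em. v \<noteq> u \<and> emb v b = emb u b"
proof -
  obtain r where r: "map_poly of_rat r = (\<Prod>z\<in>Em. [:- emb z b, 1:])"
    using char_poly_rational[OF b] by blast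
  have "rpoly (pderiv r) (emb z b) = 0" using emb_multiple_root[OF b r z] w by blast
  then have "emb z (rpoly (pderiv r) b) = 0" using emb_rpoly[OF z b] by simp
  then have "rpoly (pderiv r) b = 0" using emb_eq_0_iff[OF z rpoly_in_K[OF b]] by simp
  then have "rpoly (pderiv r) (emb u b) = 0" using emb_rpoly[OF u b, of "pderiv r"] u by simp
  then show ?thesis using emb_multiple_root[OF b r u] by blast
qed

lemma closed_subfield_of_number_field:
  assumes F: "closed_subfield F" "F \<subseteq> K"
  shows "number_field F"
proof -
  obtain B where B: "B \<subseteq> F" "\<not> rat_vs.dependent B" "F \<subseteq> rat_span B"
    using rat_vs.maximal_independent_subset[of F] by blast
  have "B \<subseteq> rat_span ((\<lambda>i. \<theta> ^ i) ` {..<d})" using B(1) F(2) K_span by blast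
  then have "finite B" using rat_vs.independent_span_bound[OF _ B(2), of "(\<lambda>i. \<theta> ^ i) ` {..<d}"] by simp
  moreover have "rat_span B \<subseteq> F" by (rule rat_vs.span_minimal[OF B(1) closed_subfield_subspace[OF F(1)]])
  ultimately show ?thesis unfolding number_field_iff using F(1) B(3) by blast
qed

text \<open>The totally real subfield is \<open>F = \<rat>(b)\<close>: an embedding of
  \<open>F\<close> sends \<open>b\<close> to a root of its characteristic polynomial, hence to some
  real \<open>emb z b\<close>. Each such value is taken at exactly two roots \<open>z\<close> and
  \<open>cnj z\<close>, which accounts for the degree 2.\<close>

lemma CM_fieldI:
  assumes b: "b \<in> K" and nr: "\<And>z. z \<in> Em \<Longrightarrow> cnj z \<noteq> z" and real: "\<And>z. z \<in> Em \<Longrightarrow> emb z b \<in> \<real>"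
    and fib: "\<And>z w. z \<in> Em \<Longrightarrow> w \<in> Em \<Longrightarrow> emb w b = emb z b \<Longrightarrow> w = z \<or> w = cnj z"
  shows "CM_field K"
proof -
  define F where "F = rat_adjoin b"
  obtain g where g: "Factorial_Ring.irreducible g" "rpoly g b = 0"
    using number_field_minimal_polynomial[OF K b] by blast
  have F: "closed_subfield F" unfolding F_def by (rule rat_adjoin_closed_subfield[OF g])
  have FK: "F \<subseteq> K" unfolding F_def by (rule rat_adjoin_subset[OF K_closed_subfield b])
  have bF: "b \<in> F" unfolding F_def by (rule rat_adjoin_base)
  obtain r where r: "map_poly of_rat r = (\<Prod>z\<in>Em. [:- emb z b, 1:])" "rpoly r b = 0"
    using char_poly_rational[OF b] by blast
  have no_real: "\<not> real_embedding K \<sigma>" for \<sigma>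
  proof
    assume "real_embedding K \<sigma>"
    then have \<sigma>: "\<sigma> \<in> Ring.ring_hom (subring_of K) (ring_of_type_algebra :: complex ring)" "\<sigma> \<theta> \<in> \<real>"
      using \<theta>_in_K unfolding real_embedding_def embeddings_def by blast+
    have "rpoly f (\<sigma> \<theta>) = 0"
      using ring_hom_rpoly[OF K_closed_subfield \<sigma>(1) \<theta>_in_K, of f] f_\<theta>
        ring_hom_closed_subfield(4)[OF K_closed_subfield \<sigma>(1)] by simp
    then have "\<sigma> \<theta> \<in> Em" by (simp add: Em_def)
    then show False using nr \<sigma>(2) unfolding Reals_cnj_iff by blast
  qed
  have "real_embedding F \<sigma>" if \<sigma>: "\<sigma> \<in> embeddings F" for \<sigma>
  proof -
    have h: "\<sigma> \<in> Ring.ring_hom (subring_of F) (ring_of_type_algebra :: complex ring)"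
      using \<sigma> unfolding embeddings_def by (rule IntD1)
    have "rpoly r (\<sigma> b) = 0"
      using ring_hom_rpoly[OF F h bF, of r] r(2) ring_hom_closed_subfield(4)[OF F h] by simp
    then have "(\<Prod>z\<in>Em. \<sigma> b - emb z b) = 0" unfolding rpoly_def r(1) by (simp add: poly_prod)
    then obtain z where z: "z \<in> Em" "\<sigma> b = emb z b" by auto
    then have sb: "\<sigma> b \<in> \<real>" using real by simp
    have "\<sigma> x \<in> \<real>" if x: "x \<in> F" for x
    proof -
      obtain p where "x = rpoly p b" using x unfolding F_def rat_adjoin_def by (rule imageE)
      then have "\<sigma> x = rpoly p (\<sigma> b)" using ring_hom_rpoly[OF F h bF] by simp
      then have "cnj (\<sigma> x) = \<sigma> x" using sb by (simp add: rpoly_cnj[symmetric] Reals_cnj_iff)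
      then show ?thesis by (simp add: Reals_cnj_iff)
    qed
    then show ?thesis using \<sigma> by (auto simp: real_embedding_def)
  qed
  then have tr: "totally_real_field F"
    using closed_subfield_of_number_field[OF F FK] by (simp add: totally_real_field_def)
  define W where "W = (\<lambda>z. emb z b) ` Em"
  define e where "e = card W"
  have fibre: "{w \<in> Em. emb w b = emb z b} = {z, cnj z}" if z: "z \<in> Em" for z
  proof
    show "{w \<in> Em. emb w b = emb z b} \<subseteq> {z, cnj z}" using fib[OF z] by blast
    have "emb (cnj z) b = emb z b" using real[OF z] by (simp add: emb_cnj Reals_cnj_iff)
    then show "{z, cnj z} \<subseteq> {w \<in> Em. emb w b = emb z b}" using z cnj_Em[OF z] by simp
  qed
  have d2e: "d = 2 * e"
  proof -
    have "d = (\<Sum>z\<in>Em. 1)" using card_Em by simp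
    also have "\<dots> = (\<Sum>y\<in>W. \<Sum>z\<in>{z \<in> Em. emb z b = y}. 1)"
      unfolding W_def by (rule sum.image_gen[OF finite_Em])
    also have "\<dots> = (\<Sum>y\<in>W. 2)"
    proof (rule sum.cong)
      fix y assume "y \<in> W"
      then obtain z where z: "z \<in> Em" "y = emb z b" by (auto simp: W_def)
      have "card {z, cnj z} = 2" using nr[OF z(1)] by (simp add: card_2_iff)
      then show "(\<Sum>z\<in>{z \<in> Em. emb z b = y}. 1) = (2::nat)" unfolding z(2) fibre[OF z(1)] by simp
    qed simp
    finally show ?thesis by (simp add: e_def)
  qed
  have e0: "e > 0" using d_pos d2e by simp
  have finW: "finite W" by (simp add: W_def)
  \<comment> \<open>At \<open>z\<close> and \<open>cnj z\<close> the element \<open>b\<close> has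
    the same value \<open>v\<close>, while \<open>\<theta>\<close> has the distinct values
    \<open>z\<close> and \<open>cnj z\<close>. Subtracting the two relations gives
    \<open>rpoly q v = 0\<close>, then \<open>rpoly p v = 0\<close>; \<open>e\<close> such points
    are too many for degrees below \<open>e\<close>.\<close>
  have both: "p = 0 \<and> q = 0" if dp: "degree p < e" "degree q < e" and rel: "rpoly p b + rpoly q b * \<theta> = 0" for p q
  proof -
    have pq: "rpoly p v = 0 \<and> rpoly q v = 0" if v: "v \<in> W" for v
    proof -
      obtain z where z: "z \<in> Em" "v = emb z b" using v by (auto simp: W_def)
      have vc: "emb (cnj z) b = v" using fibre[OF z(1)] z(2) by blast
      have *: "rpoly p (emb y b) + rpoly q (emb y b) * y = 0" if y: "y \<in> Em" for y
      proof -
        have "emb y (rpoly p b + rpoly q b * \<theta>) = 0" unfolding rel using y by simp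
        then show ?thesis
          using emb_add[OF y rpoly_in_K[OF b] K_closed(4)[OF rpoly_in_K[OF b] \<theta>_in_K]]
            emb_mult[OF y rpoly_in_K[OF b] \<theta>_in_K] emb_rpoly[OF y b] emb_\<theta>[OF y] by simp
      qed
      have 1: "rpoly p v + rpoly q v * z = 0" using *[OF z(1)] z(2) by simp
      have 2: "rpoly p v + rpoly q v * cnj z = 0" using *[OF cnj_Em[OF z(1)]] vc by simp
      have "rpoly q v * (z - cnj z) = (rpoly p v + rpoly q v * z) - (rpoly p v + rpoly q v * cnj z)"
        by (simp add: algebra_simps)
      then have "rpoly q v * (z - cnj z) = 0" unfolding 1 2 by simp
      then have "rpoly q v = 0" using nr[OF z(1)] by auto
      then show ?thesis using 1 by simp
    qed
    show ?thesis using rpoly_eq_0I[OF finW, of p] rpoly_eq_0I[OF finW, of q] dp pq unfolding e_def by blast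
  qed
  \<comment> \<open>The \<open>2 * e = d\<close> products of powers of \<open>b\<close> with
    \<open>1\<close> and with \<open>\<theta>\<close>; being independent, they span
    \<open>K\<close>, so that \<open>K = F + F \<theta>\<close>.\<close>
  define v where "v = (\<lambda>i. if i < e then b ^ i else b ^ (i - e) * \<theta>)"
  have split: "(\<Sum>i<d. of_rat (c i) * v i) =
      rpoly (\<Sum>i<e. monom (c i) i) b + rpoly (\<Sum>i<e. monom (c (e + i)) i) b * \<theta>" for c
  proof -
    have "(\<Sum>i<d. of_rat (c i) * v i) = (\<Sum>i<e. of_rat (c i) * v i) + (\<Sum>i<e. of_rat (c (e + i)) * v (e + i))"
      unfolding d2e mult_2 by (rule sum_lessThan_add)
    also have "\<dots> = (\<Sum>i<e. of_rat (c i) * b ^ i) + (\<Sum>i<e. of_rat (c (e + i)) * b ^ i) * \<theta>"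
      by (simp add: v_def sum_distrib_right mult.assoc)
    finally show ?thesis by (simp add: rpoly_sum)
  qed
  have ind: "c i = 0" if s: "(\<Sum>i<d. of_rat (c i) * v i) = 0" and i: "i < d" for c i
  proof -
    have z: "(\<Sum>i<e. monom (c i) i) = 0 \<and> (\<Sum>i<e. monom (c (e + i)) i) = 0"
      by (rule both) (use s split e0 in \<open>simp_all add: degree_sum_monom_less\<close>)
    show ?thesis
    proof (cases "i < e")
      case True
      then show ?thesis using coeff_sum_monom[of i e c] z by simp
    next
      case False
      then have "i - e < e" using i d2e by simp
      then show ?thesis using coeff_sum_monom[of "i - e" e "\<lambda>i. c (e + i)"] z False by simp
    qed
  qed
  have vK: "v i \<in> K" for i
    unfolding v_def using K_closed(9)[OF b] K_closed(4)[OF K_closed(9)[OF b] \<theta>_in_K] by simp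
  have decomp: "\<exists>p q. x = rpoly p b + rpoly q b * \<theta>" if x: "x \<in> K" for x
  proof -
    have "\<exists>c. x = (\<Sum>i<d. of_rat (c i) * v i)"
      by (rule independent_family_spans[OF vK _ x]) (rule ind)
    then obtain c where "x = (\<Sum>i<d. of_rat (c i) * v i)" by (elim exE)
    then show ?thesis unfolding split by (intro exI)
  qed
  have "\<theta> \<notin> F"
  proof
    assume "\<theta> \<in> F"
    then obtain p where p: "\<theta> = rpoly p b" unfolding F_def rat_adjoin_def by (rule imageE)
    obtain z where z: "z \<in> Em" using Em_nonempty by blast
    have "z = rpoly p (emb z b)" "cnj z = rpoly p (emb (cnj z) b)"
      using emb_rpoly[OF z b, of p] emb_rpoly[OF cnj_Em[OF z] b, of p] emb_\<theta>[OF z] emb_\<theta>[OF cnj_Em[OF z]]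
      unfolding p[symmetric] by simp_all
    moreover have "emb (cnj z) b = emb z b" using fibre[OF z] by blast
    ultimately show False using nr[OF z] by metis
  qed
  interpret A: ring "ring_of_type_algebra :: 'a ring" by (rule ring_from_type_algebra)
  have one: "A.line_extension F 1 {\<zero>\<^bsub>ring_of_type_algebra\<^esub>} = F"
    unfolding line_extension_ring_of_type_algebra by auto
  have two: "A.line_extension F \<theta> F = K"
  proof
    show "A.line_extension F \<theta> F \<subseteq> K" unfolding line_extension_ring_of_type_algebra
      using FK \<theta>_in_K K_closed(3,4) by blast
    show "K \<subseteq> A.line_extension F \<theta> F"
    proof
      fix x assume "x \<in> K"
      then obtain p q where "x = rpoly p b + rpoly q b * \<theta>" using decomp by blast
      then have "x = rpoly q b * \<theta> + rpoly p b" by (simp only: add.commute)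
      moreover have "rpoly q b \<in> F" "rpoly p b \<in> F" by (auto simp: F_def rat_adjoin_def)
      ultimately show "x \<in> A.line_extension F \<theta> F" unfolding line_extension_ring_of_type_algebra by blast
    qed
  qed
  \<comment> \<open>The inductive \<open>dimension\<close> is climbed in two steps: from
    \<open>{0}\<close> to \<open>F\<close> by \<open>1\<close>, and from \<open>F\<close> to
    \<open>K\<close> by \<open>\<theta>\<close>.\<close>
  have "A.dimension (Suc 0) F (A.line_extension F 1 {\<zero>\<^bsub>ring_of_type_algebra\<^esub>})"
    by (rule A.Suc_dim) (simp_all add: A.zero_dim[simplified])
  then have "A.dimension (Suc (Suc 0)) F (A.line_extension F \<theta> F)"
    unfolding one using \<open>\<theta> \<notin> F\<close> by (intro A.Suc_dim) simp_all
  then have "A.dimension 2 F K" unfolding two by (simp add: numeral_2_eq_2)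
  then show ?thesis unfolding CM_field_def using K no_real tr FK by blast
qed

text \<open>As \<open>n > 0\<close>, equal values of \<open>g ^ n\<close> force equal absolute
  values of \<open>g\<close>, so a coincidence can only join \<open>z\<close> and
  \<open>cnj z\<close>. By \<open>emb_fibres\<close> one coincidence spreads to every root, which is
  then nonreal and gives \<open>g ^ n\<close> a real value.\<close>

lemma non_CM_power_injective:
  assumes nCM: "\<not> CM_field K" and g: "g \<in> Ok" and n: "n > 0"
    and sep: "\<And>z w. z \<in> Em \<Longrightarrow> w \<in> Em \<Longrightarrow> w \<noteq> z \<Longrightarrow> w \<noteq> cnj z \<Longrightarrow> norm (emb z g) \<noteq> norm (emb w g)"
  shows "inj_on (\<lambda>z. emb z (g ^ n)) Em"
proof (rule ccontr)
  assume "\<not> ?thesis"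
  then obtain z0 w0 where zw: "z0 \<in> Em" "w0 \<in> Em" "w0 \<noteq> z0" "emb w0 (g ^ n) = emb z0 (g ^ n)"
    unfolding inj_on_def by metis
  have gK: "g \<in> K" by (rule Ok_subset[OF g])
  have gnK: "g ^ n \<in> K" by (rule K_closed(9)[OF gK])
  have fib: "w = z \<or> w = cnj z" if h: "z \<in> Em" "w \<in> Em" "emb w (g ^ n) = emb z (g ^ n)" for z w
  proof -
    have "norm (emb w g) ^ n = norm (emb z g) ^ n"
      using h emb_power[OF _ gK] by (simp add: norm_power[symmetric])
    then have "norm (emb w g) = norm (emb z g)" using n by (simp add: power_eq_iff_eq_base)
    then show ?thesis using sep[OF h(1,2)] by metis
  qed
  have cn: "cnj z \<noteq> z \<and> emb (cnj z) (g ^ n) = emb z (g ^ n)" if z: "z \<in> Em" for z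
  proof -
    obtain v where v: "v \<in> Em" "v \<noteq> z" "emb v (g ^ n) = emb z (g ^ n)"
      using emb_fibres[OF gnK zw z] by blast
    then have "v = cnj z" using fib[OF z] by blast
    then show ?thesis using v by blast
  qed
  have "CM_field K"
  proof (rule CM_fieldI[OF gnK _ _ fib])
    fix z assume z: "z \<in> Em"
    show "cnj z \<noteq> z" using cn[OF z] by blast
    show "emb z (g ^ n) \<in> \<real>" using cn[OF z] by (simp add: emb_cnj Reals_cnj_iff)
  qed
  then show False using nCM by blast
qed

section \<open>The index in the ring of S-integers\<close>

lemma S_integers_ring:
  assumes \<delta>: "\<delta> \<in> Ok" and A: "A = {x \<in> K. \<exists>k. \<delta> ^ k * x \<in> Ok}"
  shows "Ok \<subseteq> A" "x \<in> A \<Longrightarrow> y \<in> A \<Longrightarrow> x + y \<in> A" "x \<in> A \<Longrightarrow> y \<in> A \<Longrightarrow> x * y \<in> A" "x \<in> A \<Longrightarrow> - x \<in> A"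
proof -
  show "Ok \<subseteq> A"
  proof
    fix x assume x: "x \<in> Ok"
    then have "\<delta> ^ 0 * x \<in> Ok" by simp
    then show "x \<in> A" unfolding A using Ok_subset[OF x] by blast
  qed
  have AI: "x \<in> A" if "x \<in> K" "\<delta> ^ k * x \<in> Ok" for x k unfolding A using that by blast
  have AK: "x \<in> K" if "x \<in> A" for x using that unfolding A by blast
  have AE: "\<exists>k. \<delta> ^ k * x \<in> Ok" if "x \<in> A" for x using that unfolding A by blast
  {
    assume x: "x \<in> A" and y: "y \<in> A"
    obtain k where k: "\<delta> ^ k * x \<in> Ok" using AE[OF x] by blast
    obtain l where l: "\<delta> ^ l * y \<in> Ok" using AE[OF y] by blast
    have "\<delta> ^ (k + l) * (x + y) = \<delta> ^ l * (\<delta> ^ k * x) + \<delta> ^ k * (\<delta> ^ l * y)"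
      by (simp add: power_add algebra_simps)
    moreover have "\<delta> ^ l * (\<delta> ^ k * x) + \<delta> ^ k * (\<delta> ^ l * y) \<in> Ok"
      by (rule Ok_closed(3)[OF Ok_closed(4)[OF Ok_closed(7)[OF \<delta>] k] Ok_closed(4)[OF Ok_closed(7)[OF \<delta>] l]])
    ultimately show "x + y \<in> A" using AI[OF K_closed(3)[OF AK[OF x] AK[OF y]]] by metis
    have "\<delta> ^ (k + l) * (x * y) = (\<delta> ^ k * x) * (\<delta> ^ l * y)"
      by (simp add: power_add algebra_simps)
    then show "x * y \<in> A" using AI[OF K_closed(4)[OF AK[OF x] AK[OF y]]] Ok_closed(4)[OF k l] by metis
  }
  show "- x \<in> A" if x: "x \<in> A"
  proof -
    obtain k where k: "\<delta> ^ k * x \<in> Ok" using AE[OF x] by blast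
    have "\<delta> ^ k * (- x) = - (\<delta> ^ k * x)" by simp
    then show ?thesis using AI[OF K_closed(5)[OF AK[OF x]]] Ok_closed(5)[OF k] by metis
  qed
qed

text \<open>\<open>A\<close> need not be finitely generated as a group, so an inclusion of
  \<open>D Ok\<close> in \<open>H\<close> does not bound the index at once. But finitely many coset
  representatives are brought into \<open>Ok\<close> by a common power of \<open>b\<close>, which is
  invertible in \<open>H\<close>; two of them congruent modulo \<open>D\<close> define the same
  coset. So there are at most \<open>card Rs\<close> cosets.\<close>

lemma finite_index_int_adjoin_inverse:
  assumes b: "b \<in> Ok" "b \<noteq> 0" and prim: "primitive_number_field K b g"
    and A: "A = {x \<in> K. \<exists>k. b ^ k * x \<in> Ok}"
  shows "additive_subgroup (int_adjoin (inverse b)) (subring_of A) \<and>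
    finite (a_rcosets\<^bsub>subring_of A\<^esub> int_adjoin (inverse b))"
proof -
  define H where "H = int_adjoin (inverse b)"
  note R = S_integers_ring[OF b(1) A]
  note HI = int_adjoin_ring[where x = "inverse b", folded H_def]
  have bK: "b \<in> K" by (rule Ok_subset[OF b(1)])
  have "b ^ 1 * inverse b \<in> Ok" using b(2) Ok_closed(2) by simp
  then have ibA: "inverse b \<in> A" unfolding A using K_closed(6)[OF bK] by blast
  have "of_int k \<in> A" for k using R(1) Ok_closed(8) by blast
  then have HA: "H \<subseteq> A" unfolding H_def by (intro int_adjoin_least ibA R(2,3))
  have sub: "additive_subgroup H (subring_of A)"
  proof (rule subring_of_additive_subgroup)
    show "0 \<in> A" using R(1) Ok_closed(1) by blast
    show "0 \<in> H" by (rule int_adjoin_ring(2)[where x = "inverse b", folded H_def])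
  qed (use R(2,4) HA HI in auto)
  have bH: "b \<in> H" unfolding H_def
    by (rule algebraic_int_in_adjoin_inverse) (use b Ok_iff in auto)
  have ibH: "inverse b \<in> H" unfolding H_def by (rule int_adjoin_ring(3))
  have "int_adjoin b \<subseteq> H"
    by (rule int_adjoin_least[OF bH]) (use int_adjoin_ring(4,5,7)[where x = "inverse b", folded H_def] H_def int_adjoin_ring(7) in auto)
  \<comment> \<open>\<open>prim\<close> is a second instance of the locale, with generator
    \<open>b\<close>; its ring of integers depends on \<open>K\<close> alone, so its common
    denominator for \<open>\<int>[b]\<close> can be used here.\<close>
  moreover have "primitive_number_field.Ok K = Ok"
    unfolding primitive_number_field.Ok_def[OF prim] Ok_def ..
  ultimately obtain D where D: "D > 0" "\<And>x. x \<in> Ok \<Longrightarrow> of_int D * x \<in> H"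
    using primitive_number_field.Ok_multiple_in_int_adjoin[OF prim] by auto
  obtain Rs where Rs: "finite Rs" "Rs \<subseteq> Ok" "\<forall>x\<in>Ok. \<exists>y\<in>Ok. x - of_int D * y \<in> Rs"
    using finite_residues_Ok[OF D(1)] by blast
  have "finite (a_rcosets\<^bsub>subring_of A\<^esub> H)"
  proof (rule ccontr)
    assume inf: "infinite (a_rcosets\<^bsub>subring_of A\<^esub> H)"
    then obtain Z where Z: "finite Z" "card Z = Suc (card Rs)" "Z \<subseteq> a_rcosets\<^bsub>subring_of A\<^esub> H"
      using infinite_arbitrarily_large by metis
    have "\<forall>c\<in>Z. \<exists>x. x \<in> A \<and> c = H +>\<^bsub>subring_of A\<^esub> x"
      using Z(3) by (auto simp: A_RCOSETS_def RCOSETS_def a_r_coset_def)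
    then have "\<exists>x. \<forall>c\<in>Z. x c \<in> A \<and> c = H +>\<^bsub>subring_of A\<^esub> x c" by (rule bchoice)
    then obtain x where x: "\<forall>c\<in>Z. x c \<in> A \<and> c = H +>\<^bsub>subring_of A\<^esub> x c" by (elim exE)
    have "\<forall>c\<in>Z. \<exists>k. b ^ k * x c \<in> Ok" using x unfolding A by blast
    then have "\<exists>k. \<forall>c\<in>Z. b ^ k c * x c \<in> Ok" by (rule bchoice)
    then obtain k where k: "\<forall>c\<in>Z. b ^ k c * x c \<in> Ok" by (elim exE)
    define m where "m = (\<Sum>c\<in>Z. k c)"
    have m: "b ^ m * x c \<in> Ok" if c: "c \<in> Z" for c
    proof -
      have "k c \<le> m" unfolding m_def by (rule member_le_sum[OF c]) (use Z(1) in auto)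
      then have "b ^ m = b ^ (m - k c) * b ^ k c" by (simp add: power_add[symmetric])
      then have eq: "b ^ m * x c = b ^ (m - k c) * (b ^ k c * x c)" by (simp only: mult.assoc)
      show ?thesis unfolding eq by (rule Ok_closed(4)[OF Ok_closed(7)[OF b(1)] bspec[OF k c]])
    qed
    have "\<forall>c\<in>Z. \<exists>y. y \<in> Ok \<and> b ^ m * x c - of_int D * y \<in> Rs" using Rs(3) m by blast
    then have "\<exists>y. \<forall>c\<in>Z. y c \<in> Ok \<and> b ^ m * x c - of_int D * y c \<in> Rs" by (rule bchoice)
    then obtain y where y: "\<forall>c\<in>Z. y c \<in> Ok \<and> b ^ m * x c - of_int D * y c \<in> Rs" by (elim exE)
    define h where "h = (\<lambda>c. b ^ m * x c - of_int D * y c)"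
    have "h ` Z \<subseteq> Rs" using y by (auto simp: h_def)
    then have "card (h ` Z) \<le> card Rs" by (rule card_mono[OF Rs(1)])
    then have "card (h ` Z) < card Z" using Z(2) by simp
    then have "\<not> inj_on h Z" by (rule pigeonhole)
    then obtain c c' where cc: "c \<in> Z" "c' \<in> Z" "c \<noteq> c'" "h c = h c'" unfolding inj_on_def by blast
    have "b ^ m * (x c - x c') = of_int D * (y c - y c')" using cc(4) by (simp add: h_def algebra_simps)
    moreover have "y c - y c' \<in> Ok" using y cc(1,2) by (intro Ok_closed(6)) auto
    ultimately have "b ^ m * (x c - x c') \<in> H" using D(2) by simp
    then have "inverse b ^ m * (b ^ m * (x c - x c')) \<in> H"
      using int_adjoin_ring(5,8)[where x = "inverse b", folded H_def] ibH by blast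
    moreover have "inverse b ^ m * (b ^ m * (x c - x c')) = x c - x c'"
      using b(2) by (simp add: mult.assoc[symmetric] power_mult_distrib[symmetric])
    ultimately have "x c - x c' \<in> H" by simp
    then have "H +>\<^bsub>subring_of A\<^esub> x c = H +>\<^bsub>subring_of A\<^esub> x c'"
      using int_adjoin_ring(4,6)[where x = "inverse b", folded H_def] by (intro subring_of_coset_eqI)
    then show False using x cc(1-3) by metis
  qed
  then show ?thesis using sub unfolding H_def by blast
qed

end

theorem theorem2:
  fixes K :: "'a::field_char_0 set"
    and S :: "(('a \<Rightarrow> complex) set + 'a set) set"
  assumes "number_field K"
    and "\<not> CM_field K"
    and "S \<subseteq> primes_of K"
    and "finite S"
    and "Inl ` infinite_primes K \<subseteq> S"
    and "card S \<ge> 2"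
  shows "\<exists>\<alpha>\<in>Units (subring_of (S_integers K S)). \<forall>n::nat. n > 0 \<longrightarrow>
    additive_subgroup (int_adjoin (\<alpha> ^ n)) (subring_of (S_integers K S)) \<and>
    finite (a_rcosets\<^bsub>subring_of (S_integers K S)\<^esub> int_adjoin (\<alpha> ^ n))"
proof -
  obtain \<theta> f where "primitive_number_field K \<theta> f" using number_field_imp_primitive[OF assms(1)] by blast
  then interpret primitive_number_field K \<theta> f .
  define T where "T = {P \<in> finite_primes K. Inr P \<in> S}"
  have "finite (Inr -` S)" by (rule finite_vimageI[OF assms(4)]) simp
  then have T: "finite T" "T \<subseteq> finite_primes K" by (auto intro: finite_subset[rotated] simp: T_def)
  from exists_element_with_primes[OF T] obtain \<delta> where \<delta>12: "\<delta> \<in> Ok" "\<delta> \<noteq> 0"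
    and \<delta>3: "\<forall>P\<in>finite_primes K. \<delta> \<in> P \<longleftrightarrow> P \<in> T" by (elim bexE conjE)
  note \<delta> = \<delta>12 bspec[OF \<delta>3]
  \<comment> \<open>All pairs of roots belonging to different infinite primes; conjugate roots
    cannot be told apart by absolute values.\<close>
  define Q where "Q = {(z, w) \<in> Em \<times> Em. w \<noteq> z \<and> w \<noteq> cnj z}"
  have "finite Q" by (rule finite_subset[of _ "Em \<times> Em"]) (auto simp: Q_def)
  then have "\<exists>\<gamma>\<in>Ok. \<gamma> \<noteq> 0 \<and> (\<forall>P\<in>finite_primes K. \<gamma> \<in> P \<longleftrightarrow> \<delta> \<in> P) \<and>
    (\<forall>(z, w)\<in>Q. norm (emb z \<gamma>) \<noteq> norm (emb w \<gamma>))"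
    by (rule exists_separated_multiple[OF \<delta>(1,2)]) (auto simp: Q_def)
  then obtain \<gamma> where \<gamma>: "\<gamma> \<in> Ok" "\<gamma> \<noteq> 0" and \<gamma>P: "\<forall>P\<in>finite_primes K. \<gamma> \<in> P \<longleftrightarrow> \<delta> \<in> P"
    and sep: "\<forall>(z, w)\<in>Q. norm (emb z \<gamma>) \<noteq> norm (emb w \<gamma>)" by (elim bexE conjE)
  have prim: "\<gamma> \<in> P \<longleftrightarrow> Inr P \<in> S" if "P \<in> finite_primes K" for P
    using \<gamma>P \<delta>(3)[OF that] that by (simp add: T_def)
  have A: "S_integers K S = {x \<in> K. \<exists>k. \<gamma> ^ k * x \<in> Ok}"
    by (rule S_integers_eq[OF \<gamma> prim])
  \<comment> \<open>\<open>\<gamma> ^ n\<close> lies in the same primes as \<open>\<gamma>\<close>,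
    so inverting either gives the same ring; the index is computed with
    \<open>\<gamma> ^ n\<close>.\<close>
  have An: "S_integers K S = {x \<in> K. \<exists>k. (\<gamma> ^ n) ^ k * x \<in> Ok}" if n: "n > 0" for n
  proof (rule S_integers_eq)
    show "\<gamma> ^ n \<in> Ok" "\<gamma> ^ n \<noteq> 0" using \<gamma> Ok_closed(7) by auto
    fix P assume P: "P \<in> finite_primes K"
    have "\<gamma> ^ n \<in> P \<longleftrightarrow> \<gamma> \<in> P"
    proof
      assume "\<gamma> ^ n \<in> P"
      then show "\<gamma> \<in> P" by (rule prime_power_mem[OF P \<gamma>(1)])
    next
      assume "\<gamma> \<in> P"
      then have "\<gamma> * \<gamma> ^ (n - 1) \<in> P" by (rule is_idealD(5)[OF finite_primesD(1)[OF P] _ Ok_closed(7)[OF \<gamma>(1)]])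
      then show "\<gamma> ^ n \<in> P" using n by (cases n) simp_all
    qed
    then show "\<gamma> ^ n \<in> P \<longleftrightarrow> Inr P \<in> S" using prim[OF P] by simp
  qed
  have "\<gamma> ^ 1 * inverse \<gamma> \<in> Ok" using \<gamma>(2) Ok_closed(2) by simp
  then have "inverse \<gamma> \<in> S_integers K S" unfolding A using K_closed(6)[OF Ok_subset[OF \<gamma>(1)]] by blast
  moreover have "\<gamma> \<in> S_integers K S" using S_integers_ring(1)[OF \<gamma>(1) A] \<gamma>(1) by blast
  ultimately have "inverse \<gamma> \<in> Units (subring_of (S_integers K S))"
    using \<gamma>(2) by (auto simp: Units_def intro!: bexI[of _ \<gamma>])
  moreover have "additive_subgroup (int_adjoin (inverse \<gamma> ^ n)) (subring_of (S_integers K S)) \<and>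
    finite (a_rcosets\<^bsub>subring_of (S_integers K S)\<^esub> int_adjoin (inverse \<gamma> ^ n))" if n: "n > 0" for n
  proof -
    have g: "\<gamma> ^ n \<in> Ok" "\<gamma> ^ n \<noteq> 0" using \<gamma> Ok_closed(7) by auto
    have "inj_on (\<lambda>z. emb z (\<gamma> ^ n)) Em"
    proof (rule non_CM_power_injective[OF assms(2) \<gamma>(1) n])
      fix z w assume "z \<in> Em" "w \<in> Em" "w \<noteq> z" "w \<noteq> cnj z"
      then have "(z, w) \<in> Q" by (simp add: Q_def)
      then show "norm (emb z \<gamma>) \<noteq> norm (emb w \<gamma>)" using bspec[OF sep] by fast
    qed
    then obtain g where "primitive_number_field K (\<gamma> ^ n) g"
      using emb_injective_imp_primitive[OF g(1)] by blast
    from finite_index_int_adjoin_inverse[OF g this An[OF n]] show ?thesis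
      by (simp only: power_inverse)
  qed
  ultimately show ?thesis by blast
qed

end
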